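(* Let $G$ be a finite group. If $A$ is a solvable submodular subgroup of $G$, then $A\le G_{\mathfrak{S}}$. In particular, if $A$ is a solvable submodular subgroup of $G$, then $\langle A,B\rangle$ is solvable for any solvable subgroup $B$ of $G$.
   Context: All groups are finite. $G_{\mathfrak{S}}$ denotes the solvable radical of $G$, i.e. the largest normal solvable subgroup of $G$. A subgroup $M$ of $G$ is modular in $G$ if it is a modular element of the lattice of subgroups of $G$, i.e. $\langle X, M\cap Z\rangle=\langle X,M\rangle\cap Z$ for all subgroups $X\le Z$ of $G$, and $\langle M, Y\cap Z\rangle=\langle M,Y\rangle\cap Z$ for all subgroups $Y,Z$ of $G$ with $M\le Z$. A subgroup $H$ of $G$ is submodular in $G$ if there is a chain of subgroups $H=H_0\le H_1\le\dots\le H_n=G$ such that $H_i$ is a modular subgroup of $H_{i+1}$ for every $i$. *)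

theory Defs
  imports "HOL-Algebra.Solvable_Groups" "HOL-Algebra.SndIsomorphismGrp"
begin

definition modular_subgroup :: "'a set \<Rightarrow> ('a, 'b) monoid_scheme \<Rightarrow> bool" where
  "modular_subgroup M G \<longleftrightarrow>
     subgroup M G \<and>
     (\<forall>X Z. subgroup X G \<longrightarrow> subgroup Z G \<longrightarrow> X \<subseteq> Z \<longrightarrow>
        generate G (X \<union> (M \<inter> Z)) = generate G (X \<union> M) \<inter> Z) \<and>
     (\<forall>Y Z. subgroup Y G \<longrightarrow> subgroup Z G \<longrightarrow> M \<subseteq> Z \<longrightarrow>
        generate G (M \<union> (Y \<inter> Z)) = generate G (M \<union> Y) \<inter> Z)"

definition submodular_subgroup :: "'a set \<Rightarrow> ('a, 'b) monoid_scheme \<Rightarrow> bool" where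
  "submodular_subgroup A G \<longleftrightarrow>
     (\<exists>(n::nat) H. H 0 = A \<and> H n = carrier G \<and>
        (\<forall>i\<le>n. subgroup (H i) G) \<and>
        (\<forall>i<n. H i \<subseteq> H (Suc i) \<and> modular_subgroup (H i) (G\<lparr>carrier := H (Suc i)\<rparr>)))"

text \<open>The greatest element, with respect to inclusion, among the normal solvable subgroups. It
  exists for every finite group, see \<open>solvable_radical_greatest\<close> below; for groups in which there
  is no greatest such subgroup the value is unspecified.\<close>

definition solvable_radical :: "('a, 'b) monoid_scheme \<Rightarrow> 'a set" where
  "solvable_radical G = (GREATEST N. N \<lhd> G \<and> solvable (G\<lparr>carrier := N\<rparr>))"

lemma (in group) exp_of_derived_consistent:
  assumes "subgroup H G"
  shows "(derived (G\<lparr>carrier := H\<rparr>) ^^ n) H = (derived G ^^ n) H \<and> (derived G ^^ n) H \<subseteq> H"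
proof (induction n)
  case 0
  then show ?case by simp
next
  case (Suc n)
  then show ?case
    using derived_consistent[OF _ assms] derived_incl[OF _ assms] by simp
qed

lemma (in group) solvable_restrict_iff:
  assumes "subgroup H G"
  shows "solvable (G\<lparr>carrier := H\<rparr>) \<longleftrightarrow> solvable_seq G H"
proof -
  interpret H: group "G\<lparr>carrier := H\<rparr>"
    using subgroup_imp_group[OF assms] .
  have "solvable (G\<lparr>carrier := H\<rparr>) \<longleftrightarrow> (\<exists>n. (derived G ^^ n) H = {\<one>})"
    using H.solvable_iff_trivial_derived_seq exp_of_derived_consistent[OF assms] by simp
  also have "\<dots> \<longleftrightarrow> solvable_seq G H"
    using trivial_derived_seq_imp_solvable[OF assms] solvable_imp_trivial_derived_seq by blast
  finally show ?thesis .
qed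

lemma (in group) solvable_seq_normal_mult:
  assumes N: "N \<lhd> G" "solvable_seq G N" and M: "subgroup M G" "solvable_seq G M"
  shows "solvable_seq G (N <#> M)"
proof -
  interpret N: normal N G by (rule N(1))
  have hom: "group_hom G (G Mod N) ((#>) N)"
    using N.r_coset_hom_Mod N.factorgroup_is_group
    by (simp add: group_hom_def group_hom_axioms_def)
  have id: "group_hom G G id"
    by (simp add: group_hom_def group_hom_axioms_def hom_def)
  have img: "(#>) N ` (N <#> M) = (#>) N ` M"
  proof -
    have Mc: "m \<in> carrier G" if "m \<in> M" for m
      using subgroup.mem_carrier[OF M(1) that] .
    have eq: "N #> (n \<otimes> m) = N #> m" if "n \<in> N" "m \<in> M" for n m
    proof -
      have "n \<in> carrier G" using N.mem_carrier[OF that(1)] .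
      then have "N #> (n \<otimes> m) = (N #> n) #> m"
        using coset_mult_assoc[OF N.subset] Mc[OF that(2)] by simp
      then show ?thesis
        using N.rcos_const[OF is_group that(1)] by simp
    qed
    have mult: "N <#> M = {n \<otimes> m |n m. n \<in> N \<and> m \<in> M}"
      unfolding set_mult_def by blast
    show ?thesis
    proof (intro equalityI subsetI)
      fix y assume "y \<in> (#>) N ` (N <#> M)"
      then obtain n m where "n \<in> N" "m \<in> M" "y = N #> (n \<otimes> m)"
        unfolding mult by blast
      then show "y \<in> (#>) N ` M"
        using eq by (metis imageI)
    next
      fix y assume "y \<in> (#>) N ` M"
      then obtain m where m: "m \<in> M" "y = N #> m"
        by blast
      then have "y = N #> (\<one> \<otimes> m)" "\<one> \<otimes> m \<in> N <#> M"
        using eq[OF N.one_closed m(1)] N.one_closed unfolding mult by (simp, blast)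
      then show "y \<in> (#>) N ` (N <#> M)"
        by (metis imageI)
    qed
  qed
  have ker: "kernel G (G Mod N) ((#>) N) \<subseteq> id ` N"
  proof
    fix x assume "x \<in> kernel G (G Mod N) ((#>) N)"
    then have x: "x \<in> carrier G" "N #> x = N"
      by (simp_all add: kernel_def FactGroup_def)
    then show "x \<in> id ` N"
      using coset_join1[OF x(2) x(1) N.is_subgroup] by simp
  qed
  have snd: "second_isomorphism_grp N G M"
    by (simp add: second_isomorphism_grp_def second_isomorphism_grp_axioms_def N(1) M(1))
  have "id ` N \<subseteq> N <#> M"
    using second_isomorphism_grp.H_contained_in_set_mult[OF snd] by simp
  moreover have "solvable_seq (G Mod N) ((#>) N ` (N <#> M))"
    unfolding img by (rule group_hom.solvable_imp_solvable_img[OF hom M(2)])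
  ultimately show ?thesis
    using solvable_seq_condition[OF id hom _ ker _ N(2)]
      second_isomorphism_grp.normal_set_mult_subgroup[OF snd] by blast
qed

lemma (in group) solvable_radical_greatest:
  assumes "finite (carrier G)"
  shows "solvable_radical G \<lhd> G"
    and "solvable (G\<lparr>carrier := solvable_radical G\<rparr>)"
    and "\<And>N. N \<lhd> G \<Longrightarrow> solvable (G\<lparr>carrier := N\<rparr>) \<Longrightarrow> N \<subseteq> solvable_radical G"
proof -
  define P where "P N \<longleftrightarrow> N \<lhd> G \<and> solvable (G\<lparr>carrier := N\<rparr>)" for N
  have P_iff: "P N \<longleftrightarrow> N \<lhd> G \<and> solvable_seq G N" for N
    unfolding P_def using solvable_restrict_iff normal_imp_subgroup by blast
  have "Collect P \<subseteq> Pow (carrier G)"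
    using normal_imp_subgroup subgroup.subset unfolding P_def by blast
  then have fin: "finite (Collect P)"
    using assms finite_subset by auto
  have "P {\<one>}"
    unfolding P_iff using one_is_normal solvable_seq.unity by blast
  then obtain R where R: "P R" and max: "\<And>N. P N \<Longrightarrow> R \<subseteq> N \<Longrightarrow> R = N"
    using finite_has_maximal[OF fin] by auto
  have le: "N \<subseteq> R" if "P N" for N
  proof -
    have "second_isomorphism_grp R G N" "second_isomorphism_grp N G R"
      using R that normal_imp_subgroup unfolding P_def
      by (auto simp: second_isomorphism_grp_def second_isomorphism_grp_axioms_def)
    then have "R \<subseteq> R <#> N" "N \<subseteq> R <#> N"
      using second_isomorphism_grp.H_contained_in_set_mult
        second_isomorphism_grp.S_contained_in_set_mult by blast+
    moreover have "P (R <#> N)"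
      using R that normal_subgroup_set_mult_closed solvable_seq_normal_mult normal_imp_subgroup
      unfolding P_iff by blast
    ultimately show ?thesis using max by blast
  qed
  have "solvable_radical G = R"
    unfolding solvable_radical_def P_def[symmetric] using R le by (intro Greatest_equality) auto
  then show "solvable_radical G \<lhd> G" "solvable (G\<lparr>carrier := solvable_radical G\<rparr>)"
    "\<And>N. N \<lhd> G \<Longrightarrow> solvable (G\<lparr>carrier := N\<rparr>) \<Longrightarrow> N \<subseteq> solvable_radical G"
    using R le unfolding P_def by auto
qed

end

theory Submission
  imports Defs "HOL-Algebra.Sylow" "HOL-Algebra.Multiplicative_Group"
begin

text \<open>
  Along a chain of modular subgroups it suffices that the solvable radical can only grow at each
  step: if \<open>M\<close> is modular in \<open>G\<close>, then the solvable radical of \<open>M\<close> lies in that of \<open>G\<close>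
  (\<open>radical_of_modular\<close>). For normal \<open>M\<close> this is clear, since the radical of \<open>M\<close> is characteristic
  in \<open>M\<close>. In general the step from \<open>M\<close> to \<open>G\<close> is refined: either a proper normal subgroup contains
  \<open>M\<close>, or there is a proper subgroup \<open>L\<close> above \<open>M\<close> such that every subgroup \<open>Y\<close> of \<open>G\<close> is contained
  in \<open>L\<close> or meets it in a maximal subgroup of \<open>Y\<close> (\<open>modular_dichotomy\<close>). By induction on the order
  the radical of \<open>M\<close> lies in that of \<open>L\<close>, so that only the step from \<open>L\<close> to \<open>G\<close> remains.

  In the second case all subgroups of \<open>G\<close> act primitively on each of their orbits on the cosets of
  \<open>L\<close>. Such an action is very small: modulo its kernel \<open>G\<close> has prime order, or order \<open>r * e\<close> for
  primes \<open>e < r\<close> with a normal subgroup of order \<open>r\<close>, and \<open>L\<close> has index \<open>r\<close>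
  (\<open>hereditarily_primitive_frobenius\<close>). In particular the second derived subgroup of \<open>G\<close> lies in a
  normal subgroup \<open>N\<close> of \<open>G\<close> below \<open>L\<close>. A solvable normal subgroup \<open>S\<close> of \<open>L\<close> then centralizes \<open>N\<close>
  modulo the radical \<open>R\<close> of \<open>N\<close>, and the centralizer of \<open>N\<close> modulo \<open>R\<close> is normal and solvable: its
  second derived subgroup lies in \<open>N\<close>, where it is central modulo \<open>R\<close>. Hence \<open>S\<close> lies in the radical
  of \<open>G\<close> (\<open>radical_of_metabelian_quotient\<close>).

  The structure theorem is proved by induction on the order. One may pass to the quotient by the
  kernel, so let the action be faithful; all proper subgroups have the claimed structure on each
  orbit. If \<open>G\<close> has a nontrivial abelian normal subgroup, then this subgroup is regular of prime
  order and the claim follows (\<open>frobenius_of_abelian_normal\<close>). Otherwise let \<open>p\<close> be the largest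
  prime divisor of the order of a point stabilizer \<open>M\<close>. Two commuting elements of distinct prime
  orders have disjoint supports (\<open>commuting_disjoint_support\<close>). Together with the structure of \<open>M\<close>
  and of the centralizers of elements of order \<open>p\<close> this shows that \<open>M\<close> has a normal subgroup of
  order \<open>p\<close> that is semiregular on the remaining points, and that \<open>M\<close> has order \<open>p\<close> or \<open>p * q\<close> for a
  prime \<open>q < p\<close>, where two distinct point stabilizers meet in a subgroup of order \<open>1\<close> or \<open>q\<close>
  (\<open>point_meet_card\<close>). Since no nontrivial abelian subgroup is normal, the normalizers of subgroups
  of prime order and of a subgroup of order \<open>q\<^sup>2\<close> are proper, and their structure shows that they
  are small. In each case the conjugates of two or three such subgroups, for which the sets of
  nontrivial elements are disjoint, have more than \<open>|G| - 1\<close> nontrivial elements in total, a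
  contradiction.
\<close>

section \<open>Conjugation, normalizers and subgroups of prime index\<close>

definition conj_by :: "('a, 'b) monoid_scheme \<Rightarrow> 'a \<Rightarrow> 'a \<Rightarrow> 'a" where
  "conj_by G g x = g \<otimes>\<^bsub>G\<^esub> x \<otimes>\<^bsub>G\<^esub> inv\<^bsub>G\<^esub> g"

definition normalizer_of :: "('a, 'b) monoid_scheme \<Rightarrow> 'a set \<Rightarrow> 'a set" where
  "normalizer_of G H = {g \<in> carrier G. conj_by G g ` H = H}"

definition centralizer_of :: "('a, 'b) monoid_scheme \<Rightarrow> 'a \<Rightarrow> 'a set" where
  "centralizer_of G x = {c \<in> carrier G. c \<otimes>\<^bsub>G\<^esub> x = x \<otimes>\<^bsub>G\<^esub> c}"

context group
begin

lemma cancel_inv [simp]: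
  assumes "x \<in> carrier G" "y \<in> carrier G"
  shows "x \<otimes> (inv x \<otimes> y) = y" "inv x \<otimes> (x \<otimes> y) = y"
  using assms by (simp_all flip: m_assoc)

lemma conj_simps:
  assumes "g \<in> carrier G" "h \<in> carrier G" "x \<in> carrier G" "y \<in> carrier G"
  shows "conj_by G g x \<in> carrier G"
    and "conj_by G (g \<otimes> h) x = conj_by G g (conj_by G h x)"
    and "conj_by G g (x \<otimes> y) = conj_by G g x \<otimes> conj_by G g y"
    and "conj_by G g (inv x) = inv (conj_by G g x)"
    and "conj_by G (inv g) (conj_by G g x) = x"
    and "conj_by G g (conj_by G (inv g) x) = x"
    and "conj_by G \<one> x = x"
  using assms by (simp_all add: conj_by_def m_assoc inv_mult_group)

lemma conj_closed [simp]: "g \<in> carrier G \<Longrightarrow> x \<in> carrier G \<Longrightarrow> conj_by G g x \<in> carrier G"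
  by (simp add: conj_by_def)

lemma conj_one [simp]: "g \<in> carrier G \<Longrightarrow> conj_by G g \<one> = \<one>"
  by (simp add: conj_by_def)

lemma conj_pow:
  assumes "g \<in> carrier G" "x \<in> carrier G"
  shows "conj_by G g (x [^] (n::nat)) = conj_by G g x [^] n"
proof (induction n)
  case 0 then show ?case using assms by simp
next
  case (Suc n)
  then show ?case using assms conj_simps(3)[of g g "x [^] n" x] by simp
qed

lemma inj_on_conj: "g \<in> carrier G \<Longrightarrow> inj_on (conj_by G g) (carrier G)"
  by (metis (no_types, lifting) conj_simps(5) inj_onI)

lemma conj_image_comp:
  assumes "g \<in> carrier G" "h \<in> carrier G" "X \<subseteq> carrier G"
  shows "conj_by G g ` conj_by G h ` X = conj_by G (g \<otimes> h) ` X"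
  unfolding image_image using assms conj_simps(2)[of g h] by (intro image_cong) auto

lemma conj_image_one: "X \<subseteq> carrier G \<Longrightarrow> conj_by G \<one> ` X = X"
proof -
  assume "X \<subseteq> carrier G"
  then have "conj_by G \<one> ` X = (\<lambda>x. x) ` X"
    by (intro image_cong) (auto simp: conj_by_def)
  then show ?thesis by simp
qed

lemma conj_image_subset: "g \<in> carrier G \<Longrightarrow> X \<subseteq> carrier G \<Longrightarrow> conj_by G g ` X \<subseteq> carrier G"
  by auto

lemma conj_image_inv:
  assumes "g \<in> carrier G" "X \<subseteq> carrier G"
  shows "conj_by G (inv g) ` conj_by G g ` X = X" "conj_by G g ` conj_by G (inv g) ` X = X"
  using assms by (simp_all only: conj_image_comp conj_image_one inv_closed l_inv r_inv)

lemma card_conj_image: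
  assumes "g \<in> carrier G" "X \<subseteq> carrier G"
  shows "card (conj_by G g ` X) = card X"
  using card_image[OF inj_on_subset[OF inj_on_conj]] assms by blast

lemma subgroup_conj_image:
  assumes "g \<in> carrier G" "subgroup H G"
  shows "subgroup (conj_by G g ` H) G"
proof -
  have H: "H \<subseteq> carrier G" using assms(2) subgroup.subset by blast
  show ?thesis
  proof (rule subgroupI)
    show "conj_by G g ` H \<subseteq> carrier G" using H assms(1) by auto
    show "conj_by G g ` H \<noteq> {}" using subgroup.one_closed[OF assms(2)] by blast
  next
    fix a assume "a \<in> conj_by G g ` H"
    then obtain x where x: "x \<in> H" "a = conj_by G g x" by blast
    then have "inv a = conj_by G g (inv x)" using conj_simps(4)[of g g x x] H assms(1) by (auto simp: subset_iff)
    then show "inv a \<in> conj_by G g ` H" using x assms(2) by (simp add: subgroup.m_inv_closed)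
  next
    fix a b assume "a \<in> conj_by G g ` H" "b \<in> conj_by G g ` H"
    then obtain x y where x: "x \<in> H" "a = conj_by G g x" and y: "y \<in> H" "b = conj_by G g y" by blast
    then have "a \<otimes> b = conj_by G g (x \<otimes> y)" using conj_simps(3)[of g g x y] H assms(1) by (auto simp: subset_iff)
    then show "a \<otimes> b \<in> conj_by G g ` H" using x y assms(2) by (simp add: subgroup.m_closed)
  qed
qed

lemma conj_image_self:
  assumes "subgroup H G" "g \<in> H"
  shows "conj_by G g ` H = H"
proof -
  have sub: "conj_by G h ` H \<subseteq> H" if "h \<in> H" for h
    using assms(1) that by (auto simp: conj_by_def intro: subgroup.m_closed subgroup.m_inv_closed)
  have c: "g \<in> carrier G" "H \<subseteq> carrier G" using assms subgroup.subset by auto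
  have "conj_by G g ` conj_by G (inv g) ` H \<subseteq> conj_by G g ` H"
    using sub[OF subgroup.m_inv_closed[OF assms]] by (rule image_mono)
  then show ?thesis using sub[OF assms(2)] unfolding conj_image_inv(2)[OF c] by (rule subset_antisym[rotated])
qed

lemma subgroup_normalizer_of:
  assumes "H \<subseteq> carrier G"
  shows "subgroup (normalizer_of G H) G"
proof (rule subgroupI)
  show "normalizer_of G H \<subseteq> carrier G" by (auto simp: normalizer_of_def)
  show "normalizer_of G H \<noteq> {}"
    using conj_image_one[OF assms] unfolding normalizer_of_def by blast
next
  fix a assume "a \<in> normalizer_of G H"
  then have a: "a \<in> carrier G" "conj_by G a ` H = H" by (auto simp: normalizer_of_def)
  then have "conj_by G (inv a) ` H = H" using conj_image_inv(1)[OF a(1) assms] by simp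
  then show "inv a \<in> normalizer_of G H" using a(1) by (simp add: normalizer_of_def)
next
  fix a b assume "a \<in> normalizer_of G H" "b \<in> normalizer_of G H"
  then have a: "a \<in> carrier G" "conj_by G a ` H = H" and b: "b \<in> carrier G" "conj_by G b ` H = H"
    by (auto simp: normalizer_of_def)
  then show "a \<otimes> b \<in> normalizer_of G H"
    using conj_image_comp[OF a(1) b(1) assms] by (simp add: normalizer_of_def)
qed

lemma normalizer_of_subset: "normalizer_of G H \<subseteq> carrier G"
  by (auto simp: normalizer_of_def)

lemma normalizer_of_conj: "g \<in> normalizer_of G H \<Longrightarrow> conj_by G g ` H = H"
  by (simp add: normalizer_of_def)

lemma normalizer_of_mem: "g \<in> normalizer_of G H \<Longrightarrow> x \<in> H \<Longrightarrow> conj_by G g x \<in> H"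
  by (auto simp: normalizer_of_def)

lemma subgroup_le_normalizer: "subgroup H G \<Longrightarrow> H \<subseteq> normalizer_of G H"
  by (simp add: normalizer_of_def conj_image_self subgroup.mem_carrier subset_iff)

lemma subset_normalizer_ofI:
  assumes "subgroup Z G" "H \<subseteq> carrier G"
    and "\<And>z x. z \<in> Z \<Longrightarrow> x \<in> H \<Longrightarrow> conj_by G z x \<in> H"
  shows "Z \<subseteq> normalizer_of G H"
proof
  fix z assume z: "z \<in> Z"
  have zc: "z \<in> carrier G" using subgroup.mem_carrier[OF assms(1) z] .
  have iz: "inv z \<in> Z" using subgroup.m_inv_closed[OF assms(1) z] .
  have sub: "conj_by G z ` H \<subseteq> H" "conj_by G (inv z) ` H \<subseteq> H"
    using assms(3)[OF z] assms(3)[OF iz] by (auto simp only: image_subset_iff)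
  have "conj_by G z ` conj_by G (inv z) ` H \<subseteq> conj_by G z ` H"
    using sub(2) by (rule image_mono)
  then have "conj_by G z ` H = H"
    using sub(1) unfolding conj_image_inv(2)[OF zc assms(2)] by (rule subset_antisym[rotated])
  then show "z \<in> normalizer_of G H" using zc by (simp add: normalizer_of_def)
qed

lemma normal_iff_normalizer:
  assumes "subgroup N G"
  shows "N \<lhd> G \<longleftrightarrow> normalizer_of G N = carrier G"
proof
  assume "N \<lhd> G"
  then have "carrier G \<subseteq> normalizer_of G N"
    by (intro subset_normalizer_ofI) (auto simp: subgroup_self subgroup.subset[OF assms] normal.inv_op_closed2 conj_by_def)
  then show "normalizer_of G N = carrier G" using normalizer_of_subset by blast
next
  assume "normalizer_of G N = carrier G"
  then show "N \<lhd> G" 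
    using assms normalizer_of_mem[of _ N] unfolding normal_inv_iff conj_by_def by blast
qed

lemma card_subgroup_dvd:
  assumes "subgroup H G" "subgroup K G" "H \<subseteq> K"
  shows "card H dvd card K"
proof -
  have "card (rcosets\<^bsub>G\<lparr>carrier := K\<rparr>\<^esub> H) * card H = card K"
    using group.lagrange[OF subgroup_imp_group[OF assms(2)] subgroup_incl[OF assms]]
    by (simp add: order_def)
  then show ?thesis by (metis dvd_triv_right)
qed

lemma card_subgroup_pos:
  assumes "finite (carrier G)" "subgroup H G"
  shows "card H > 0"
  using assms subgroup.finite_imp_card_positive by blast

lemma finite_subgroup: "finite (carrier G) \<Longrightarrow> subgroup H G \<Longrightarrow> finite H"
  using subgroup.subset finite_subset by blast

lemma subgroup_prime_index_maximal:
  assumes "finite (carrier G)" "subgroup H G" "subgroup X G" "subgroup K G" "H \<subseteq> X" "X \<subseteq> K"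
    and "card K = r * card H" "prime (r::nat)"
  shows "X = H \<or> X = K"
proof -
  have fin: "finite X" "finite K" using assms finite_subgroup by auto
  obtain a where a: "card X = card H * a" using card_subgroup_dvd[OF assms(2,3,5)] by (auto elim: dvdE)
  obtain b where b: "card K = card X * b" using card_subgroup_dvd[OF assms(3,4,6)] by (auto elim: dvdE)
  have "card H > 0" using card_subgroup_pos assms by blast
  then have "r = a * b" using a b assms(7) by simp
  then have "a = 1 \<or> b = 1" using assms(8) prime_product by blast
  then show ?thesis using a b card_subset_eq[OF fin(1) assms(5)] card_subset_eq[OF fin(2) assms(6)] by auto
qed

lemma subgroup_eq_one_iff_card:
  assumes "finite (carrier G)" "subgroup H G"
  shows "card H = 1 \<longleftrightarrow> H = {\<one>}"
  using assms subgroup.one_closed by (auto simp: card_1_singleton_iff)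

text \<open>The fibre of \<open>(h, k) \<mapsto> h \<otimes> k\<close> over \<open>h \<otimes> k\<close>
  consists of the pairs \<open>(h \<otimes> d, inv d \<otimes> k)\<close> with \<open>d\<close> in
  the intersection.\<close>

lemma card_set_mult:
  assumes "finite (carrier G)" "subgroup H G" "subgroup K G"
  shows "card H * card K = card (H <#> K) * card (H \<inter> K)"
proof -
  have H: "H \<subseteq> carrier G" and K: "K \<subseteq> carrier G" using assms subgroup.subset by auto
  have fin: "finite H" "finite K" using finite_subgroup assms by auto
  define f where "f = (\<lambda>(h, k). h \<otimes> k)"
  have img: "f ` (H \<times> K) = H <#> K" unfolding f_def set_mult_def by auto
  have fibre: "card {y \<in> H \<times> K. f y = x} = card (H \<inter> K)" if x: "x \<in> H <#> K" for x
  proof -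
    obtain h k where hk: "h \<in> H" "k \<in> K" "x = h \<otimes> k" using x unfolding set_mult_def by auto
    have "bij_betw (\<lambda>d. (h \<otimes> d, inv d \<otimes> k)) (H \<inter> K) {y \<in> H \<times> K. f y = x}"
    proof (rule bij_betw_imageI)
      show "inj_on (\<lambda>d. (h \<otimes> d, inv d \<otimes> k)) (H \<inter> K)"
        using hk H by (intro inj_onI) (auto simp: subset_iff)
      show "(\<lambda>d. (h \<otimes> d, inv d \<otimes> k)) ` (H \<inter> K) = {y \<in> H \<times> K. f y = x}" (is "?L = ?R")
      proof
        show "?L \<subseteq> ?R"
          using hk H K assms(2,3) unfolding f_def
          by (auto simp: m_assoc subset_iff subgroup.m_closed subgroup.m_inv_closed)
        show "?R \<subseteq> ?L"
        proof
          fix y assume "y \<in> ?R"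
          then obtain a b where ab: "y = (a, b)" "a \<in> H" "b \<in> K" "a \<otimes> b = h \<otimes> k"
            unfolding f_def hk(3) by auto
          have c: "a \<in> carrier G" "b \<in> carrier G" "h \<in> carrier G" "k \<in> carrier G"
            using ab hk H K by auto
          define d where "d = inv h \<otimes> a"
          have "inv h \<otimes> (a \<otimes> b) = k" using ab(4) c by simp
          then have dk: "d \<otimes> b = k" unfolding d_def using c by (simp add: m_assoc)
          have dc: "d \<in> carrier G" unfolding d_def using c by simp
          have "d = k \<otimes> inv b" using dk c dc by (metis inv_solve_right)
          then have "d \<in> K" using ab hk assms(3) by (simp add: subgroup.m_closed subgroup.m_inv_closed)
          moreover have "d \<in> H" unfolding d_def using ab hk assms(2)
            by (simp add: subgroup.m_closed subgroup.m_inv_closed)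
          moreover have "h \<otimes> d = a" unfolding d_def using c by simp
          moreover have "inv d \<otimes> k = b" using dk dc c by (metis cancel_inv(2))
          ultimately show "y \<in> ?L" using ab(1) by force
        qed
      qed
    qed
    then show ?thesis by (simp add: bij_betw_same_card)
  qed
  have "card (H \<times> K) = (\<Sum>x \<in> f ` (H \<times> K). card {y \<in> H \<times> K. f y = x})"
    using fin sum.image_gen[of "H \<times> K" "\<lambda>_. 1::nat" f] by simp
  also have "\<dots> = card (H <#> K) * card (H \<inter> K)" unfolding img using fibre by simp
  finally show ?thesis by (simp add: card_cartesian_product)
qed

lemma subgroup_set_mult_normalizer:
  assumes "subgroup N G" "subgroup K G" "K \<subseteq> normalizer_of G N"
  shows "subgroup (N <#> K) G" "N \<subseteq> N <#> K" "K \<subseteq> N <#> K"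
proof -
  have NK: "N \<subseteq> carrier G" "K \<subseteq> carrier G" using assms subgroup.subset by auto
  have mem: "x \<in> N <#> K \<longleftrightarrow> (\<exists>n\<in>N. \<exists>k\<in>K. x = n \<otimes> k)" for x unfolding set_mult_def by auto
  show "N \<subseteq> N <#> K"
  proof
    fix n assume n: "n \<in> N"
    then have "n = n \<otimes> \<one>" using NK by auto
    then show "n \<in> N <#> K" using n subgroup.one_closed[OF assms(2)] unfolding mem by blast
  qed
  show "K \<subseteq> N <#> K"
  proof
    fix n assume n: "n \<in> K"
    then have "n = \<one> \<otimes> n" using NK by auto
    then show "n \<in> N <#> K" using n subgroup.one_closed[OF assms(1)] unfolding mem by blast
  qed
  show "subgroup (N <#> K) G"
  proof (rule subgroupI)
    show "N <#> K \<subseteq> carrier G" using NK by (simp add: setmult_subset_G)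
    show "N <#> K \<noteq> {}" using \<open>N \<subseteq> N <#> K\<close> subgroup.one_closed[OF assms(1)] by blast
  next
    fix a assume "a \<in> N <#> K"
    then obtain n k where a: "n \<in> N" "k \<in> K" "a = n \<otimes> k" unfolding mem by blast
    then have ik: "inv k \<in> K" "inv n \<in> N" using assms by (simp_all add: subgroup.m_inv_closed)
    have "conj_by G (inv k) (inv n) \<in> N" using normalizer_of_mem ik assms(3) by blast
    moreover have "inv a = conj_by G (inv k) (inv n) \<otimes> inv k"
      using a NK by (simp add: conj_by_def inv_mult_group m_assoc subset_iff)
    ultimately show "inv a \<in> N <#> K" unfolding mem using ik by blast
  next
    fix a b assume "a \<in> N <#> K" "b \<in> N <#> K"
    then obtain n k n' k' where a: "n \<in> N" "k \<in> K" "a = n \<otimes> k" and b: "n' \<in> N" "k' \<in> K" "b = n' \<otimes> k'"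
      unfolding mem by blast
    have "conj_by G k n' \<in> N" using normalizer_of_mem a b assms(3) by blast
    then have "n \<otimes> conj_by G k n' \<in> N" "k \<otimes> k' \<in> K" using a b assms by (simp_all add: subgroup.m_closed)
    moreover have "a \<otimes> b = (n \<otimes> conj_by G k n') \<otimes> (k \<otimes> k')"
      using a b NK by (simp add: conj_by_def m_assoc subset_iff)
    ultimately show "a \<otimes> b \<in> N <#> K" unfolding mem by blast
  qed
qed

lemma conj_eq_iff_commute:
  assumes "c \<in> carrier G" "x \<in> carrier G" "y \<in> carrier G"
  shows "conj_by G c x = y \<longleftrightarrow> c \<otimes> x = y \<otimes> c"
  unfolding conj_by_def using assms by (auto simp: inv_solve_right')

lemma subgroup_centralizer_of:
  assumes "x \<in> carrier G"
  shows "subgroup (centralizer_of G x) G"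
proof -
  have eq: "centralizer_of G x = normalizer_of G {x}"
    unfolding centralizer_of_def normalizer_of_def
    by (auto simp: conj_eq_iff_commute[OF _ assms assms])
  show ?thesis unfolding eq using subgroup_normalizer_of[of "{x}"] assms by simp
qed

lemma commuting_mem_normalizer:
  assumes "y \<in> carrier G" "D \<subseteq> carrier G" "\<And>d. d \<in> D \<Longrightarrow> y \<otimes> d = d \<otimes> y"
  shows "y \<in> normalizer_of G D"
proof -
  have "conj_by G y d = d" if "d \<in> D" for d
    using that assms by (simp add: conj_eq_iff_commute subset_iff)
  then have "conj_by G y ` D = (\<lambda>d. d) ` D" by (intro image_cong) auto
  then show ?thesis using assms(1) by (simp add: normalizer_of_def)
qed

lemma commute_of_trivial_commutator:
  assumes "a \<in> carrier G" "b \<in> carrier G" "conj_by G a b \<otimes> inv b = \<one>"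
  shows "a \<otimes> b = b \<otimes> a"
proof -
  have "conj_by G a b = b" using assms by (metis conj_closed inv_equality inv_inv inv_closed)
  then show ?thesis using assms(1,2) by (simp add: conj_eq_iff_commute)
qed

text \<open>The commutator of \<open>a\<close> and \<open>b\<close> lies in both subgroups.\<close>

lemma commute_of_normalizing:
  assumes A: "subgroup A G" and B: "subgroup B G" and "A \<inter> B = {\<one>}"
    and AB: "A \<subseteq> normalizer_of G B" and BA: "B \<subseteq> normalizer_of G A" and a: "a \<in> A" and b: "b \<in> B"
  shows "a \<otimes> b = b \<otimes> a"
proof -
  have c: "a \<in> carrier G" "b \<in> carrier G" using subgroup.mem_carrier[OF A a] subgroup.mem_carrier[OF B b] .
  have "conj_by G a b \<in> B" using normalizer_of_mem[of a B b] AB a b by blast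
  then have 1: "conj_by G a b \<otimes> inv b \<in> B" using subgroup.m_closed[OF B] subgroup.m_inv_closed[OF B b] by blast
  have "conj_by G b (inv a) \<in> A"
    using normalizer_of_mem[of b A "inv a"] BA b subgroup.m_inv_closed[OF A a] by blast
  then have "a \<otimes> conj_by G b (inv a) \<in> A" using subgroup.m_closed[OF A a] by blast
  moreover have "a \<otimes> conj_by G b (inv a) = conj_by G a b \<otimes> inv b"
    using c by (simp add: conj_by_def m_assoc)
  ultimately have "conj_by G a b \<otimes> inv b = \<one>" using 1 assms(3) by (metis IntI singletonD)
  then show ?thesis by (rule commute_of_trivial_commutator[OF c])
qed

lemma cyclic_subgroup:
  assumes "x \<in> carrier G"
  shows "subgroup (generate G {x}) G" "x \<in> generate G {x}" "card (generate G {x}) = ord x"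
    "\<And>H. subgroup H G \<Longrightarrow> x \<in> H \<Longrightarrow> generate G {x} \<subseteq> H"
  using assms generate_is_subgroup generate_pow_card generate.incl[of x "{x}"] generate_subgroup_incl[of "{x}"]
  by auto

lemma ord_prime_iff:
  assumes "x \<in> carrier G" "prime (p::nat)"
  shows "ord x = p \<longleftrightarrow> x \<noteq> \<one> \<and> x [^] p = \<one>"
proof -
  have "ord x = p \<longleftrightarrow> ord x \<noteq> 1 \<and> ord x dvd p"
    using assms(2) by (auto simp: prime_nat_iff)
  then show ?thesis using assms ord_eq_1 pow_eq_id by simp
qed

lemma cauchy_in_subgroup:
  assumes "finite (carrier G)" "subgroup Z G" "prime (p::nat)" "p dvd card Z"
  obtains x where "x \<in> Z" "ord x = p"
proof -
  interpret Z: group "G\<lparr>carrier := Z\<rparr>" using subgroup_imp_group[OF assms(2)] .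
  obtain m where "card Z = p ^ 1 * m" using assms(4) by (auto elim: dvdE)
  then obtain H where H: "subgroup H (G\<lparr>carrier := Z\<rparr>)" "card H = p"
    using sylow_thm[OF assms(3) Z.is_group, of 1 m] finite_subgroup[OF assms(1,2)] by (auto simp: order_def)
  have HZ: "H \<subseteq> Z" using subgroup.subset[OF H(1)] by simp
  have HG: "subgroup H G" using incl_subgroup[OF assms(2) H(1)] .
  have "\<not> H \<subseteq> {\<one>}"
    using H(2) assms(3) prime_gt_1_nat[of p] card_mono[of "{\<one>}" H] by auto
  then obtain x where x: "x \<in> H" "x \<noteq> \<one>" by blast
  have xc: "x \<in> carrier G" using subgroup.mem_carrier[OF HG x(1)] .
  have "ord x dvd p"
    using card_subgroup_dvd[OF cyclic_subgroup(1)[OF xc] HG cyclic_subgroup(4)[OF xc HG x(1)]]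
      cyclic_subgroup(3)[OF xc] H(2) by simp
  then have "ord x = p" using assms(3) x(2) ord_eq_1[OF xc] by (auto simp: prime_nat_iff)
  then show thesis using that x HZ by blast
qed

lemma sylow_in_subgroup:
  assumes "finite (carrier G)" "subgroup Z G" "prime (p::nat)" "p ^ a dvd card Z"
  obtains H where "subgroup H G" "H \<subseteq> Z" "card H = p ^ a"
proof -
  interpret Z: group "G\<lparr>carrier := Z\<rparr>" using subgroup_imp_group[OF assms(2)] .
  obtain m where "card Z = p ^ a * m" using assms(4) by (auto elim: dvdE)
  then obtain H where H: "subgroup H (G\<lparr>carrier := Z\<rparr>)" "card H = p ^ a"
    using sylow_thm[OF assms(3) Z.is_group, of a m] finite_subgroup[OF assms(1,2)] by (auto simp: order_def)
  then show thesis using that incl_subgroup[OF assms(2) H(1)] subgroup.subset[OF H(1)] by auto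
qed

text \<open>By Cauchy's theorem some element has prime order, and the subgroup that it generates must be
  everything.\<close>

lemma card_prime_of_simple_lattice:
  assumes "finite (carrier G)" "subgroup Z G" "Z \<noteq> {\<one>}"
    and "\<And>X. subgroup X G \<Longrightarrow> X \<subseteq> Z \<Longrightarrow> X \<noteq> {\<one>} \<Longrightarrow> X = Z"
  shows "prime (card Z)"
proof -
  have "card Z \<noteq> 1" using subgroup_eq_one_iff_card assms by blast
  then obtain p where p: "prime p" "p dvd card Z" using prime_factor_nat by blast
  obtain x where x: "x \<in> Z" "ord x = p" using cauchy_in_subgroup[OF assms(1,2) p] .
  have xc: "x \<in> carrier G" using subgroup.mem_carrier[OF assms(2) x(1)] .
  have "x \<noteq> \<one>" using x p ord_prime_iff xc by blast
  then have "generate G {x} = Z"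
    using assms(4)[OF cyclic_subgroup(1)[OF xc] cyclic_subgroup(4)[OF xc assms(2) x(1)]]
      cyclic_subgroup(2)[OF xc] by blast
  then show ?thesis using cyclic_subgroup(3)[OF xc] x p by simp
qed

text \<open>The quotient by \<open>L\<close> has prime order and is therefore abelian. Without forming the
  quotient: the elements \<open>b\<close> whose commutator with \<open>a\<close> lies in
  \<open>L\<close> form a subgroup that contains \<open>L\<close> and \<open>a\<close>, which is
  everything unless \<open>a\<close> is in \<open>L\<close>.\<close>

lemma commutator_in_prime_index:
  assumes "finite (carrier G)" "subgroup L G" "subgroup Z G" "L \<subseteq> Z" "Z \<subseteq> normalizer_of G L"
    and "card Z = r * card L" "prime (r::nat)" "a \<in> Z" "b \<in> Z"
  shows "conj_by G a b \<otimes> inv b \<in> L"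
proof -
  have Zc: "Z \<subseteq> carrier G" using subgroup.subset[OF assms(3)] .
  have Lc: "L \<subseteq> carrier G" using subgroup.subset[OF assms(2)] .
  have ac: "a \<in> carrier G" using assms Zc by auto
  have nL: "conj_by G z l \<in> L" if "z \<in> Z" "l \<in> L" for z l
    using that assms(5) normalizer_of_mem by blast
  note iL = subgroup.m_inv_closed[OF assms(2)] and mL = subgroup.m_closed[OF assms(2)]
  show ?thesis
  proof (cases "a \<in> L")
    case True
    have "conj_by G b (inv a) \<in> L" using nL iL True assms by blast
    moreover have "conj_by G a b \<otimes> inv b = a \<otimes> conj_by G b (inv a)"
      using assms Zc by (simp add: conj_by_def m_assoc subset_iff)
    ultimately show ?thesis using mL True by simp
  next
    case False
    define B where "B = {b \<in> Z. conj_by G a b \<otimes> inv b \<in> L}"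
    have "subgroup B G"
    proof (rule subgroupI)
      show "B \<subseteq> carrier G" using Zc by (auto simp: B_def)
      show "B \<noteq> {}" using ac subgroup.one_closed[OF assms(2)] subgroup.one_closed[OF assms(3)] by (auto simp: B_def)
    next
      fix x assume "x \<in> B"
      then have x: "x \<in> Z" "conj_by G a x \<otimes> inv x \<in> L" by (auto simp: B_def)
      have xc: "x \<in> carrier G" and ix: "inv x \<in> Z" using x Zc assms(3) by (auto simp: subgroup.m_inv_closed)
      have "conj_by G (inv x) (inv (conj_by G a x \<otimes> inv x)) \<in> L" using nL[OF ix] iL x by blast
      moreover have "conj_by G (inv x) (inv (conj_by G a x \<otimes> inv x)) = inv (conj_by G a x) \<otimes> x"
        using ac xc by (simp add: conj_by_def m_assoc inv_mult_group)
      ultimately have "inv (conj_by G a x) \<otimes> x \<in> L" by simp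
      moreover have "inv (conj_by G a x) \<otimes> x = conj_by G a (inv x) \<otimes> inv (inv x)"
        using ac xc by (simp add: conj_by_def m_assoc inv_mult_group)
      ultimately show "inv x \<in> B" using ix by (simp add: B_def)
    next
      fix x y assume "x \<in> B" "y \<in> B"
      then have x: "x \<in> Z" "conj_by G a x \<otimes> inv x \<in> L" and y: "y \<in> Z" "conj_by G a y \<otimes> inv y \<in> L"
        by (auto simp: B_def)
      have xc: "x \<in> carrier G" "y \<in> carrier G" using x y Zc by auto
      have "(conj_by G a x \<otimes> inv x) \<otimes> conj_by G x (conj_by G a y \<otimes> inv y) \<in> L"
        using mL nL x y by blast
      moreover have "(conj_by G a x \<otimes> inv x) \<otimes> conj_by G x (conj_by G a y \<otimes> inv y)
          = conj_by G a (x \<otimes> y) \<otimes> inv (x \<otimes> y)"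
        using ac xc by (simp add: conj_by_def m_assoc inv_mult_group)
      ultimately show "x \<otimes> y \<in> B" using x y assms(3) by (simp add: B_def subgroup.m_closed)
    qed
    moreover have "L \<subseteq> B"
    proof
      fix l assume l: "l \<in> L"
      then show "l \<in> B" using nL[OF assms(8) l] mL iL assms(4) by (auto simp: B_def)
    qed
    moreover have "B \<subseteq> Z" by (auto simp: B_def)
    moreover have "a \<in> B"
      using assms(8) ac subgroup.one_closed[OF assms(2)] by (simp add: B_def conj_by_def m_assoc)
    ultimately have "B = Z"
      using subgroup_prime_index_maximal[OF assms(1,2) _ assms(3) _ _ assms(6,7)] False by blast
    then show ?thesis using assms(9) by (auto simp: B_def)
  qed
qed

text \<open>A normalizing element of prime order outside \<open>D\<close> generates a subgroup that meets
  \<open>D\<close> trivially, so adjoining it multiplies the order by \<open>p\<close>.\<close>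

lemma adjoin_prime_order:
  assumes "finite (carrier G)" "subgroup D G" "y \<in> normalizer_of G D" "ord y = p" "prime (p::nat)" "y \<notin> D"
  obtains X where "subgroup X G" "D \<subseteq> X" "y \<in> X" "card X = p * card D"
    "\<And>Z. subgroup Z G \<Longrightarrow> D \<subseteq> Z \<Longrightarrow> y \<in> Z \<Longrightarrow> X \<subseteq> Z"
proof -
  have yc: "y \<in> carrier G" using assms(3) by (simp add: normalizer_of_def)
  define Y where "Y = generate G {y}"
  have Y: "subgroup Y G" "y \<in> Y" "card Y = p" "\<And>H. subgroup H G \<Longrightarrow> y \<in> H \<Longrightarrow> Y \<subseteq> H"
    unfolding Y_def using cyclic_subgroup[OF yc] assms(4) by auto
  have YN: "Y \<subseteq> normalizer_of G D"
    using Y(4)[OF subgroup_normalizer_of[OF subgroup.subset[OF assms(2)]] assms(3)] .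
  note S = subgroup_set_mult_normalizer[OF assms(2) Y(1) YN]
  have "card (D \<inter> Y) dvd p"
    using card_subgroup_dvd[OF subgroups_Inter_pair[OF assms(2) Y(1)] Y(1)] Y(3) by auto
  moreover have "card (D \<inter> Y) \<noteq> p"
    using card_subset_eq[of Y "D \<inter> Y"] Y finite_subgroup[OF assms(1) Y(1)] assms(6) by auto
  ultimately have "card (D \<inter> Y) = 1" using assms(5) by (auto simp: prime_nat_iff)
  then have "card (D <#> Y) = p * card D"
    using card_set_mult[OF assms(1,2) Y(1)] Y(3) by (simp add: mult.commute)
  moreover have "D <#> Y \<subseteq> Z" if Z: "subgroup Z G" "D \<subseteq> Z" "y \<in> Z" for Z
    using Y(4)[OF Z(1,3)] Z(2) subgroup.m_closed[OF Z(1)] by (auto simp: set_mult_def subset_iff)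
  ultimately show thesis using that[OF S(1,2)] S(3) Y(2) by blast
qed

text \<open>Otherwise \<open>E\<close> and \<open>x\<close> generate a subgroup of order
  \<open>p * card E\<close>, so that \<open>p\<close> divides the index \<open>m\<close>.\<close>

lemma mem_normal_of_coprime_index:
  assumes "finite (carrier G)" "subgroup E G" "subgroup Z G" "E \<subseteq> Z" "Z \<subseteq> normalizer_of G E"
    and "card Z = m * card E" "prime (p::nat)" "\<not> p dvd m" "x \<in> Z" "ord x = p"
  shows "x \<in> E"
proof (rule ccontr)
  assume "x \<notin> E"
  moreover have "x \<in> normalizer_of G E" using assms(5,9) by blast
  ultimately obtain X where X: "subgroup X G" "card X = p * card E"
    "\<And>Y. subgroup Y G \<Longrightarrow> E \<subseteq> Y \<Longrightarrow> x \<in> Y \<Longrightarrow> X \<subseteq> Y"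
    using adjoin_prime_order[OF assms(1,2) _ assms(10,7)] by metis
  have "p * card E dvd m * card E"
    using card_subgroup_dvd[OF X(1) assms(3) X(3)[OF assms(3,4,9)]] X(2) assms(6) by simp
  then show False using assms(8) card_subgroup_pos[OF assms(1,2)] by simp
qed

lemma ord_dvd_subgroup_card:
  assumes "subgroup A G" "x \<in> A"
  shows "ord x dvd card A"
proof -
  have xc: "x \<in> carrier G" using subgroup.mem_carrier[OF assms] .
  show ?thesis
    using card_subgroup_dvd[OF cyclic_subgroup(1)[OF xc] assms(1) cyclic_subgroup(4)[OF xc assms]]
      cyclic_subgroup(3)[OF xc] by simp
qed

lemma prime_card_ord:
  assumes "subgroup A G" "prime (card A)" "x \<in> A" "x \<noteq> \<one>"
  shows "ord x = card A"
proof -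
  have xc: "x \<in> carrier G" using subgroup.mem_carrier[OF assms(1,3)] .
  have "ord x dvd card A"
    using card_subgroup_dvd[OF cyclic_subgroup(1)[OF xc] assms(1) cyclic_subgroup(4)[OF xc assms(1,3)]]
      cyclic_subgroup(3)[OF xc] by simp
  then show ?thesis using assms(2,4) ord_eq_1[OF xc] by (auto simp: prime_nat_iff)
qed

lemma ord_conj:
  assumes "g \<in> carrier G" "x \<in> carrier G"
  shows "ord (conj_by G g x) = ord x"
proof -
  have "conj_by G g x [^] n = \<one> \<longleftrightarrow> x [^] n = \<one>" for n :: nat
  proof -
    have "conj_by G g x [^] n = conj_by G g (x [^] n)" using conj_pow[OF assms] by simp
    then show ?thesis using inj_onD[OF inj_on_conj[OF assms(1)], of "x [^] n" \<one>] assms by auto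
  qed
  then show ?thesis using assms by (simp add: ord_unique pow_eq_id)
qed

lemma prime_card_subgroup_eq:
  assumes "finite (carrier G)" "subgroup A G" "subgroup B G" "card A = t" "card B = t" "prime (t::nat)"
    "x \<in> A" "x \<in> B" "x \<noteq> \<one>"
  shows "A = B"
proof -
  have "A \<inter> B = {\<one>} \<or> A \<inter> B = A"
    using subgroup_prime_index_maximal[OF assms(1) triv_subgroup subgroups_Inter_pair[OF assms(2,3)] assms(2), of t]
      assms(4,6) subgroup.one_closed[OF assms(2)] subgroup.one_closed[OF assms(3)] by simp
  then have "A \<subseteq> B" using assms(7-9) by blast
  then show ?thesis using card_subset_eq[OF finite_subgroup[OF assms(1,3)]] assms(4,5) by simp
qed

lemma prime_card_commute:
  assumes "finite (carrier G)" "subgroup A G" "prime (card A)" "a \<in> A" "b \<in> A"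
  shows "a \<otimes> b = b \<otimes> a"
proof -
  have c: "a \<in> carrier G" "b \<in> carrier G" using assms subgroup.mem_carrier[OF assms(2)] by auto
  have "A \<subseteq> normalizer_of G {\<one>}" using subgroup.subset[OF assms(2)] by (auto simp: normalizer_of_def)
  then have "conj_by G a b \<otimes> inv b \<in> {\<one>}"
    using commutator_in_prime_index[OF assms(1) triv_subgroup assms(2) _ _ _ assms(3-5)]
      subgroup.one_closed[OF assms(2)] by simp
  then show ?thesis using commute_of_trivial_commutator[OF c] by simp
qed

end

section \<open>The lattice of subgroups and its modular elements\<close>

text \<open>For the action of \<open>Z\<close> on the cosets of \<open>L\<close> this says that every subgroup
  \<open>Y\<close> of \<open>Z\<close> acts primitively on the orbit of the base point, whose
  stabilizer in \<open>Y\<close> is \<open>Y \<inter> L\<close>: this stabilizer is \<open>Y\<close>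
  or maximal in \<open>Y\<close>. The formulation with \<open>X\<close> covers both cases, as there
  is no such \<open>X\<close> if \<open>Y\<close> lies in \<open>L\<close>, and \<open>Y = Z\<close>
  gives that \<open>L\<close> is maximal in \<open>Z\<close>.\<close>

definition hereditarily_primitive :: "('a, 'b) monoid_scheme \<Rightarrow> 'a set \<Rightarrow> 'a set \<Rightarrow> bool" where
  "hereditarily_primitive G Z L \<longleftrightarrow> subgroup Z G \<and> subgroup L G \<and> L \<subset> Z \<and>
     (\<forall>X Y. subgroup X G \<longrightarrow> subgroup Y G \<longrightarrow> Y \<inter> L \<subseteq> X \<longrightarrow> X \<subseteq> Y \<longrightarrow> Y \<subseteq> Z \<longrightarrow> \<not> X \<subseteq> L \<longrightarrow> X = Y)"

context group
begin

lemma generate_superset: "A \<subseteq> generate G A"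
  by (auto intro: generate.incl)

lemma generate_union_absorb:
  assumes "A \<subseteq> carrier G" "B \<subseteq> carrier G"
  shows "generate G (A \<union> generate G B) = generate G (A \<union> B)"
proof
  have AB: "A \<union> B \<subseteq> carrier G" using assms by blast
  note S = generate_is_subgroup[OF AB]
  have "B \<subseteq> generate G B" by (rule generate_superset)
  then show "generate G (A \<union> B) \<subseteq> generate G (A \<union> generate G B)" by (intro mono_generate) blast
  have "A \<subseteq> generate G (A \<union> B)" "B \<subseteq> generate G (A \<union> B)" using generate_superset[of "A \<union> B"] by blast+
  then have "A \<union> generate G B \<subseteq> generate G (A \<union> B)"
    using generate_subgroup_incl[OF generate_superset S] generate_subgroup_incl[of B, OF _ S] by simp
  then show "generate G (A \<union> generate G B) \<subseteq> generate G (A \<union> B)"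
    by (rule generate_subgroup_incl[OF _ S])
qed

lemma generate_union_absorb':
  assumes "A \<subseteq> carrier G" "B \<subseteq> carrier G"
  shows "generate G (generate G A \<union> B) = generate G (A \<union> B)"
  using generate_union_absorb[OF assms(2,1)] by (simp add: Un_commute)

lemma generate_subgroup_eq: "subgroup H G \<Longrightarrow> generate G H = H"
  using generateI[of H H] by blast

lemma modular_lowerD:
  assumes "modular_subgroup M G" "subgroup X G" "subgroup Z G" "X \<subseteq> Z"
  shows "generate G (X \<union> (M \<inter> Z)) = generate G (X \<union> M) \<inter> Z"
  using assms unfolding modular_subgroup_def by blast

lemma modular_upperD:
  assumes "modular_subgroup M G" "subgroup Y G" "subgroup Z G" "M \<subseteq> Z"
  shows "generate G (M \<union> (Y \<inter> Z)) = generate G (M \<union> Y) \<inter> Z"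
  using assms unfolding modular_subgroup_def by blast

lemma modular_imp_subgroup: "modular_subgroup M G \<Longrightarrow> subgroup M G"
  unfolding modular_subgroup_def by blast

text \<open>In any lattice the join \<open>J\<close> of two modular elements is modular. The second identity
  follows by applying that of \<open>M'\<close> and then that of \<open>M\<close>. For the first
  one, the meet with \<open>W = M \<squnion> Z\<close> is computed before the meet with
  \<open>Z\<close>: below \<open>W\<close> the identities of \<open>M'\<close> and \<open>M\<close>
  apply in turn, and \<open>J \<sqinter> W\<close> equals
  \<open>M \<squnion> (Z \<sqinter> J)\<close> because \<open>M\<close> is modular and lies below
  \<open>J\<close>.\<close>

lemma modular_join:
  assumes "modular_subgroup M G" "modular_subgroup M' G"
  shows "modular_subgroup (generate G (M \<union> M')) G"
proof -
  define J where "J = generate G (M \<union> M')"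
  have MG: "subgroup M G" "subgroup M' G" using assms modular_imp_subgroup by auto
  have M: "M \<subseteq> carrier G" "M' \<subseteq> carrier G" using MG[THEN subgroup.subset] .
  then have MM: "M \<union> M' \<subseteq> carrier G" by blast
  have JG: "subgroup J G" unfolding J_def using generate_is_subgroup[OF MM] .
  have J: "M \<subseteq> J" "M' \<subseteq> J" "J \<subseteq> carrier G"
    using generate_superset[of "M \<union> M'"] subgroup.subset[OF JG] unfolding J_def by auto
  have upper: "generate G (J \<union> (Y \<inter> Z)) = generate G (J \<union> Y) \<inter> Z"
    if Y: "subgroup Y G" and Z: "subgroup Z G" and JZ: "J \<subseteq> Z" for Y Z
  proof -
    have c: "Y \<subseteq> carrier G" "Z \<subseteq> carrier G" using subgroup.subset[OF Y] subgroup.subset[OF Z] .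
    have g: "M' \<union> Y \<subseteq> carrier G" "M' \<union> (Y \<inter> Z) \<subseteq> carrier G" using c M by auto
    have "generate G (J \<union> (Y \<inter> Z)) = generate G (M \<union> (M' \<union> (Y \<inter> Z)))"
      unfolding J_def using generate_union_absorb'[OF MM, of "Y \<inter> Z"] c by (auto simp: Un_assoc)
    also have "\<dots> = generate G (M \<union> generate G (M' \<union> (Y \<inter> Z)))"
      using generate_union_absorb[OF M(1) g(2)] by simp
    also have "\<dots> = generate G (M \<union> (generate G (M' \<union> Y) \<inter> Z))"
      using modular_upperD[OF assms(2) Y Z] J JZ by simp
    also have "\<dots> = generate G (M \<union> generate G (M' \<union> Y)) \<inter> Z"
      using modular_upperD[OF assms(1) generate_is_subgroup[OF g(1)] Z] J JZ by simp
    also have "\<dots> = generate G (M \<union> M' \<union> Y) \<inter> Z"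
      using generate_union_absorb[OF M(1) g(1)] by (simp add: Un_assoc)
    also have "\<dots> = generate G (J \<union> Y) \<inter> Z"
      unfolding J_def using generate_union_absorb'[OF MM c(1)] by simp
    finally show ?thesis .
  qed
  have lower: "generate G (X \<union> (J \<inter> Z)) = generate G (X \<union> J) \<inter> Z"
    if X: "subgroup X G" and Z: "subgroup Z G" and XZ: "X \<subseteq> Z" for X Z
  proof -
    have c: "X \<subseteq> carrier G" "Z \<subseteq> carrier G" using subgroup.subset[OF X] subgroup.subset[OF Z] .
    define W where "W = generate G (M \<union> Z)"
    have MZ: "M \<union> Z \<subseteq> carrier G" and XM: "X \<union> M \<subseteq> carrier G" using M c by auto
    have WG: "subgroup W G" unfolding W_def using generate_is_subgroup[OF MZ] .
    have W: "M \<subseteq> W" "Z \<subseteq> W" "W \<subseteq> carrier G"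
      using generate_superset[of "M \<union> Z"] subgroup.subset[OF WG] unfolding W_def by auto
    have XMG: "subgroup (generate G (X \<union> M)) G" using generate_is_subgroup[OF XM] .
    have XMW: "generate G (X \<union> M) \<subseteq> W" 
      by (rule generate_subgroup_incl[OF _ WG]) (use W XZ in blast)
    have JW: "J \<inter> W = generate G (M \<union> (Z \<inter> J))"
      using modular_upperD[OF assms(1) Z JG J(1)] unfolding W_def by (simp add: Int_commute)
    have "generate G (X \<union> J) \<inter> W = generate G (generate G (X \<union> M) \<union> M') \<inter> W"
      unfolding J_def using generate_union_absorb[OF c(1) MM] generate_union_absorb'[OF XM M(2)]
      by (simp add: Un_assoc)
    also have "\<dots> = generate G (generate G (X \<union> M) \<union> (M' \<inter> W))"
      using modular_lowerD[OF assms(2) XMG WG XMW] by simp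
    also have "\<dots> = generate G (X \<union> M \<union> (M' \<inter> W))"
      using generate_union_absorb'[OF XM, of "M' \<inter> W"] M by blast
    also have "\<dots> = generate G (X \<union> generate G (M \<union> (M' \<inter> W)))"
      using generate_union_absorb[OF c(1), of "M \<union> (M' \<inter> W)"] M by (auto simp: Un_assoc)
    also have "\<dots> = generate G (X \<union> (J \<inter> W))"
      using modular_upperD[OF assms(1) MG(2) WG W(1)] unfolding J_def by simp
    finally have 1: "generate G (X \<union> J) \<inter> W = generate G (X \<union> (J \<inter> W))" .
    have XZJ: "X \<union> (Z \<inter> J) \<subseteq> carrier G" "M \<union> (Z \<inter> J) \<subseteq> carrier G" using c M by auto
    have TZ: "generate G (X \<union> (Z \<inter> J)) \<subseteq> Z" 
      by (rule generate_subgroup_incl[OF _ Z]) (use XZ in blast)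
    have "generate G (X \<union> J) \<inter> Z = (generate G (X \<union> J) \<inter> W) \<inter> Z" using W by blast
    also have "\<dots> = generate G (X \<union> (M \<union> (Z \<inter> J))) \<inter> Z"
      unfolding 1 JW using generate_union_absorb[OF c(1) XZJ(2)] by simp
    also have "\<dots> = generate G (generate G (X \<union> (Z \<inter> J)) \<union> M) \<inter> Z"
      using generate_union_absorb'[OF XZJ(1) M(1)] by (simp add: Un_ac)
    also have "\<dots> = generate G (generate G (X \<union> (Z \<inter> J)) \<union> (M \<inter> Z))"
      using modular_lowerD[OF assms(1) generate_is_subgroup[OF XZJ(1)] Z TZ] by simp
    also have "\<dots> = generate G (X \<union> (Z \<inter> J) \<union> (M \<inter> Z))"
      using generate_union_absorb'[OF XZJ(1), of "M \<inter> Z"] M by blast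
    also have "X \<union> (Z \<inter> J) \<union> (M \<inter> Z) = X \<union> (J \<inter> Z)" using J by blast
    finally show ?thesis by simp
  qed
  show ?thesis unfolding modular_subgroup_def J_def[symmetric] using JG upper lower by blast
qed

lemma group_hom_conj: "g \<in> carrier G \<Longrightarrow> group_hom G G (conj_by G g)"
  by (simp add: group_hom_def group_hom_axioms_def hom_def conj_simps(3) Pi_iff)

lemma conj_image_Int:
  assumes "g \<in> carrier G" "X \<subseteq> carrier G" "Y \<subseteq> carrier G"
  shows "conj_by G g ` (X \<inter> Y) = conj_by G g ` X \<inter> conj_by G g ` Y"
  using inj_on_image_Int[OF inj_on_conj[OF assms(1)] assms(2,3)] .

text \<open>Conjugation by \<open>g\<close> is an automorphism of the subgroup lattice.\<close>

lemma modular_conj: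
  assumes "modular_subgroup M G" "g \<in> carrier G"
  shows "modular_subgroup (conj_by G g ` M) G"
proof -
  let ?c = "image (conj_by G g)" and ?d = "image (conj_by G (inv g))"
  interpret c: group_hom G G "conj_by G g" using group_hom_conj[OF assms(2)] .
  have ig: "inv g \<in> carrier G" using assms(2) by simp
  have MG: "subgroup M G" using assms(1) modular_imp_subgroup by blast
  note Mc = subgroup.subset[OF MG]
  have step: "generate G (?c A \<union> (?c B \<inter> ?c C)) = ?c (generate G (A \<union> (B \<inter> C)))"
    "generate G (?c A \<union> ?c B) \<inter> ?c C = ?c (generate G (A \<union> B) \<inter> C)"
    if "A \<subseteq> carrier G" "B \<subseteq> carrier G" "C \<subseteq> carrier G" for A B C
  proof -
    have "A \<union> (B \<inter> C) \<subseteq> carrier G" "A \<union> B \<subseteq> carrier G" using that by auto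
    then show "generate G (?c A \<union> (?c B \<inter> ?c C)) = ?c (generate G (A \<union> (B \<inter> C)))"
      "generate G (?c A \<union> ?c B) \<inter> ?c C = ?c (generate G (A \<union> B) \<inter> C)"
      using c.generate_img[of "A \<union> (B \<inter> C)"] c.generate_img[of "A \<union> B"] that
      by (simp_all add: conj_image_Int[OF assms(2)] generate_incl image_Un)
  qed
  have inv_img: "X = ?c (?d X)" "subgroup (?d X) G" "?d X \<subseteq> carrier G" if "subgroup X G" for X
    using conj_image_inv(2)[OF assms(2) subgroup.subset[OF that]] subgroup_conj_image[OF ig that]
      subgroup.subset[OF subgroup_conj_image[OF ig that]] by auto
  have sub: "A \<subseteq> B" if "?c A \<subseteq> ?c B" "A \<subseteq> carrier G" "B \<subseteq> carrier G" for A B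
    using image_mono[OF that(1), of "conj_by G (inv g)"] unfolding conj_image_inv(1)[OF assms(2) that(2)]
      conj_image_inv(1)[OF assms(2) that(3)] .
  show ?thesis
    unfolding modular_subgroup_def
  proof (intro conjI allI impI)
    show "subgroup (?c M) G" using subgroup_conj_image[OF assms(2) MG] .
  next
    fix X Z assume X: "subgroup X G" and Z: "subgroup Z G" and XZ: "X \<subseteq> Z"
    define X' Z' where "X' = ?d X" and "Z' = ?d Z"
    have X': "X = ?c X'" "subgroup X' G" "X' \<subseteq> carrier G" and Z': "Z = ?c Z'" "subgroup Z' G" "Z' \<subseteq> carrier G"
      unfolding X'_def Z'_def using inv_img[OF X] inv_img[OF Z] by auto
    have "X' \<subseteq> Z'" using sub XZ X' Z' by blast
    then show "generate G (X \<union> (?c M \<inter> Z)) = generate G (X \<union> ?c M) \<inter> Z"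
      unfolding X'(1) Z'(1) step[OF X'(3) Mc Z'(3)]
      using modular_lowerD[OF assms(1) X'(2) Z'(2)] by simp
  next
    fix Y Z assume Y: "subgroup Y G" and Z: "subgroup Z G" and XZ: "?c M \<subseteq> Z"
    define Y' Z' where "Y' = ?d Y" and "Z' = ?d Z"
    have Y': "Y = ?c Y'" "subgroup Y' G" "Y' \<subseteq> carrier G" and Z': "Z = ?c Z'" "subgroup Z' G" "Z' \<subseteq> carrier G"
      unfolding Y'_def Z'_def using inv_img[OF Y] inv_img[OF Z] by auto
    have "M \<subseteq> Z'" using sub XZ Mc Z' by blast
    then show "generate G (?c M \<union> (Y \<inter> Z)) = generate G (?c M \<union> Y) \<inter> Z"
      unfolding Y'(1) Z'(1) step[OF Mc Y'(3) Z'(3)]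
      using modular_upperD[OF assms(1) Y'(2) Z'(2)] by simp
  qed
qed

lemma modular_restrict:
  assumes "modular_subgroup M G" "subgroup L G" "M \<subseteq> L"
  shows "modular_subgroup M (G\<lparr>carrier := L\<rparr>)"
proof -
  have eq: "generate (G\<lparr>carrier := L\<rparr>) A = generate G A" if "A \<subseteq> L" for A
    using generate_consistent[OF that assms(2)] .
  have sub: "subgroup X G" "X \<subseteq> L" if "subgroup X (G\<lparr>carrier := L\<rparr>)" for X
    using incl_subgroup[OF assms(2) that] subgroup.subset[OF that] by auto
  show ?thesis
    unfolding modular_subgroup_def
  proof (intro conjI allI impI)
    show "subgroup M (G\<lparr>carrier := L\<rparr>)"
      using subgroup_incl[OF modular_imp_subgroup[OF assms(1)] assms(2,3)] .
  next
    fix X Z assume X: "subgroup X (G\<lparr>carrier := L\<rparr>)" and Z: "subgroup Z (G\<lparr>carrier := L\<rparr>)" and XZ: "X \<subseteq> Z"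
    have "X \<union> (M \<inter> Z) \<subseteq> L" "X \<union> M \<subseteq> L" using sub[OF X] assms(3) by auto
    then show "generate (G\<lparr>carrier := L\<rparr>) (X \<union> (M \<inter> Z)) = generate (G\<lparr>carrier := L\<rparr>) (X \<union> M) \<inter> Z"
      using modular_lowerD[OF assms(1) sub(1)[OF X] sub(1)[OF Z] XZ] by (simp add: eq)
  next
    fix X Z assume X: "subgroup X (G\<lparr>carrier := L\<rparr>)" and Z: "subgroup Z (G\<lparr>carrier := L\<rparr>)" and XZ: "M \<subseteq> Z"
    have "M \<union> (X \<inter> Z) \<subseteq> L" "M \<union> X \<subseteq> L" using sub[OF X] assms(3) by auto
    then show "generate (G\<lparr>carrier := L\<rparr>) (M \<union> (X \<inter> Z)) = generate (G\<lparr>carrier := L\<rparr>) (M \<union> X) \<inter> Z"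
      using modular_upperD[OF assms(1) sub(1)[OF X] sub(1)[OF Z] XZ] by (simp add: eq)
  qed
qed

text \<open>Take \<open>L\<close> maximal among the proper modular subgroups above \<open>M\<close>, and let
  \<open>N\<close> be its normalizer. For \<open>y\<close> outside \<open>N\<close> the join of
  \<open>L\<close> with its conjugate under \<open>y\<close> is modular and larger than
  \<open>L\<close>, hence all of \<open>G\<close>. So every subgroup \<open>X\<close> outside
  \<open>N\<close> generates \<open>G\<close> together with \<open>L\<close>, and then the modular
  law for \<open>L\<close> and \<open>X \<subseteq> Y\<close> gives
  \<open>Y = \<langle>X, L \<inter> Y\<rangle>\<close>. As \<open>L\<close> lies in
  \<open>N\<close>, the subgroup \<open>X\<close> is \<open>Y\<close> as soon as it contains
  \<open>Y \<inter> N\<close>. If \<open>N\<close> is not \<open>G\<close>, it is therefore the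
  subgroup wanted; otherwise \<open>L\<close> is.\<close>

lemma modular_dichotomy:
  assumes "finite (carrier G)" "modular_subgroup M G" "M \<noteq> carrier G"
  obtains L where "subgroup L G" "M \<subseteq> L" "L \<noteq> carrier G"
    "L \<lhd> G \<or> hereditarily_primitive G (carrier G) L"
proof -
  define S where "S = {L. modular_subgroup L G \<and> M \<subseteq> L \<and> L \<noteq> carrier G}"
  have "S \<subseteq> Pow (carrier G)" unfolding S_def by (auto dest!: modular_imp_subgroup subgroup.subset)
  then have "finite S" using assms(1) finite_subset by blast
  moreover have "M \<in> S" unfolding S_def using assms by blast
  ultimately obtain L where L: "L \<in> S" and max: "\<And>L'. L' \<in> S \<Longrightarrow> L \<subseteq> L' \<Longrightarrow> L = L'"
    using finite_has_maximal[of S] by auto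
  have Lm: "modular_subgroup L G" "M \<subseteq> L" "L \<noteq> carrier G" using L unfolding S_def by auto
  note LG = modular_imp_subgroup[OF Lm(1)]
  note Lc = subgroup.subset[OF LG]
  define N where "N = normalizer_of G L"
  have NG: "subgroup N G" unfolding N_def using subgroup_normalizer_of[OF Lc] .
  have LN: "L \<subseteq> N" unfolding N_def using subgroup_le_normalizer[OF LG] .
  show thesis
  proof (cases "N = carrier G")
    case True
    then show thesis using that[OF LG Lm(2,3)] normal_iff_normalizer[OF LG] unfolding N_def by blast
  next
    case False
    have join: "generate G (L \<union> conj_by G y ` L) = carrier G" if y: "y \<in> carrier G" "y \<notin> N" for y
    proof (rule ccontr)
      let ?J = "generate G (L \<union> conj_by G y ` L)"
      assume "?J \<noteq> carrier G"
      moreover have sup: "L \<union> conj_by G y ` L \<subseteq> ?J" by (rule generate_superset)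
      ultimately have "?J \<in> S"
        unfolding S_def using modular_join[OF Lm(1) modular_conj[OF Lm(1) y(1)]] Lm(2) by blast
      then have "?J = L" using max sup by blast
      then have "conj_by G y ` L \<subseteq> L" using sup by simp
      then have "conj_by G y ` L = L"
        using card_subset_eq[of L] finite_subgroup[OF assms(1) LG] card_conj_image[OF y(1) Lc] by simp
      then show False using y unfolding N_def normalizer_of_def by simp
    qed
    have "hereditarily_primitive G (carrier G) N"
      unfolding hereditarily_primitive_def
    proof (intro conjI allI impI)
      show "subgroup (carrier G) G" by (rule subgroup_self)
      show "subgroup N G" by fact
      show "N \<subset> carrier G" using False subgroup.subset[OF NG] by blast
    next
      fix X Y assume X: "subgroup X G" and Y: "subgroup Y G" and YN: "Y \<inter> N \<subseteq> X" and XY: "X \<subseteq> Y" and "\<not> X \<subseteq> N"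
      then obtain y where y: "y \<in> X" "y \<notin> N" by blast
      note Xc = subgroup.subset[OF X] and Yc = subgroup.subset[OF Y]
      have yc: "y \<in> carrier G" using y Xc by blast
      define J where "J = generate G (X \<union> L)"
      have JG: "subgroup J G" unfolding J_def using generate_is_subgroup Xc Lc by simp
      have sup: "X \<union> L \<subseteq> J" unfolding J_def by (rule generate_superset)
      then have "conj_by G y ` L \<subseteq> J"
        using conj_image_self[OF JG, of y] y(1) image_mono[of L J "conj_by G y"] by blast
      then have "L \<union> conj_by G y ` L \<subseteq> J" using sup by simp
      then have "carrier G \<subseteq> J" using generate_subgroup_incl[OF _ JG] unfolding join[OF yc y(2), symmetric] by simp
      then have "generate G (X \<union> L) \<inter> Y = Y" unfolding J_def using Yc by blast
      then have "generate G (X \<union> (L \<inter> Y)) = Y" using modular_lowerD[OF Lm(1) X Y XY] by simp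
      moreover have "X \<union> (L \<inter> Y) = X" using YN LN by blast
      ultimately show "X = Y" using generate_subgroup_eq[OF X] by simp
    qed
    then show thesis using that[OF NG _ False] Lm(2) LN by blast
  qed
qed

end

section \<open>Faithful hereditarily primitive actions\<close>

text \<open>Modulo the normal subgroup \<open>N\<close> the group \<open>Z\<close> has order
  \<open>r * e\<close> with the normal subgroup \<open>E\<close> of prime order \<open>r\<close>,
  and \<open>L\<close> is a complement of it whose order \<open>e\<close> is \<open>1\<close> or a
  smaller prime: either a group of prime order or one of order \<open>r * e\<close>, acting on
  \<open>r\<close> points. The orders are compared with that of \<open>N\<close> to avoid quotients,
  whose elements have another type.\<close>

definition prime_frobenius :: "('a, 'b) monoid_scheme \<Rightarrow> 'a set \<Rightarrow> 'a set \<Rightarrow> bool" where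
  "prime_frobenius G Z L \<longleftrightarrow> (\<exists>N E r e. subgroup N G \<and> subgroup E G \<and> N \<subseteq> L \<and> N \<subseteq> E \<and> E \<subseteq> Z \<and>
     Z \<subseteq> normalizer_of G N \<and> Z \<subseteq> normalizer_of G E \<and> prime (r::nat) \<and>
     card E = r * card N \<and> card L = e * card N \<and> card Z = r * e * card N \<and> (e = 1 \<or> prime e \<and> e < r))"

context group
begin

lemma hereditarily_primitiveD:
  assumes "hereditarily_primitive G Z L" "subgroup X G" "subgroup Y G" "Y \<inter> L \<subseteq> X" "X \<subseteq> Y" "Y \<subseteq> Z" "\<not> X \<subseteq> L"
  shows "X = Y"
  using assms unfolding hereditarily_primitive_def by blast

lemma hereditarily_primitive_restrict:
  assumes "hereditarily_primitive G Z L" "subgroup Y G" "Y \<subseteq> Z" "\<not> Y \<subseteq> L"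
  shows "hereditarily_primitive G Y (Y \<inter> L)"
  unfolding hereditarily_primitive_def
proof (intro conjI allI impI)
  have "subgroup L G" using assms(1) unfolding hereditarily_primitive_def by blast
  then show "subgroup (Y \<inter> L) G" using subgroups_Inter_pair assms(2) by blast
  show "Y \<inter> L \<subset> Y" using assms(4) by blast
next
  fix X Y' assume "subgroup X G" "subgroup Y' G" "Y' \<inter> (Y \<inter> L) \<subseteq> X" "X \<subseteq> Y'" "Y' \<subseteq> Y" "\<not> X \<subseteq> Y \<inter> L"
  then show "X = Y'" by (intro hereditarily_primitiveD[OF assms(1)]) (use assms(3) in auto)
qed (fact assms(2))

lemma hereditarily_primitive_conj:
  assumes "hereditarily_primitive G Z L" "g \<in> carrier G"
  shows "hereditarily_primitive G (conj_by G g ` Z) (conj_by G g ` L)"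
proof -
  have ZL: "subgroup Z G" "subgroup L G" "L \<subset> Z" using assms(1) unfolding hereditarily_primitive_def by auto
  note c = ZL(1,2)[THEN subgroup.subset]
  have ig: "inv g \<in> carrier G" using assms(2) by simp
  show ?thesis
    unfolding hereditarily_primitive_def
  proof (intro conjI allI impI)
    show "subgroup (conj_by G g ` Z) G" "subgroup (conj_by G g ` L) G"
      using ZL subgroup_conj_image[OF assms(2)] by auto
    show "conj_by G g ` L \<subset> conj_by G g ` Z"
      using ZL(3) inj_on_image_eq_iff[OF inj_on_conj[OF assms(2)] c] by (auto simp: psubset_eq image_mono)
  next
    fix X Y assume X: "subgroup X G" and Y: "subgroup Y G" and *: "Y \<inter> conj_by G g ` L \<subseteq> X"
      "X \<subseteq> Y" "Y \<subseteq> conj_by G g ` Z" "\<not> X \<subseteq> conj_by G g ` L"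
    define X' Y' where "X' = conj_by G (inv g) ` X" and "Y' = conj_by G (inv g) ` Y"
    note Xc = subgroup.subset[OF X] and Yc = subgroup.subset[OF Y]
    have sX: "subgroup X' G" "subgroup Y' G" unfolding X'_def Y'_def
      using X Y subgroup_conj_image[OF ig] by auto
    have L': "L = conj_by G (inv g) ` conj_by G g ` L" and Z': "Z = conj_by G (inv g) ` conj_by G g ` Z"
      using conj_image_inv(1)[OF assms(2)] c by auto
    have X: "X = conj_by G g ` X'" "Y = conj_by G g ` Y'" unfolding X'_def Y'_def
      using conj_image_inv(2)[OF assms(2)] Xc Yc by auto
    have "Y' \<inter> L \<subseteq> X'"
      using image_mono[OF *(1), of "conj_by G (inv g)"]
      unfolding conj_image_Int[OF ig Yc conj_image_subset[OF assms(2) c(2)]] L'[symmetric]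
      by (simp add: X'_def Y'_def)
    moreover have "X' \<subseteq> Y'" using *(2) unfolding X'_def Y'_def by (rule image_mono)
    moreover have "Y' \<subseteq> Z" unfolding Y'_def by (subst Z') (rule image_mono[OF *(3)])
    moreover have "\<not> X' \<subseteq> L" using *(4) unfolding X(1) by (auto intro: image_mono)
    ultimately have "X' = Y'" using hereditarily_primitiveD[OF assms(1) sX] by blast
    then show "X = Y" using X by simp
  qed
qed

end

text \<open>The structure of proper subgroups is an assumption here because it comes from an induction over
  the subgroups of a fixed group, whereas faithfulness requires a quotient and thus another type of
  elements.\<close>

locale faithful_hereditarily_primitive = group +
  fixes M
  assumes fin: "finite (carrier G)"
    and prim: "hereditarily_primitive G (carrier G) M"
    and faithful: "\<And>x. x \<in> carrier G \<Longrightarrow> (\<And>g. g \<in> carrier G \<Longrightarrow> x \<in> conj_by G g ` M) \<Longrightarrow> x = \<one>"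
    and proper_subgroups: "\<And>Z g. subgroup Z G \<Longrightarrow> Z \<noteq> carrier G \<Longrightarrow> g \<in> carrier G \<Longrightarrow> \<not> Z \<subseteq> conj_by G g ` M \<Longrightarrow>
       prime_frobenius G Z (Z \<inter> conj_by G g ` M)"
begin

text \<open>The conjugates of \<open>M\<close> stand for the points of the action of \<open>G\<close> on the
  cosets of \<open>M\<close>, each point being represented by its stabilizer: an element fixes the
  point \<open>K\<close> if it lies in \<open>K\<close>.\<close>

definition points :: "'a set set" where
  "points = (\<lambda>g. conj_by G g ` M) ` carrier G"

lemma subgroup_M: "subgroup M G" and M_subset: "M \<subseteq> carrier G" and M_proper: "M \<noteq> carrier G"
  using prim subgroup.subset[of M G] unfolding hereditarily_primitive_def by auto

lemma M_point: "M \<in> points"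
  unfolding points_def using conj_image_one[OF M_subset] by (metis image_eqI one_closed)

lemma point_conj:
  assumes "K \<in> points" "g \<in> carrier G"
  shows "conj_by G g ` K \<in> points"
proof -
  obtain h where h: "h \<in> carrier G" "K = conj_by G h ` M" using assms(1) unfolding points_def by blast
  then have "conj_by G g ` K = conj_by G (g \<otimes> h) ` M" using conj_image_comp assms(2) M_subset by simp
  then show ?thesis unfolding points_def using h(1) assms(2) by simp
qed

lemma point_transitive:
  assumes "K \<in> points" "K' \<in> points"
  obtains g where "g \<in> carrier G" "K' = conj_by G g ` K"
proof -
  obtain h where h: "h \<in> carrier G" "K = conj_by G h ` M" using assms(1) unfolding points_def by blast
  obtain h' where h': "h' \<in> carrier G" "K' = conj_by G h' ` M" using assms(2) unfolding points_def by blast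
  have "conj_by G (h' \<otimes> inv h) ` K = conj_by G h' ` conj_by G (inv h) ` K"
    using conj_image_comp[of h' "inv h" K] h h' conj_image_subset[OF h(1) M_subset] by simp
  then have "conj_by G (h' \<otimes> inv h) ` K = K'"
    using h h' conj_image_inv(1)[OF h(1) M_subset] by simp
  then show thesis using that[of "h' \<otimes> inv h"] h h' by simp
qed

lemma point_subgroup: "K \<in> points \<Longrightarrow> subgroup K G"
  and point_subset: "K \<in> points \<Longrightarrow> K \<subseteq> carrier G"
  and point_card: "K \<in> points \<Longrightarrow> card K = card M"
  and point_finite: "K \<in> points \<Longrightarrow> finite K"
proof -
  assume K: "K \<in> points"
  show "subgroup K G" using K subgroup_conj_image[OF _ subgroup_M] unfolding points_def by blast
  then show "K \<subseteq> carrier G" "finite K" using subgroup.subset[of K G] finite_subgroup[OF fin] by auto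
  show "card K = card M" using K card_conj_image[OF _ M_subset] unfolding points_def by blast
qed

lemma point_faithful: "x \<in> carrier G \<Longrightarrow> (\<And>K. K \<in> points \<Longrightarrow> x \<in> K) \<Longrightarrow> x = \<one>"
  using faithful unfolding points_def by blast

lemma point_primitive:
  assumes "K \<in> points"
  shows "hereditarily_primitive G (carrier G) K"
proof -
  obtain h where h: "h \<in> carrier G" "K = conj_by G h ` M" using assms(1) unfolding points_def by blast
  have "conj_by G h ` carrier G = carrier G" using conj_image_self[OF subgroup_self h(1)] .
  then show ?thesis using hereditarily_primitive_conj[OF prim h(1)] h(2) by simp
qed

lemma point_maximal_meet:
  assumes "K \<in> points" "subgroup X G" "subgroup Y G" "Y \<inter> K \<subseteq> X" "X \<subseteq> Y" "\<not> X \<subseteq> K"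
  shows "X = Y"
  using hereditarily_primitiveD[OF point_primitive[OF assms(1)] assms(2-5)] subgroup.subset[OF assms(3)] assms(6) by blast

lemma point_maximal:
  assumes "K \<in> points" "subgroup X G" "K \<subseteq> X" "\<not> X \<subseteq> K"
  shows "X = carrier G"
  by (rule point_maximal_meet[OF assms(1,2) subgroup_self _ subgroup.subset[OF assms(2)] assms(4)]) (use assms(3) in auto)

lemma point_frobenius:
  assumes "K \<in> points" "subgroup Z G" "Z \<noteq> carrier G" "\<not> Z \<subseteq> K"
  shows "prime_frobenius G Z (Z \<inter> K)"
  using assms proper_subgroups unfolding points_def by blast

text \<open>A normal subgroup inside one point lies in all of them.\<close>

lemma normal_in_point_trivial:
  assumes "subgroup A G" "normalizer_of G A = carrier G" "K \<in> points" "A \<subseteq> K"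
  shows "A = {\<one>}"
proof -
  have "x = \<one>" if "x \<in> A" for x
  proof (rule point_faithful)
    show "x \<in> carrier G" using that subgroup.mem_carrier[OF assms(1)] by blast
    fix K' assume "K' \<in> points"
    then obtain g where g: "g \<in> carrier G" "K' = conj_by G g ` K" using point_transitive[OF assms(3)] by blast
    have "A = conj_by G g ` A" using g(1) assms(2) normalizer_of_conj by blast
    also have "\<dots> \<subseteq> K'" unfolding g(2) using assms(4) by (rule image_mono)
    finally show "x \<in> K'" using that by blast
  qed
  then show ?thesis using subgroup.one_closed[OF assms(1)] by blast
qed

text \<open>Writing the element that conjugates \<open>K'\<close> to \<open>K\<close> as a product of elements
  of \<open>K\<close> and \<open>K'\<close> shows that the two are equal.\<close>

lemma point_product_proper:
  assumes "K \<in> points" "K' \<in> points" "K <#> K' = carrier G"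
  shows "K = K'"
proof -
  obtain g where g: "g \<in> carrier G" "K = conj_by G g ` K'" using point_transitive[OF assms(2,1)] .
  then obtain k m where km: "k \<in> K" "m \<in> K'" "g = k \<otimes> m" using assms(3) unfolding set_mult_def by blast
  have kc: "k \<in> carrier G" "m \<in> carrier G" using km point_subset assms by auto
  have "K = conj_by G k ` conj_by G m ` K'"
    unfolding g(2) km(3) using conj_image_comp[OF kc point_subset[OF assms(2)]] by simp
  also have "\<dots> = conj_by G k ` K'" using conj_image_self[OF point_subgroup[OF assms(2)] km(2)] by simp
  finally have "conj_by G k ` K = conj_by G k ` K'" using conj_image_self[OF point_subgroup[OF assms(1)] km(1)] by simp
  then show ?thesis
    using inj_on_image_eq_iff[OF inj_on_conj[OF kc(1)]] point_subset assms(1,2) by blast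
qed

text \<open>Primitivity makes the trivial subgroup \<open>A \<inter> K\<close> maximal in \<open>A\<close>.\<close>

lemma prime_of_trivial_point_meet:
  assumes "K \<in> points" "subgroup A G" "A \<inter> K = {\<one>}" "A \<noteq> {\<one>}"
  shows "prime (card A)"
proof (rule card_prime_of_simple_lattice[OF fin assms(2,4)])
  fix X assume X: "subgroup X G" "X \<subseteq> A" "X \<noteq> {\<one>}"
  show "X = A"
  proof (rule point_maximal_meet[OF assms(1) X(1) assms(2) _ X(2)])
    show "A \<inter> K \<subseteq> X" using assms(3) subgroup.one_closed[OF X(1)] by simp
    show "\<not> X \<subseteq> K" using assms(3) X(2,3) subgroup.one_closed[OF X(1)] by blast
  qed
qed

text \<open>Let \<open>C\<close> be the common centralizer of \<open>y\<close> and \<open>z\<close>, and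
  \<open>D = C \<inter> K\<close>. If \<open>y\<close> is not in \<open>K\<close>, then by
  primitivity adjoining \<open>y\<close> to \<open>D\<close> yields all of \<open>C\<close>, so that
  \<open>D\<close> has index \<open>p\<close> in \<open>C\<close>. If \<open>z\<close> is not in
  \<open>K\<close> either, then the index is also \<open>u\<close>.\<close>

lemma commuting_disjoint_support:
  assumes "K \<in> points" "y \<in> carrier G" "z \<in> carrier G" "y \<otimes> z = z \<otimes> y"
    and "ord y = p" "ord z = u" "prime (p::nat)" "prime (u::nat)" "p \<noteq> u"
  shows "y \<in> K \<or> z \<in> K"
proof (rule ccontr)
  assume "\<not> (y \<in> K \<or> z \<in> K)"
  then have nK: "y \<notin> K" "z \<notin> K" by auto
  define C where "C = centralizer_of G y \<inter> centralizer_of G z"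
  have C: "subgroup C G" unfolding C_def
    using subgroups_Inter_pair[OF subgroup_centralizer_of[OF assms(2)] subgroup_centralizer_of[OF assms(3)]] .
  have yz: "y \<in> C" "z \<in> C" unfolding C_def centralizer_of_def using assms by auto
  define D where "D = C \<inter> K"
  have D: "subgroup D G" unfolding D_def using subgroups_Inter_pair[OF C point_subgroup[OF assms(1)]] .
  have card_C: "card C = q * card D" if w: "w \<in> C" "w \<notin> K" "ord w = q" "prime q" "w = y \<or> w = z" for w and q :: nat
  proof -
    have wc: "w \<in> carrier G" using w assms by auto
    have "w \<otimes> d = d \<otimes> w" if "d \<in> D" for d
      using that w(5) unfolding D_def C_def centralizer_of_def by auto
    then have wn: "w \<in> normalizer_of G D"
      using commuting_mem_normalizer[OF wc subgroup.subset[OF D]] by blast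
    have "w \<notin> D" using w(2) unfolding D_def by blast
    then obtain X where X: "subgroup X G" "D \<subseteq> X" "w \<in> X" "card X = q * card D"
      "\<And>Z. subgroup Z G \<Longrightarrow> D \<subseteq> Z \<Longrightarrow> w \<in> Z \<Longrightarrow> X \<subseteq> Z"
      using adjoin_prime_order[OF fin D wn w(3,4)] by blast
    have "X \<subseteq> C" using X(5)[OF C] w(1) unfolding D_def by blast
    then have "X = C"
      using point_maximal_meet[OF assms(1) X(1) C] X(2,3) w(2) unfolding D_def by blast
    then show ?thesis using X(4) by simp
  qed
  have "p * card D = u * card D"
    using card_C[OF yz(1) nK(1) assms(5,7)] card_C[OF yz(2) nK(2) assms(6,8)] by presburger
  then show False using assms(9) card_subgroup_pos[OF fin D] by simp
qed

text \<open>Since \<open>M\<close> is maximal and \<open>A\<close> is not contained in it, every subgroup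
  normalized by \<open>M\<close> and by \<open>A\<close> is normal, hence trivial if it lies in
  \<open>M\<close>. This applies to \<open>A \<inter> M\<close> and to the centralizer
  \<open>B\<close> of \<open>A\<close> in \<open>M\<close>. So \<open>A\<close> is a regular normal
  subgroup, of prime order \<open>r\<close> by primitivity. An element of \<open>M\<close> and of
  its conjugate under a nontrivial \<open>g \<in> A\<close> commutes with \<open>g\<close>, hence
  with \<open>A\<close>, and is trivial. So \<open>M\<close> has prime order if it is not trivial,
  and this order is less than \<open>r\<close> because \<open>M\<close> and its conjugate have a
  product of \<open>card M * card M\<close> elements, which is not all of \<open>G\<close>.\<close>

lemma frobenius_of_abelian_normal:
  assumes A: "subgroup A G" "normalizer_of G A = carrier G" "A \<noteq> {\<one>}"
    and comm: "\<And>a b. a \<in> A \<Longrightarrow> b \<in> A \<Longrightarrow> a \<otimes> b = b \<otimes> a"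
  shows "prime_frobenius G (carrier G) M"
proof -
  note Ac = subgroup.subset[OF A(1)]
  have AM: "\<not> A \<subseteq> M" using normal_in_point_trivial[OF A(1,2) M_point] A(3) by blast
  have normal: "normalizer_of G D = carrier G" if D: "subgroup D G" "M \<subseteq> normalizer_of G D" "A \<subseteq> normalizer_of G D" for D
    using point_maximal[OF M_point subgroup_normalizer_of[OF subgroup.subset[OF D(1)]] D(2)] D(3) AM by blast
  have M_norm_A: "conj_by G m a \<in> A" if "m \<in> M" "a \<in> A" for m a
    using normalizer_of_mem[of m A a] A(2) that M_subset by blast
  have AM1: "A \<inter> M = {\<one>}"
  proof -
    have S: "subgroup (A \<inter> M) G" using subgroups_Inter_pair[OF A(1) subgroup_M] .
    have "M \<subseteq> normalizer_of G (A \<inter> M)"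
    proof (rule subset_normalizer_ofI[OF subgroup_M subgroup.subset[OF S]])
      fix m x assume "m \<in> M" "x \<in> A \<inter> M"
      then show "conj_by G m x \<in> A \<inter> M"
        using M_norm_A normalizer_of_mem[of m M x] subgroup_le_normalizer[OF subgroup_M] by blast
    qed
    moreover have "A \<subseteq> normalizer_of G (A \<inter> M)"
    proof
      fix a assume "a \<in> A"
      then show "a \<in> normalizer_of G (A \<inter> M)"
        by (intro commuting_mem_normalizer) (use Ac comm in auto)
    qed
    ultimately show ?thesis using normal_in_point_trivial[OF S normal[OF S] M_point] by blast
  qed
  define r where "r = card A"
  have r: "prime r" unfolding r_def using prime_of_trivial_point_meet[OF M_point A(1) AM1 A(3)] .
  have A_min: "X = A" if X: "subgroup X G" "X \<subseteq> A" "X \<noteq> {\<one>}" for X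
  proof (rule point_maximal_meet[OF M_point X(1) A(1) _ X(2)])
    show "A \<inter> M \<subseteq> X" using AM1 subgroup.one_closed[OF X(1)] by simp
    show "\<not> X \<subseteq> M" using AM1 X(2,3) subgroup.one_closed[OF X(1)] by blast
  qed
  have "subgroup (A <#> M) G" "A \<subseteq> A <#> M" "M \<subseteq> A <#> M"
    using subgroup_set_mult_normalizer[OF A(1) subgroup_M] A(2) M_subset by auto
  then have "A <#> M = carrier G" using point_maximal[OF M_point, of "A <#> M"] AM by blast
  then have cG: "card (carrier G) = r * card M"
    using card_set_mult[OF fin A(1) subgroup_M] AM1 unfolding r_def by simp
  have e: "card M = 1 \<or> prime (card M) \<and> card M < r"
  proof (cases "M = {\<one>}")
    case True then show ?thesis by simp
  next
    case False
    obtain g where g: "g \<in> A" "g \<noteq> \<one>" using A(3) subgroup.one_closed[OF A(1)] by blast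
    have gc: "g \<in> carrier G" using g Ac by blast
    define K where "K = conj_by G g ` M"
    have Kp: "K \<in> points" unfolding K_def using point_conj[OF M_point gc] .
    have MK: "M \<inter> K = {\<one>}"
    proof -
      define B where "B = {m \<in> M. \<forall>a\<in>A. m \<otimes> a = a \<otimes> m}"
      have B_eq: "B = M \<inter> (\<Inter>a\<in>A. centralizer_of G a)"
        unfolding B_def centralizer_of_def using M_subset by auto
      have "subgroup (\<Inter> (insert M (centralizer_of G ` A))) G"
        by (rule subgroups_Inter) (use subgroup_M subgroup_centralizer_of Ac in auto)
      then have BG: "subgroup B G" unfolding B_eq by simp
      have "M \<subseteq> normalizer_of G B"
      proof (rule subset_normalizer_ofI[OF subgroup_M subgroup.subset[OF BG]])
        fix m x assume m: "m \<in> M" and x: "x \<in> B"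
        have mc: "m \<in> carrier G" "x \<in> carrier G" "inv m \<in> M"
          using m x M_subset subgroup.m_inv_closed[OF subgroup_M] unfolding B_def by auto
        have "conj_by G m x \<in> M"
          using m x normalizer_of_mem[of m M x] subgroup_le_normalizer[OF subgroup_M] unfolding B_def by blast
        moreover have "conj_by G m x \<otimes> a = a \<otimes> conj_by G m x" if a: "a \<in> A" for a
        proof -
          have ac: "a \<in> carrier G" using a Ac by blast
          define b where "b = conj_by G (inv m) a"
          have b: "b \<in> A" "b \<in> carrier G" "a = conj_by G m b"
            unfolding b_def using M_norm_A[OF mc(3) a] Ac conj_simps(6)[OF mc(1) mc(1) ac ac] by auto
          have "x \<otimes> b = b \<otimes> x" using x b(1) unfolding B_def by blast
          then show ?thesis unfolding b(3) using conj_simps(3)[OF mc(1) mc(1)] mc b by metis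
        qed
        ultimately show "conj_by G m x \<in> B" unfolding B_def by blast
      qed
      moreover have "A \<subseteq> normalizer_of G B"
      proof
        fix a assume "a \<in> A"
        then show "a \<in> normalizer_of G B"
          by (intro commuting_mem_normalizer) (use Ac M_subset in \<open>auto simp: B_def\<close>)
      qed
      ultimately have B1: "B = {\<one>}"
        using normal_in_point_trivial[OF BG normal[OF BG] M_point] unfolding B_def by blast
      have "x = \<one>" if x: "x \<in> M" "x \<in> K" for x
      proof -
        obtain m where m: "m \<in> M" "x = conj_by G g m" using x(2) unfolding K_def by blast
        have mc: "m \<in> carrier G" "x \<in> carrier G" using m x M_subset by auto
        have "x \<otimes> inv m \<in> M" using x(1) m(1) subgroup.m_closed[OF subgroup_M] subgroup.m_inv_closed[OF subgroup_M] by blast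
        moreover have "x \<otimes> inv m = g \<otimes> conj_by G m (inv g)"
          unfolding m(2) using mc gc by (simp add: conj_by_def m_assoc)
        moreover have "g \<otimes> conj_by G m (inv g) \<in> A"
          using subgroup.m_closed[OF A(1) g(1) M_norm_A[OF m(1) subgroup.m_inv_closed[OF A(1) g(1)]]] .
        ultimately have "x \<otimes> inv m = \<one>" using AM1 by (metis IntI singletonD)
        then have "x = m" using mc by (metis inv_equality inv_inv inv_closed)
        then have xg: "g \<otimes> x = x \<otimes> g" using m(2) gc mc by (metis conj_eq_iff_commute)
        have "A \<inter> centralizer_of G x = A"
        proof (rule A_min)
          show "subgroup (A \<inter> centralizer_of G x) G"
            using subgroups_Inter_pair[OF A(1) subgroup_centralizer_of[OF mc(2)]] .
          have "g \<in> A \<inter> centralizer_of G x" using g gc xg unfolding centralizer_of_def by blast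
          then show "A \<inter> centralizer_of G x \<noteq> {\<one>}" using g(2) by blast
        qed blast
        then have "a \<otimes> x = x \<otimes> a" if "a \<in> A" for a
          using that unfolding centralizer_of_def by blast
        then have "x \<in> B" using x(1) by (simp add: B_def)
        then show ?thesis using B1 by blast
      qed
      then show ?thesis
        using subgroup.one_closed[OF subgroup_M] subgroup.one_closed[OF point_subgroup[OF Kp]] by blast
    qed
    have pM: "prime (card M)" using prime_of_trivial_point_meet[OF Kp subgroup_M MK False] .
    have cK: "card K = card M" using point_card[OF Kp] .
    have KM: "card (K <#> M) = card M * card M"
      using card_set_mult[OF fin point_subgroup[OF Kp] subgroup_M] MK cK by (simp add: Int_commute)
    have KMc: "K <#> M \<subseteq> carrier G" using setmult_subset_G[OF point_subset[OF Kp] M_subset] .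
    have "card M * card M \<le> r * card M" using card_mono[OF fin KMc] KM cG by simp
    then have "card M \<le> r" using card_subgroup_pos[OF fin subgroup_M] by simp
    moreover have "card M \<noteq> r"
    proof
      assume "card M = r"
      then have "K <#> M = carrier G" using card_subset_eq[OF fin KMc] KM cG by simp
      then have "K = M" by (rule point_product_proper[OF Kp M_point])
      then show False using MK False by blast
    qed
    ultimately show ?thesis using pM by simp
  qed
  have "subgroup {\<one>} G" "normalizer_of G {\<one>} = carrier G"
    using triv_subgroup by (auto simp: normalizer_of_def)
  then show ?thesis
    unfolding prime_frobenius_def
    by (intro exI[of _ "{\<one>}"] exI[of _ A] exI[of _ r] exI[of _ "card M"])
      (use A(1,2) subgroup.one_closed[OF A(1)] subgroup.one_closed[OF subgroup_M] Ac r e cG r_def in auto)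
qed

text \<open>A normal point is trivial, so that \<open>G\<close> has no proper nontrivial subgroups by
  maximality.\<close>

lemma frobenius_of_normal_point:
  assumes "normalizer_of G M = carrier G"
  shows "prime_frobenius G (carrier G) M"
proof -
  have M1: "M = {\<one>}" using normal_in_point_trivial[OF subgroup_M assms M_point] by simp
  then have "prime (card (carrier G))"
    using prime_of_trivial_point_meet[OF M_point subgroup_self] M_proper by auto
  then show ?thesis
    unfolding prime_frobenius_def
    by (intro exI[of _ "{\<one>}"] exI[of _ "carrier G"] exI[of _ "card (carrier G)"] exI[of _ 1])
      (use M1 subgroup_M assms subgroup_self subgroup_le_normalizer[OF subgroup_self] in auto)
qed

end

section \<open>Point stabilizers in the absence of abelian normal subgroups\<close>

text \<open>The two ways in which the structure theorem can hold directly are excluded: a regular abelian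
  normal subgroup, and a normal point. The aim is a contradiction.\<close>

locale frobenius_counterexample = faithful_hereditarily_primitive +
  fixes p :: nat
  assumes no_abelian_normal: "\<And>A. subgroup A G \<Longrightarrow> normalizer_of G A = carrier G \<Longrightarrow>
      (\<And>a b. a \<in> A \<Longrightarrow> b \<in> A \<Longrightarrow> a \<otimes> b = b \<otimes> a) \<Longrightarrow> A = {\<one>}"
    and not_normal: "normalizer_of G M \<noteq> carrier G"
    and p_prime: "prime p" and p_dvd: "p dvd card M"
    and p_largest: "\<And>u. prime u \<Longrightarrow> u dvd card M \<Longrightarrow> u \<le> p"
begin

lemma point_eqI: "K \<in> points \<Longrightarrow> K' \<in> points \<Longrightarrow> K \<subseteq> K' \<Longrightarrow> K = K'"
  using card_subset_eq[OF point_finite[of K']] point_card by simp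

lemma normalizer_point: 
  assumes "K \<in> points"
  shows "normalizer_of G K = K"
proof (rule ccontr)
  assume "normalizer_of G K \<noteq> K"
  then have "normalizer_of G K = carrier G"
    using point_maximal[OF assms subgroup_normalizer_of[OF point_subset[OF assms]]]
      subgroup_le_normalizer[OF point_subgroup[OF assms]] by blast
  then have "K = {\<one>}" using normal_in_point_trivial[OF point_subgroup[OF assms] _ assms] by simp
  then have "M = {\<one>}" using point_card[OF assms] subgroup_eq_one_iff_card[OF fin subgroup_M] by simp
  then show False using not_normal by (auto simp: normalizer_of_def)
qed

text \<open>The center of \<open>G\<close> is an abelian normal subgroup and therefore trivial.\<close>

lemma centralizer_proper:
  assumes "x \<in> carrier G" "x \<noteq> \<one>"
  shows "centralizer_of G x \<noteq> carrier G"
proof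
  assume x: "centralizer_of G x = carrier G"
  define A where "A = (\<Inter>c\<in>carrier G. centralizer_of G c)"
  have "subgroup (\<Inter> (centralizer_of G ` carrier G)) G"
    by (rule subgroups_Inter) (use subgroup_centralizer_of one_closed in blast)+
  then have AG: "subgroup A G" unfolding A_def .
  have comm: "a \<otimes> c = c \<otimes> a" if "a \<in> A" "c \<in> carrier G" for a c
    using that unfolding A_def centralizer_of_def by blast
  note Ac = subgroup.subset[OF AG]
  have "normalizer_of G A = carrier G"
    using commuting_mem_normalizer[OF _ Ac] comm normalizer_of_subset by (metis subsetI subset_antisym)
  then have "A = {\<one>}" using no_abelian_normal[OF AG] comm Ac by blast
  moreover have "c \<otimes> x = x \<otimes> c" if "c \<in> carrier G" for c
    using x that unfolding centralizer_of_def by blast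
  then have "x \<in> A" using assms(1) by (simp add: A_def centralizer_of_def)
  ultimately show False using assms(2) by blast
qed

text \<open>As a subgroup this is obtained only from \<open>p_part_commute\<close>; it turns out to be the
  normal Sylow \<open>p\<close>-subgroup of the point.\<close>

definition p_part :: "'a set \<Rightarrow> 'a set" where
  "p_part K = {x \<in> K. x [^] p = \<one>}"

lemma p_part_subset: "p_part K \<subseteq> K"
  by (auto simp: p_part_def)

lemma p_part_ord:
  assumes "K \<in> points" "x \<in> p_part K" "x \<noteq> \<one>"
  shows "ord x = p"
  using assms point_subset[OF assms(1)] ord_prime_iff[OF _ p_prime, of x] unfolding p_part_def by auto

lemma p_partI: "x \<in> K \<Longrightarrow> K \<in> points \<Longrightarrow> ord x = p \<Longrightarrow> x \<in> p_part K"
  using point_subset[of K] unfolding p_part_def by (auto intro: pow_ord_eq_1)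

text \<open>It suffices that the commutator lies in every other point \<open>K'\<close>. On the orbit of
  \<open>K'\<close> the group \<open>K\<close> acts with normal series
  \<open>N \<subseteq> E \<subseteq> K\<close> as in \<open>prime_frobenius\<close>. As
  \<open>p\<close> is the largest prime divisor of the order of \<open>K\<close>, it does not divide
  the index \<open>e < r \<le> p\<close> of \<open>E\<close>, so that elements of order
  \<open>p\<close> lie in \<open>E\<close>, and \<open>E\<close> is abelian modulo \<open>N\<close>.\<close>

lemma p_part_commute:
  assumes K: "K \<in> points" and x: "x \<in> p_part K" and y: "y \<in> p_part K"
  shows "x \<otimes> y = y \<otimes> x"
proof -
  have xK: "x \<in> K" "y \<in> K" using x y p_part_subset by auto
  have xc: "x \<in> carrier G" "y \<in> carrier G" using xK point_subset[OF K] by auto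
  have "conj_by G x y \<otimes> inv y = \<one>"
  proof (rule point_faithful)
    show "conj_by G x y \<otimes> inv y \<in> carrier G" using xc by simp
    fix K' assume K': "K' \<in> points"
    show "conj_by G x y \<otimes> inv y \<in> K'"
    proof (cases "K = K'")
      case True
      then show ?thesis
        using xK subgroup.m_closed[OF point_subgroup[OF K']] subgroup.m_inv_closed[OF point_subgroup[OF K']]
        unfolding conj_by_def by blast
    next
      case False
      then have "\<not> K \<subseteq> K'" using point_eqI[OF K K'] by blast
      moreover have "K \<noteq> carrier G" using point_primitive[OF K] unfolding hereditarily_primitive_def by blast
      ultimately obtain N E r e where NE: "subgroup N G" "subgroup E G" "N \<subseteq> K \<inter> K'" "N \<subseteq> E" "E \<subseteq> K"
        "K \<subseteq> normalizer_of G N" "K \<subseteq> normalizer_of G E" "prime r"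
        "card E = r * card N" "card K = r * e * card N" "e = 1 \<or> prime e \<and> e < r"
        using point_frobenius[OF K' point_subgroup[OF K]] unfolding prime_frobenius_def by blast
      have "r dvd card M" using NE(10) point_card[OF K] by (metis dvd_triv_left mult.assoc)
      then have "r \<le> p" using p_largest NE(8) by blast
      then have "e < p" "e > 0" using NE(11) p_prime prime_gt_1_nat[of p] prime_gt_0_nat by auto
      then have pe: "\<not> p dvd e" by (simp add: nat_dvd_not_less)
      have cE: "card K = e * card E" using NE(9,10) by simp
      have inE: "w \<in> E" if w: "w \<in> p_part K" for w
      proof (cases "w = \<one>")
        case True then show ?thesis using subgroup.one_closed[OF NE(2)] by simp
      next
        case False
        then show ?thesis
          using mem_normal_of_coprime_index[OF fin NE(2) point_subgroup[OF K] NE(5,7) cE p_prime pe _ p_part_ord[OF K w]]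
            w p_part_subset by blast
      qed
      have "E \<subseteq> normalizer_of G N" using NE(5,6) by blast
      then have "conj_by G x y \<otimes> inv y \<in> N"
        using commutator_in_prime_index[OF fin NE(1,2,4) _ NE(9,8) inE[OF x] inE[OF y]] by blast
      then show ?thesis using NE(3) by blast
    qed
  qed
  then show ?thesis by (rule commute_of_trivial_commutator[OF xc])
qed

lemma p_part_subgroup:
  assumes "K \<in> points"
  shows "subgroup (p_part K) G"
proof (rule subgroupI)
  note sK = point_subgroup[OF assms]
  show "p_part K \<subseteq> carrier G" using p_part_subset point_subset[OF assms] by blast
  have "\<one> \<in> p_part K" using subgroup.one_closed[OF sK] by (simp add: p_part_def)
  then show "p_part K \<noteq> {}" by blast
  fix a assume a: "a \<in> p_part K"
  then have ac: "a \<in> carrier G" "a \<in> K" using p_part_subset point_subset[OF assms] by auto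
  show "inv a \<in> p_part K"
    using a ac subgroup.m_inv_closed[OF sK] by (simp add: p_part_def nat_pow_inv)
  fix b assume b: "b \<in> p_part K"
  then have bc: "b \<in> carrier G" "b \<in> K" using p_part_subset point_subset[OF assms] by auto
  show "a \<otimes> b \<in> p_part K"
    using a b ac bc subgroup.m_closed[OF sK] pow_mult_distrib[OF p_part_commute[OF assms a b] ac(1) bc(1)]
    by (simp add: p_part_def)
qed

lemma p_part_conj:
  assumes "K \<in> points" "g \<in> carrier G"
  shows "p_part (conj_by G g ` K) = conj_by G g ` p_part K"
proof -
  have "conj_by G g x [^] p = \<one> \<longleftrightarrow> x [^] p = \<one>" if "x \<in> K" for x
  proof -
    have xc: "x \<in> carrier G" using that point_subset[OF assms(1)] by blast
    have "conj_by G g x [^] p = conj_by G g (x [^] p)" using conj_pow[OF assms(2) xc] by simp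
    then show ?thesis using inj_onD[OF inj_on_conj[OF assms(2)], of "x [^] p" \<one>] xc assms(2) by auto
  qed
  then show ?thesis by (auto simp: p_part_def)
qed

lemma p_part_card:
  assumes "K \<in> points"
  shows "card (p_part K) = card (p_part M)"
proof -
  obtain g where "g \<in> carrier G" "K = conj_by G g ` M" using point_transitive[OF M_point assms] by blast
  moreover have "p_part M \<subseteq> carrier G" using p_part_subset M_subset by blast
  ultimately show ?thesis using p_part_conj[OF M_point] card_conj_image by metis
qed

lemma p_part_nontrivial:
  assumes "K \<in> points"
  obtains x where "x \<in> p_part K" "ord x = p" "x \<noteq> \<one>"
proof -
  have "p dvd card K" using p_dvd point_card[OF assms] by simp
  then obtain x where x: "x \<in> K" "ord x = p"
    using cauchy_in_subgroup[OF fin point_subgroup[OF assms] p_prime] by blast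
  moreover have "x \<noteq> \<one>" using x(2) p_prime by auto
  ultimately show thesis using that p_partI[OF x(1) assms x(2)] by blast
qed

text \<open>The \<open>p\<close>-part is invariant under automorphisms of \<open>K\<close>, so its normalizer
  contains the maximal subgroup \<open>K\<close>; it is not normal in \<open>G\<close>, being
  abelian.\<close>

lemma normalizer_p_part:
  assumes "K \<in> points"
  shows "normalizer_of G (p_part K) = K"
proof -
  note S = p_part_subgroup[OF assms]
  note N = subgroup_normalizer_of[OF subgroup.subset[OF S]]
  have le: "K \<subseteq> normalizer_of G (p_part K)"
  proof (rule subset_normalizer_ofI[OF point_subgroup[OF assms] subgroup.subset[OF S]])
    fix k x assume k: "k \<in> K" and x: "x \<in> p_part K"
    then have "conj_by G k x \<in> conj_by G k ` p_part K" by blast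
    also have "\<dots> = p_part K"
      using p_part_conj[OF assms, of k] conj_image_self[OF point_subgroup[OF assms] k] k point_subset[OF assms] by auto
    finally show "conj_by G k x \<in> p_part K" .
  qed
  moreover have "normalizer_of G (p_part K) \<noteq> carrier G"
    using no_abelian_normal[OF S] p_part_commute[OF assms] p_part_nontrivial[OF assms] by blast
  ultimately show ?thesis using point_maximal[OF assms N] by blast
qed

text \<open>If the \<open>p\<close>-part of \<open>K\<close> lies in \<open>K'\<close>, then it is the
  \<open>p\<close>-part of \<open>K'\<close>, and points are recovered from their
  \<open>p\<close>-parts as normalizers.\<close>

lemma p_part_in_unique_point:
  assumes "K \<in> points" "K' \<in> points" "p_part K \<subseteq> K'"
  shows "K = K'"
proof -
  have "p_part K \<subseteq> p_part K'" using assms(3) by (auto simp: p_part_def)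
  then have "p_part K = p_part K'"
    using card_subset_eq[OF finite_subgroup[OF fin p_part_subgroup[OF assms(2)]]] p_part_card assms by simp
  then show ?thesis using normalizer_p_part assms by metis
qed

text \<open>Some element \<open>x\<close> of order \<open>p\<close> in \<open>K\<close> moves
  \<open>K'\<close>, hence is not in the kernel \<open>N\<close> of the action of \<open>K\<close>
  on the orbit of \<open>K'\<close>. Since no prime divisor of the order of \<open>K\<close> exceeds
  \<open>p\<close>, this forces the length \<open>r\<close> of the orbit to be \<open>p\<close>.\<close>

lemma point_meet_structure:
  assumes "K \<in> points" "K' \<in> points" "K \<noteq> K'"
  obtains N e where "subgroup N G" "N \<subseteq> K \<inter> K'" "K \<subseteq> normalizer_of G N"
    "card (K \<inter> K') = e * card N" "card K = p * e * card N" "e = 1 \<or> prime e \<and> e < p"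
proof -
  have "\<not> K \<subseteq> K'" using point_eqI[OF assms(1,2)] assms(3) by blast
  moreover have "K \<noteq> carrier G" using point_primitive[OF assms(1)] unfolding hereditarily_primitive_def by blast
  ultimately obtain N E r e where NE: "subgroup N G" "N \<subseteq> K \<inter> K'"
    "K \<subseteq> normalizer_of G N" "prime r" "card (K \<inter> K') = e * card N"
    "card K = r * e * card N" "e = 1 \<or> prime e \<and> e < r"
    using point_frobenius[OF assms(2) point_subgroup[OF assms(1)]] unfolding prime_frobenius_def by blast
  obtain x where x: "x \<in> p_part K" "x \<notin> K'" using p_part_in_unique_point[OF assms(1,2)] assms(3) by blast
  have "x \<noteq> \<one>" using x(2) subgroup.one_closed[OF point_subgroup[OF assms(2)]] by blast
  then have ox: "ord x = p" using p_part_ord[OF assms(1) x(1)] by blast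
  have rp: "r \<le> p" using NE(6) point_card[OF assms(1)] p_largest[OF NE(4)] by (metis dvd_triv_left mult.assoc)
  have "r = p"
  proof (rule ccontr)
    assume "r \<noteq> p"
    then have "\<not> p dvd r" using NE(4) p_prime primes_dvd_imp_eq by blast
    moreover have "\<not> p dvd e" using NE(7) rp p_prime prime_gt_1_nat[of p] prime_gt_0_nat[of e]
      by (auto simp: nat_dvd_not_less)
    ultimately have "\<not> p dvd r * e" using p_prime by (simp add: prime_dvd_mult_iff)
    then have "x \<in> N"
      using mem_normal_of_coprime_index[OF fin NE(1) point_subgroup[OF assms(1)] _ NE(3,6) p_prime _ _ ox]
        x(1) p_part_subset NE(2) by blast
    then show False using x(2) NE(2) by blast
  qed
  then show thesis using that NE by blast
qed

text \<open>Let \<open>y \<noteq> \<one>\<close> be in the intersection, and consider the action of its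
  centralizer \<open>C\<close> on the orbit of \<open>K\<close>. The \<open>p\<close>-part of
  \<open>K\<close> lies in \<open>C\<close>, but not in the kernel \<open>N\<close> of this action,
  since otherwise it would consist of the elements of \<open>N\<close> of order dividing
  \<open>p\<close> and would be normalized by \<open>C\<close>, which is not contained in
  \<open>K\<close>. So the stabilizer \<open>C \<inter> K\<close> has order divisible by
  \<open>p\<close> modulo \<open>N\<close>, and the orbit length is a prime \<open>u > p\<close>. An
  element of order \<open>u\<close> in \<open>C\<close> fixes, by disjointness of supports, a point
  moved by \<open>y\<close>. This contradicts the choice of \<open>p\<close>.\<close>

lemma p_part_point_meet:
  assumes K: "K \<in> points" and K': "K' \<in> points" and "K \<noteq> K'"
  shows "p_part K \<inter> K' = {\<one>}"
proof (rule ccontr)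
  assume "p_part K \<inter> K' \<noteq> {\<one>}"
  moreover have "\<one> \<in> p_part K \<inter> K'"
    using subgroup.one_closed[OF p_part_subgroup[OF K]] subgroup.one_closed[OF point_subgroup[OF K']] by blast
  ultimately obtain y where y: "y \<in> p_part K" "y \<in> K'" "y \<noteq> \<one>" by blast
  have oy: "ord y = p" using p_part_ord[OF K y(1,3)] .
  have y': "y \<in> p_part K'" using p_partI[OF y(2) K' oy] .
  have yc: "y \<in> carrier G" using y(2) point_subset[OF K'] by blast
  define C where "C = centralizer_of G y"
  have C: "subgroup C G" "C \<noteq> carrier G" unfolding C_def
    using subgroup_centralizer_of[OF yc] centralizer_proper[OF yc y(3)] by auto
  have sub_C: "p_part L \<subseteq> C" if "L \<in> points" "y \<in> p_part L" for L
    unfolding C_def centralizer_of_def using p_part_commute[OF that(1) _ that(2)] p_part_subset point_subset[OF that(1)] by blast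
  have CK: "\<not> C \<subseteq> K" using sub_C[OF K' y'] p_part_in_unique_point[OF K' K] assms(3) by blast
  obtain N E u e where NE: "subgroup N G" "N \<subseteq> C \<inter> K"
    "C \<subseteq> normalizer_of G N" "prime u" "card (C \<inter> K) = e * card N"
    "card C = u * e * card N" "e = 1 \<or> prime e \<and> e < u"
    using point_frobenius[OF K C CK] unfolding prime_frobenius_def by blast
  have CKs: "subgroup (C \<inter> K) G" using subgroups_Inter_pair[OF C(1) point_subgroup[OF K]] .
  have "\<not> p_part K \<subseteq> N"
  proof
    assume PN: "p_part K \<subseteq> N"
    have eq: "p_part K = {z \<in> N. z [^] p = \<one>}" using PN NE(2) unfolding p_part_def by blast
    have "C \<subseteq> normalizer_of G (p_part K)"
    proof (rule subset_normalizer_ofI[OF C(1) subgroup.subset[OF p_part_subgroup[OF K]]])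
      fix c x assume c: "c \<in> C" and x: "x \<in> p_part K"
      have cc: "c \<in> carrier G" "x \<in> carrier G"
        using c x subgroup.subset[OF C(1)] subgroup.subset[OF p_part_subgroup[OF K]] by auto
      have "conj_by G c x \<in> N" using normalizer_of_mem[of c N x] c x NE(3) PN by blast
      moreover have "conj_by G c x [^] p = \<one>"
        using conj_pow[OF cc, of p] x cc by (simp add: p_part_def)
      ultimately show "conj_by G c x \<in> p_part K" unfolding eq by blast
    qed
    then show False using CK normalizer_p_part[OF K] by simp
  qed
  then obtain x where x: "x \<in> p_part K" "x \<notin> N" by blast
  have xCK: "x \<in> C \<inter> K" using x sub_C[OF K y(1)] p_part_subset by blast
  have "x \<noteq> \<one>" using x(2) subgroup.one_closed[OF NE(1)] by blast
  then have ox: "ord x = p" using p_part_ord[OF K x(1)] by blast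
  have "p dvd e"
    using mem_normal_of_coprime_index[OF fin NE(1) CKs NE(2) _ NE(5) p_prime _ xCK ox] NE(3) x(2) by blast
  then have "e = p" using NE(7) p_prime by (auto dest: primes_dvd_imp_eq[rotated 2])
  then have pu: "p < u" using NE(7) p_prime by auto
  have "u dvd card C" using NE(6) by (metis dvd_triv_left mult.assoc)
  then obtain z where z: "z \<in> C" "ord z = u" using cauchy_in_subgroup[OF fin C(1) NE(4)] by blast
  have zc: "z \<in> carrier G" using subgroup.mem_carrier[OF C(1) z(1)] .
  obtain L where L: "L \<in> points" "y \<notin> L" using point_faithful[OF yc] y(3) by blast
  have "y \<otimes> z = z \<otimes> y" using z(1) unfolding C_def centralizer_of_def by simp
  then have "z \<in> L" using commuting_disjoint_support[OF L(1) yc zc _ oy z(2) p_prime NE(4)] pu L(2) by blast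
  then have "u dvd card L"
    using card_subgroup_dvd[OF cyclic_subgroup(1)[OF zc] point_subgroup[OF L(1)]]
      cyclic_subgroup(3)[OF zc] cyclic_subgroup(4)[OF zc point_subgroup[OF L(1)]] z(2) by simp
  then show False using p_largest[OF NE(4)] point_card[OF L(1)] pu by simp
qed

lemma other_point:
  assumes "K \<in> points"
  obtains K' where "K' \<in> points" "K' \<noteq> K"
proof -
  have "K \<noteq> carrier G" using point_primitive[OF assms] unfolding hereditarily_primitive_def by blast
  then obtain g where g: "g \<in> carrier G" "g \<notin> normalizer_of G K"
    using normalizer_point[OF assms] point_subset[OF assms] by blast
  then have "conj_by G g ` K \<noteq> K" by (simp add: normalizer_of_def)
  then show thesis using that point_conj[OF assms g(1)] by blast
qed

lemma card_p_part:
  assumes "K \<in> points"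
  shows "card (p_part K) = p"
proof -
  obtain K' where K': "K' \<in> points" "K' \<noteq> K" using other_point[OF assms] .
  obtain x where x: "x \<in> p_part K" "ord x = p" "x \<noteq> \<one>" using p_part_nontrivial[OF assms] .
  have xc: "x \<in> carrier G" using x(1) p_part_subset point_subset[OF assms] by blast
  have "prime (card (p_part K))"
    using prime_of_trivial_point_meet[OF K'(1) p_part_subgroup[OF assms] p_part_point_meet[OF assms K'(1)]] K'(2) x by blast
  moreover have "p dvd card (p_part K)"
    using card_subgroup_dvd[OF cyclic_subgroup(1)[OF xc] p_part_subgroup[OF assms]]
      cyclic_subgroup(3)[OF xc] cyclic_subgroup(4)[OF xc p_part_subgroup[OF assms] x(1)] x(2) by simp
  ultimately have "p = card (p_part K)" by (intro primes_dvd_imp_eq[OF p_prime])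
  then show ?thesis by simp
qed

text \<open>By disjointness of supports \<open>z\<close> would fix every point except possibly
  \<open>K\<close>, the only one that \<open>y\<close> fixes, and it fixes \<open>K\<close> too.\<close>

lemma p_part_centralizes_nothing:
  assumes "K \<in> points" "y \<in> p_part K" "y \<noteq> \<one>" "z \<in> K" "ord z = t" "prime t" "t \<noteq> p"
  shows "y \<otimes> z \<noteq> z \<otimes> y"
proof
  assume comm: "y \<otimes> z = z \<otimes> y"
  have c: "y \<in> carrier G" "z \<in> carrier G" using assms p_part_subset point_subset[OF assms(1)] by auto
  have "z = \<one>"
  proof (rule point_faithful[OF c(2)])
    fix K' assume K': "K' \<in> points"
    show "z \<in> K'"
    proof (cases "K' = K")
      case False
      then have "y \<notin> K'" using p_part_point_meet[OF assms(1) K'] assms(2,3) by blast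
      then show ?thesis
        using commuting_disjoint_support[OF K' c comm p_part_ord[OF assms(1-3)] assms(5) p_prime assms(6)] assms(7) by blast
    qed (use assms(4) in simp)
  qed
  then show False using assms(5,6) by auto
qed

text \<open>Such a subgroup commutes with the \<open>p\<close>-part of \<open>K\<close>.\<close>

lemma normal_p_complement_trivial:
  assumes K: "K \<in> points" and N: "subgroup N G" "N \<subseteq> K" "K \<subseteq> normalizer_of G N" "p_part K \<inter> N = {\<one>}"
  shows "N = {\<one>}"
proof (rule ccontr)
  assume "N \<noteq> {\<one>}"
  then have "card N \<noteq> 1" using subgroup_eq_one_iff_card[OF fin N(1)] by blast
  then obtain t where t: "prime t" "t dvd card N" using prime_factor_nat by blast
  obtain z where z: "z \<in> N" "ord z = t" using cauchy_in_subgroup[OF fin N(1) t] .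
  have zK: "z \<in> K" using z N(2) by auto
  have z1: "z \<noteq> \<one>" using z(2) t(1) by auto
  have tp: "t \<noteq> p" using N(4) p_partI[OF zK K] z z1 by blast
  obtain y where y: "y \<in> p_part K" "ord y = p" "y \<noteq> \<one>" using p_part_nontrivial[OF K] .
  have "p_part K \<subseteq> normalizer_of G N" using p_part_subset N(3) by blast
  moreover have "N \<subseteq> normalizer_of G (p_part K)" using normalizer_p_part[OF K] N(2) by simp
  ultimately have "y \<otimes> z = z \<otimes> y"
    using commute_of_normalizing[OF p_part_subgroup[OF K] N(1,4)] y(1) z(1) by blast
  then show False using p_part_centralizes_nothing[OF K y(1,3) zK z(2) t(1) tp] by blast
qed

text \<open>The kernel \<open>N\<close> of the action of \<open>K\<close> on the orbit of \<open>K'\<close>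
  meets the \<open>p\<close>-part trivially and is therefore trivial, so that the order of
  \<open>K\<close> can be read off from the action.\<close>

lemma point_meet_card:
  assumes K: "K \<in> points" and K': "K' \<in> points" and "K \<noteq> K'"
  shows "card M = p * card (K \<inter> K')" "card (K \<inter> K') = 1 \<or> prime (card (K \<inter> K')) \<and> card (K \<inter> K') < p"
proof -
  obtain N e where N: "subgroup N G" "N \<subseteq> K \<inter> K'" "K \<subseteq> normalizer_of G N"
    "card (K \<inter> K') = e * card N" "card K = p * e * card N" "e = 1 \<or> prime e \<and> e < p"
    using point_meet_structure[OF assms] .
  have "p_part K \<inter> N = {\<one>}"
    using p_part_point_meet[OF assms] N(2) subgroup.one_closed[OF N(1)]
      subgroup.one_closed[OF p_part_subgroup[OF K]] by blast
  then have "N = {\<one>}" using normal_p_complement_trivial[OF K N(1) _ N(3)] N(2) by blast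
  then show "card M = p * card (K \<inter> K')" "card (K \<inter> K') = 1 \<or> prime (card (K \<inter> K')) \<and> card (K \<inter> K') < p"
    using N(4-6) point_card[OF K] by auto
qed

end

section \<open>Counting conjugates; stabilizers of prime order\<close>

context group
begin

text \<open>Consider \<open>(g, x) \<mapsto> conj_by G g x\<close> on \<open>Z \<times> B\<close>. If
  \<open>g'\<close> and \<open>x'\<close> give the same value as \<open>g\<close> and
  \<open>x\<close>, then \<open>inv g \<otimes> g'\<close> is in \<open>N\<close>, and
  \<open>g'\<close> determines \<open>x'\<close>. So the fibres have at most \<open>card N\<close>
  elements.\<close>

lemma card_conjugates_ge:
  assumes "finite (carrier G)" "subgroup Z G" "subgroup N G" "B \<subseteq> carrier G"
    and norm: "\<And>g x. g \<in> Z \<Longrightarrow> x \<in> B \<Longrightarrow> conj_by G g x \<in> B \<Longrightarrow> g \<in> N"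
  shows "card Z * card B \<le> card N * card {conj_by G g x | g x. g \<in> Z \<and> x \<in> B}"
proof -
  define f where "f = (\<lambda>(g, x). conj_by G g x)"
  define U where "U = {conj_by G g x | g x. g \<in> Z \<and> x \<in> B}"
  note Zc = subgroup.subset[OF assms(2)]
  have fin: "finite Z" "finite B" "finite N" using assms finite_subset Zc finite_subgroup by auto
  have img: "f ` (Z \<times> B) = U" unfolding f_def U_def by auto
  have fibre: "card {y \<in> Z \<times> B. f y = u} \<le> card N" if u: "u \<in> U" for u
  proof -
    obtain g x where gx: "g \<in> Z" "x \<in> B" "u = conj_by G g x" using u unfolding U_def by blast
    have gc: "g \<in> carrier G" "x \<in> carrier G" using gx Zc assms(4) by auto
    have back_g: "fst y \<in> carrier G \<and> snd y \<in> carrier G \<and> inv g \<otimes> fst y \<in> N \<and> snd y = conj_by G (inv (fst y)) u"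
      if y: "y \<in> {y \<in> Z \<times> B. f y = u}" for y
    proof -
      obtain h z where hz: "y = (h, z)" "h \<in> Z" "z \<in> B" "conj_by G h z = u" using y unfolding f_def by auto
      have hc: "h \<in> carrier G" "z \<in> carrier G" using hz Zc assms(4) by auto
      have iz: "inv g \<otimes> h \<in> Z" using subgroup.m_closed[OF assms(2)] subgroup.m_inv_closed[OF assms(2)] gx hz by blast
      have "conj_by G (inv g \<otimes> h) z = conj_by G (inv g) u"
        using conj_simps(2)[of "inv g" h z z] gc hc hz(4) by simp
      also have "\<dots> = x" unfolding gx(3) using conj_simps(5)[OF gc(1) gc(1) gc(2) gc(2)] .
      finally have "inv g \<otimes> h \<in> N" using norm[OF iz hz(3)] gx(2) by simp
      moreover have "z = conj_by G (inv h) u" using conj_simps(5)[OF hc(1) hc(1) hc(2) hc(2)] hz(4) by simp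
      ultimately show ?thesis using hz(1) hc by simp
    qed
    show ?thesis
    proof (rule card_inj_on_le[OF _ _ fin(3)])
      show "inj_on (\<lambda>y. inv g \<otimes> fst y) {y \<in> Z \<times> B. f y = u}"
      proof (rule inj_onI)
        fix y y' assume y: "y \<in> {y \<in> Z \<times> B. f y = u}" and y': "y' \<in> {y \<in> Z \<times> B. f y = u}"
          and eq: "inv g \<otimes> fst y = inv g \<otimes> fst y'"
        have "fst y = fst y'" using eq back_g[OF y] back_g[OF y'] gc by simp
        then show "y = y'" using back_g[OF y] back_g[OF y'] by (simp add: prod_eq_iff)
      qed
      show "(\<lambda>y. inv g \<otimes> fst y) ` {y \<in> Z \<times> B. f y = u} \<subseteq> N" using back_g by blast
    qed
  qed
  have "card Z * card B = card (Z \<times> B)" by (simp add: card_cartesian_product)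
  also have "\<dots> = (\<Sum>u \<in> U. card {y \<in> Z \<times> B. f y = u})"
    unfolding img[symmetric] using fin sum.image_gen[of "Z \<times> B" "\<lambda>_. 1::nat" f] by simp
  also have "\<dots> \<le> (\<Sum>u \<in> U. card N)" using fibre by (rule sum_mono)
  also have "\<dots> = card N * card U" by simp
  finally show ?thesis unfolding U_def .
qed

text \<open>Conjugates of a subgroup of prime order coincide or meet trivially.\<close>

lemma card_conjugates_prime_order:
  assumes "finite (carrier G)" "subgroup Z G" "subgroup A G" "card A = t" "prime (t::nat)"
  shows "card Z * (t - 1) \<le> card (normalizer_of G A \<inter> Z) * card {conj_by G g x | g x. g \<in> Z \<and> x \<in> A - {\<one>}}"
proof -
  note Ac = subgroup.subset[OF assms(3)]
  note NZ = subgroups_Inter_pair[OF subgroup_normalizer_of[OF Ac] assms(2)]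
  have "g \<in> normalizer_of G A \<inter> Z" if g: "g \<in> Z" and x: "x \<in> A - {\<one>}" "conj_by G g x \<in> A - {\<one>}" for g x
  proof -
    have gc: "g \<in> carrier G" using subgroup.mem_carrier[OF assms(2) g] .
    have "conj_by G g ` A = A"
      by (rule prime_card_subgroup_eq[OF assms(1) subgroup_conj_image[OF gc assms(3)] assms(3) _ assms(4,5), of "conj_by G g x"])
        (use x card_conj_image[OF gc Ac] assms(4) in auto)
    then show ?thesis using gc g by (simp add: normalizer_of_def)
  qed
  then have "card Z * card (A - {\<one>}) \<le> card (normalizer_of G A \<inter> Z) * card {conj_by G g x | g x. g \<in> Z \<and> x \<in> A - {\<one>}}"
    using card_conjugates_ge[OF assms(1,2) NZ, of "A - {\<one>}"] Ac by blast
  moreover have "card (A - {\<one>}) = t - 1"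
    using subgroup.one_closed[OF assms(3)] assms(4) by simp
  ultimately show ?thesis by simp
qed

definition conjugates_of :: "'a set \<Rightarrow> 'a set" where
  "conjugates_of A = {conj_by G g x | g x. g \<in> carrier G \<and> x \<in> A - {\<one>}}"

lemma conjugates_of_subset:
  assumes "A \<subseteq> carrier G"
  shows "conjugates_of A \<subseteq> carrier G - {\<one>}"
proof
  fix y assume "y \<in> conjugates_of A"
  then obtain g x where gx: "g \<in> carrier G" "x \<in> A" "x \<noteq> \<one>" "y = conj_by G g x"
    unfolding conjugates_of_def by blast
  have "conj_by G g x \<noteq> \<one>"
    using inj_onD[OF inj_on_conj[OF gx(1)], of x \<one>] gx assms by auto
  then show "y \<in> carrier G - {\<one>}" using gx assms by auto
qed

lemma conjugates_of_ord:
  assumes "subgroup A G" "prime (card A)" "y \<in> conjugates_of A"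
  shows "ord y = card A"
  using assms(3) prime_card_ord[OF assms(1,2)] ord_conj subgroup.mem_carrier[OF assms(1)]
  unfolding conjugates_of_def by auto

lemma card_conjugates_of_prime:
  assumes "finite (carrier G)" "subgroup A G" "prime (card A)"
  shows "card (carrier G) * (card A - 1) \<le> card (normalizer_of G A) * card (conjugates_of A)"
proof -
  have "normalizer_of G A \<inter> carrier G = normalizer_of G A" by (auto simp: normalizer_of_def)
  then show ?thesis
    using card_conjugates_prime_order[OF assms(1) subgroup_self assms(2) refl assms(3)]
    unfolding conjugates_of_def by simp
qed

lemma card_two_disjoint:
  assumes "finite (carrier G)" "U \<subseteq> carrier G - {\<one>}" "V \<subseteq> carrier G - {\<one>}" "U \<inter> V = {}"
  shows "card U + card V < card (carrier G)"
proof -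
  have "card U + card V = card (U \<union> V)"
    using assms finite_subset[of U "carrier G"] finite_subset[of V "carrier G"] by (subst card_Un_disjoint) auto
  also have "\<dots> \<le> card (carrier G - {\<one>})" using assms by (intro card_mono) auto
  also have "\<dots> < card (carrier G)" using assms(1) by (intro psubset_card_mono) auto
  finally show ?thesis .
qed

lemma card_three_disjoint:
  assumes "finite (carrier G)" "U \<subseteq> carrier G - {\<one>}" "V \<subseteq> carrier G - {\<one>}" "W \<subseteq> carrier G - {\<one>}"
    "U \<inter> V = {}" "U \<inter> W = {}" "V \<inter> W = {}"
  shows "card U + card V + card W < card (carrier G)"
proof -
  have "card U + card V = card (U \<union> V)"
    using assms finite_subset[of U "carrier G"] finite_subset[of V "carrier G"] by (subst card_Un_disjoint) auto
  moreover have "(U \<union> V) \<inter> W = {}" using assms(6,7) by blast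
  ultimately show ?thesis using card_two_disjoint[OF assms(1) _ assms(4), of "U \<union> V"] assms(2,3) by simp
qed

end

context frobenius_counterexample
begin

lemma card_carrier:
  obtains n where "card (carrier G) = n * card M" "n > 1"
proof -
  obtain n where n: "card (carrier G) = card M * n"
    using card_subgroup_dvd[OF subgroup_M subgroup_self M_subset] by (auto elim: dvdE)
  have "n \<noteq> 0" using n card_subgroup_pos[OF fin subgroup_self] by auto
  moreover have "n \<noteq> 1" using n card_subset_eq[OF fin M_subset] M_proper by auto
  ultimately show thesis using that[of n] n by (simp add: mult.commute)
qed

lemma abelian_normalizer_proper:
  assumes "subgroup A G" "A \<noteq> {\<one>}" "\<And>a b. a \<in> A \<Longrightarrow> b \<in> A \<Longrightarrow> a \<otimes> b = b \<otimes> a"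
  shows "normalizer_of G A \<noteq> carrier G"
  using no_abelian_normal[OF assms(1) _ assms(3)] assms(2) by blast

lemma prime_normalizer_proper:
  assumes "subgroup A G" "prime (card A)"
  shows "normalizer_of G A \<noteq> carrier G"
proof (rule abelian_normalizer_proper[OF assms(1)])
  show "A \<noteq> {\<one>}" using assms(2) by auto
qed (rule prime_card_commute[OF fin assms])

lemma coprime_meet_trivial:
  assumes "subgroup A G" "subgroup B G" "coprime (card A) (card B)"
  shows "A \<inter> B = {\<one>}"
proof -
  have "card (A \<inter> B) dvd card A" "card (A \<inter> B) dvd card B"
    using card_subgroup_dvd[OF subgroups_Inter_pair[OF assms(1,2)]] assms by auto
  then have "card (A \<inter> B) = 1" using assms(3) by (metis coprime_common_divisor_nat)
  then show ?thesis using subgroup_eq_one_iff_card[OF fin subgroups_Inter_pair[OF assms(1,2)]] by blast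
qed

text \<open>Suppose that the points have prime order \<open>p\<close>, so that \<open>G\<close> is a Frobenius
  group. Of its \<open>n * p\<close> elements, \<open>n * (p - 1)\<close> are nontrivial elements of
  points, and \<open>p\<close> does not divide \<open>n\<close>. For a prime \<open>r\<close>
  dividing \<open>n\<close>, a subgroup of order \<open>r\<close> is semiregular, and the order of
  its normalizer divides \<open>r * p\<close>. Its conjugates contain at least
  \<open>n * (r - 1) / r\<close>, hence at least half of the remaining \<open>n\<close> elements. So
  \<open>n\<close> has only one prime divisor, and as \<open>r\<^sup>2\<close> does not divide
  \<open>n\<close>, it is a prime. Then a subgroup of order \<open>n\<close> is self-normalizing,
  since it is not normal, and its conjugates contain \<open>p * (n - 1)\<close> elements.\<close>

lemma card_point_not_prime: "card M \<noteq> p"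
proof
  assume cM: "card M = p"
  obtain n where n: "card (carrier G) = n * p" "n > 1" using card_carrier cM by metis
  have pM: "prime (card M)" using cM p_prime by simp
  have p2: "p \<ge> 2" using p_prime prime_ge_2_nat by blast
  have meet: "K \<inter> K' = {\<one>}" if "K \<in> points" "K' \<in> points" "K \<noteq> K'" for K K'
  proof -
    have "card (K \<inter> K') = 1" using point_meet_card(1)[OF that] cM p2 by simp
    then show ?thesis
      using subgroup_eq_one_iff_card[OF fin subgroups_Inter_pair[OF point_subgroup point_subgroup]] that by blast
  qed
  have pn: "\<not> p dvd n"
  proof
    assume "p dvd n"
    then have "p ^ 2 dvd card (carrier G)" using n(1) by (simp add: power2_eq_square mult_dvd_mono)
    then obtain Y where Y: "subgroup Y G" "card Y = p ^ 2"
      using sylow_in_subgroup[OF fin subgroup_self p_prime] by blast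
    have sub: "K \<subseteq> Y" if K: "K \<in> points" for K
    proof -
      have cK: "card K = p" using point_card[OF K] cM by simp
      have "card (Y \<inter> K) dvd p"
        using card_subgroup_dvd[OF subgroups_Inter_pair[OF Y(1) point_subgroup[OF K]] point_subgroup[OF K]] cK by auto
      moreover have "card (Y \<inter> K) \<noteq> 1"
      proof
        assume "card (Y \<inter> K) = 1"
        then have "Y \<inter> K = {\<one>}"
          using subgroup_eq_one_iff_card[OF fin subgroups_Inter_pair[OF Y(1) point_subgroup[OF K]]] by blast
        moreover have "Y \<noteq> {\<one>}" using Y(2) p2 by (auto simp: power2_eq_square)
        ultimately have "prime (p ^ 2)" using prime_of_trivial_point_meet[OF K Y(1)] Y(2) by simp
        then show False by (simp add: prime_power_iff)
      qed
      ultimately have "card (Y \<inter> K) = card K" using p_prime cK by (auto simp: prime_nat_iff)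
      then have "Y \<inter> K = K" using card_subset_eq[OF point_finite[OF K], of "Y \<inter> K"] by blast
      then show ?thesis by blast
    qed
    have "card Y \<noteq> card M" using Y(2) cM p2 by (simp add: power2_eq_square)
    then have "\<not> Y \<subseteq> M" using sub[OF M_point] by auto
    then have YG: "Y = carrier G" by (rule point_maximal[OF M_point Y(1) sub[OF M_point]])
    obtain K where K: "K \<in> points" "K \<noteq> M" using other_point[OF M_point] .
    have "card (K <#> M) = p ^ 2"
      using card_set_mult[OF fin point_subgroup[OF K(1)] subgroup_M] meet[OF K(1) M_point K(2)]
        point_card[OF K(1)] cM by (simp add: power2_eq_square)
    then have "K <#> M = carrier G"
      using card_subset_eq[OF fin setmult_subset_G[OF point_subset[OF K(1)] M_subset]] YG Y(2) by simp
    then show False using point_product_proper[OF K(1) M_point] K(2) by blast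
  qed
  define U where "U = conjugates_of M"
  have Us: "U \<subseteq> carrier G - {\<one>}" unfolding U_def using conjugates_of_subset[OF M_subset] .
  have "n * p * (p - 1) \<le> p * card U"
    using card_conjugates_of_prime[OF fin subgroup_M pM] normalizer_point[OF M_point] n(1) cM
    unfolding U_def by simp
  then have "p * (n * (p - 1)) \<le> p * card U" by (simp add: mult_ac)
  then have cU: "n * (p - 1) \<le> card U" using p2 by simp
  have R: "\<exists>R. subgroup R G \<and> card R = r \<and> card (normalizer_of G R) dvd r * p"
    and r2: "\<not> r ^ 2 dvd n" if r: "prime r" "r dvd n" for r
  proof -
    have rp: "r \<noteq> p" using r(2) pn by blast
    have triv: "Y \<inter> K = {\<one>}" if Y: "subgroup Y G" "card Y = r ^ a" and K: "K \<in> points" for Y K a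
    proof (rule coprime_meet_trivial[OF Y(1) point_subgroup[OF K]])
      show "coprime (card Y) (card K)"
        using Y(2) point_card[OF K] cM rp primes_coprime[OF r(1) p_prime] by simp
    qed
    show "\<not> r ^ 2 dvd n"
    proof
      assume "r ^ 2 dvd n"
      then have "r ^ 2 dvd card (carrier G)" using n(1) by simp
      then obtain Y where Y: "subgroup Y G" "card Y = r ^ 2"
        using sylow_in_subgroup[OF fin subgroup_self r(1)] by blast
      have "Y \<noteq> {\<one>}" using Y(2) r(1) by (auto simp: power2_eq_square)
      then have "prime (r ^ 2)" using prime_of_trivial_point_meet[OF M_point Y(1) triv[OF Y M_point]] Y(2) by simp
      then show False by (simp add: prime_power_iff)
    qed
    have "r ^ 1 dvd card (carrier G)" using n(1) r(2) by simp
    then obtain R where R: "subgroup R G" "card R = r ^ 1"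
      using sylow_in_subgroup[OF fin subgroup_self r(1)] by blast
    have cR: "card R = r" using R(2) by simp
    define N where "N = normalizer_of G R"
    have N: "subgroup N G" "N \<noteq> carrier G" unfolding N_def
      using subgroup_normalizer_of[OF subgroup.subset[OF R(1)]] prime_normalizer_proper[OF R(1)] cR r(1) by auto
    have RN: "R \<subseteq> N" unfolding N_def using subgroup_le_normalizer[OF R(1)] .
    have "R \<noteq> {\<one>}" using cR r(1) by auto
    then have "\<not> N \<subseteq> M" using triv[OF R M_point] RN by blast
    then obtain N' :: "'a set" and u e where NE: "prime u" "card (N \<inter> M) = e * card N'" "card N = u * e * card N'"
      using point_frobenius[OF M_point N] unfolding prime_frobenius_def by blast
    have d: "card (N \<inter> M) dvd p"
      using card_subgroup_dvd[OF subgroups_Inter_pair[OF N(1) subgroup_M] subgroup_M] cM by auto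
    have "r dvd u * card (N \<inter> M)"
      using card_subgroup_dvd[OF R(1) N(1) RN] cR NE(2,3) by (simp add: mult_ac)
    moreover have "\<not> r dvd card (N \<inter> M)" using d rp r(1) p_prime primes_dvd_imp_eq dvd_trans by blast
    ultimately have "r dvd u" using r(1) by (simp add: prime_dvd_mult_iff)
    then have "r = u" using primes_dvd_imp_eq[OF r(1) NE(1)] by blast
    then have "card N = r * card (N \<inter> M)" using NE(2,3) by (simp add: mult_ac)
    then have "card N dvd r * p" using d by simp
    then show "\<exists>R. subgroup R G \<and> card R = r \<and> card (normalizer_of G R) dvd r * p"
      using R(1) cR unfolding N_def by blast
  qed
  have count: "\<exists>V. V \<subseteq> carrier G - {\<one>} \<and> (\<forall>y\<in>V. ord y = r) \<and> n * (r - 1) \<le> r * card V \<and>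
      (n = r \<longrightarrow> p * (r - 1) \<le> card V)" if r: "prime r" "r dvd n" for r
  proof -
    obtain A where A: "subgroup A G" "card A = r" "card (normalizer_of G A) dvd r * p" using R[OF r] by blast
    have pA: "prime (card A)" using A(2) r(1) by simp
    note NA = subgroup_normalizer_of[OF subgroup.subset[OF A(1)]]
    define V where "V = conjugates_of A"
    have V: "V \<subseteq> carrier G - {\<one>}" "\<forall>y\<in>V. ord y = r"
      unfolding V_def using conjugates_of_subset[OF subgroup.subset[OF A(1)]] conjugates_of_ord[OF A(1) pA] A(2) by auto
    have c: "n * p * (r - 1) \<le> card (normalizer_of G A) * card V"
      using card_conjugates_of_prime[OF fin A(1) pA] n(1) A(2) unfolding V_def by simp
    have rp0: "r * p > 0" using r(1) p2 prime_gt_0_nat by simp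
    have "card (normalizer_of G A) \<le> r * p" using A(3) rp0 by (rule dvd_imp_le)
    then have "n * p * (r - 1) \<le> r * p * card V" using c mult_le_mono1 le_trans by blast
    then have "p * (n * (r - 1)) \<le> p * (r * card V)" by (simp add: mult_ac)
    then have 1: "n * (r - 1) \<le> r * card V" using p2 by simp
    have 2: "p * (r - 1) \<le> card V" if nr: "n = r"
    proof -
      have "card (normalizer_of G A) \<noteq> r * p"
        using prime_normalizer_proper[OF A(1) pA] card_subset_eq[OF fin normalizer_of_subset] n(1) nr by auto
      moreover obtain k where k: "card (normalizer_of G A) = r * k" 
        using card_subgroup_dvd[OF A(1) NA subgroup_le_normalizer[OF A(1)]] A(2) by (auto elim: dvdE)
      ultimately have "k dvd p" "k \<noteq> p" using A(3) r(1) prime_gt_0_nat[of r] by auto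
      then have "k = 1" using p_prime by (auto simp: prime_nat_iff)
      then have "r * (p * (r - 1)) \<le> r * card V" using c k nr by (simp add: mult_ac)
      then show ?thesis using r(1) prime_gt_0_nat[of r] by simp
    qed
    show ?thesis using V 1 2 by blast
  qed
  obtain r where r: "prime r" "r dvd n" using n(2) prime_factor_nat[of n] by auto
  obtain V where V: "V \<subseteq> carrier G - {\<one>}" "\<forall>y\<in>V. ord y = r" "n * (r - 1) \<le> r * card V"
    "n = r \<longrightarrow> p * (r - 1) \<le> card V" using count[OF r] by blast
  have rp: "r \<noteq> p" using r(2) pn by blast
  have Uo: "\<forall>y\<in>U. ord y = p" unfolding U_def using conjugates_of_ord[OF subgroup_M pM] cM by simp
  have UV: "U \<inter> V = {}" using Uo V(2) rp by auto
  have r2': "r \<ge> 2" using r(1) prime_ge_2_nat by blast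
  show False
  proof (cases "n = r")
    case True
    have "card U + card V < r * p" using card_two_disjoint[OF fin Us V(1) UV] n(1) True by simp
    moreover have "r * (p - 1) \<le> card U" "p * (r - 1) \<le> card V" using cU V(4) True by simp_all
    ultimately have "r * (p - 1) + p * (r - 1) < r * p" by linarith
    moreover obtain a b where "p = a + 2" "r = b + 2"
      using p2 r2' by (metis add.commute le_Suc_ex)
    ultimately show False by (simp add: algebra_simps)
  next
    case False
    obtain m where m: "n = r * m" using r(2) by (auto elim: dvdE)
    have "m \<noteq> 1" using m False by auto
    then obtain s where s: "prime s" "s dvd m" using prime_factor_nat by blast
    have sn: "s dvd n" using s(2) m by simp
    have sr: "s \<noteq> r" using s(2) m r2[OF r] by (auto simp: power2_eq_square)
    obtain W where W: "W \<subseteq> carrier G - {\<one>}" "\<forall>y\<in>W. ord y = s" "n * (s - 1) \<le> s * card W"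
      using count[OF s(1) sn] by blast
    have sp: "s \<noteq> p" using sn pn by blast
    have disj: "U \<inter> W = {}" "V \<inter> W = {}" using Uo V(2) W(2) sp sr by auto
    have "card U + card V + card W < n * p"
      using card_three_disjoint[OF fin Us V(1) W(1) UV disj] n(1) by simp
    moreover have half: "n \<le> 2 * c" if t: "n * (t - 1) \<le> t * c" "t \<ge> 2" for t c :: nat
    proof -
      obtain k where k: "t = k + 2" using t(2) by (metis le_Suc_ex add.commute)
      have "n * (k + 1) \<le> (k + 2) * c" using t(1) k by simp
      also have "\<dots> \<le> (k + 1) * (2 * c)" by simp
      finally have "(k + 1) * n \<le> (k + 1) * (2 * c)" by (simp only: mult.commute)
      then show ?thesis by (simp del: mult_Suc)
    qed
    ultimately have "n * (p - 1) + n < n * p"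
      using half[OF V(3) r2'] half[OF W(3)] prime_ge_2_nat[OF s(1)] cU by linarith
    then show False using p2 by (cases p) auto
  qed
qed

end

section \<open>Stabilizers of order \<open>p * q\<close>\<close>

context frobenius_counterexample
begin

text \<open>By \<open>point_meet_order\<close> below this is the order of the intersection of two distinct
  points.\<close>

definition q :: nat where "q = card M div p"

lemma point_order: "card M = p * q" and q_prime: "prime q" and q_less: "q < p"
  and point_meet_order: "K \<in> points \<Longrightarrow> K' \<in> points \<Longrightarrow> K \<noteq> K' \<Longrightarrow> card (K \<inter> K') = q"
proof -
  have p0: "p > 0" using p_prime prime_gt_0_nat by blast
  have eq: "card (K \<inter> K') = q" if "K \<in> points" "K' \<in> points" "K \<noteq> K'" for K K'
    using point_meet_card(1)[OF that] p0 by (simp add: q_def)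
  then show "K \<in> points \<Longrightarrow> K' \<in> points \<Longrightarrow> K \<noteq> K' \<Longrightarrow> card (K \<inter> K') = q" .
  obtain K where K: "K \<in> points" "K \<noteq> M" using other_point[OF M_point] .
  show 1: "card M = p * q" using point_meet_card(1)[OF K(1) M_point K(2)] eq[OF K(1) M_point K(2)] by simp
  have "q \<noteq> 1" using 1 card_point_not_prime by auto
  then show "prime q" "q < p" using point_meet_card(2)[OF K(1) M_point K(2)] eq[OF K(1) M_point K(2)] by auto
qed

lemma p_gt_2: "p > 2" and q_ge_2: "q \<ge> 2"
  using q_less prime_ge_2_nat[OF q_prime] by auto

lemma small_prime_not_dvd_order:
  assumes "prime t" "t < q"
  shows "\<not> t dvd p * q"
proof
  assume "t dvd p * q"
  then have "t dvd p \<or> t dvd q" using assms(1) prime_dvd_mult_iff by blast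
  then show False
    using primes_dvd_imp_eq[OF assms(1) p_prime] primes_dvd_imp_eq[OF assms(1) q_prime] assms(2) q_less by auto
qed

text \<open>The intersection is a subgroup of index \<open>p\<close> in \<open>K\<close>, hence maximal, and
  it is not normal in \<open>K\<close>.\<close>

lemma normalizer_meet:
  assumes "K \<in> points" "K' \<in> points" "K \<noteq> K'"
  shows "normalizer_of G (K \<inter> K') \<inter> K = K \<inter> K'"
proof -
  define D where "D = K \<inter> K'"
  have D: "subgroup D G" unfolding D_def using subgroups_Inter_pair point_subgroup assms by blast
  have cD: "card D = q" unfolding D_def using point_meet_order[OF assms] .
  have N: "subgroup (normalizer_of G D \<inter> K) G"
    using subgroups_Inter_pair[OF subgroup_normalizer_of[OF subgroup.subset[OF D]] point_subgroup[OF assms(1)]] .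
  have "normalizer_of G D \<inter> K = D \<or> normalizer_of G D \<inter> K = K"
  proof (rule subgroup_prime_index_maximal[OF fin D N point_subgroup[OF assms(1)] _ _ _ p_prime])
    show "D \<subseteq> normalizer_of G D \<inter> K" using subgroup_le_normalizer[OF D] unfolding D_def by blast
    show "card K = p * card D" using point_card[OF assms(1)] point_order cD by simp
  qed blast
  moreover have "normalizer_of G D \<inter> K \<noteq> K"
  proof
    assume "normalizer_of G D \<inter> K = K"
    then have "K \<subseteq> normalizer_of G D" by blast
    moreover have "p_part K \<inter> D = {\<one>}"
      using p_part_point_meet[OF assms] subgroup.one_closed[OF D]
        subgroup.one_closed[OF p_part_subgroup[OF assms(1)]] unfolding D_def by blast
    ultimately have "D = {\<one>}" using normal_p_complement_trivial[OF assms(1) D] unfolding D_def by blast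
    then show False using cD q_ge_2 by simp
  qed
  ultimately show ?thesis unfolding D_def by blast
qed

text \<open>Otherwise \<open>g\<close> normalizes \<open>K \<inter> K'\<close>, a subgroup of prime order
  generated by \<open>x\<close>, and so lies in it by \<open>normalizer_meet\<close>; but
  \<open>g\<close> moves \<open>K'\<close>.\<close>

lemma p_part_moves_meet:
  assumes K: "K \<in> points" and K': "K' \<in> points" and KK': "K \<noteq> K'" and x: "x \<in> K \<inter> K'" "x \<noteq> \<one>"
    and g: "g \<in> p_part K" "g \<noteq> \<one>"
  shows "x \<notin> conj_by G g ` K'"
proof
  assume xg: "x \<in> conj_by G g ` K'"
  define D where "D = K \<inter> K'"
  have D: "subgroup D G" unfolding D_def using subgroups_Inter_pair point_subgroup assms by blast
  have cD: "card D = q" unfolding D_def using point_meet_order[OF K K' KK'] .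
  have gK: "g \<in> K" using g p_part_subset by blast
  have gc: "g \<in> carrier G" using gK point_subset[OF K] by blast
  have "conj_by G g ` D = K \<inter> conj_by G g ` K'"
    unfolding D_def conj_image_Int[OF gc point_subset[OF K] point_subset[OF K']]
    using conj_image_self[OF point_subgroup[OF K] gK] by simp
  then have "x \<in> conj_by G g ` D" using xg x(1) by blast
  then have "conj_by G g ` D = D"
    using prime_card_subgroup_eq[OF fin subgroup_conj_image[OF gc D] D _ cD q_prime _ _ x(2)]
      card_conj_image[OF gc subgroup.subset[OF D]] cD x(1) unfolding D_def by simp
  then have "g \<in> normalizer_of G D \<inter> K" using gc gK by (simp add: normalizer_of_def)
  then have "g \<in> K'" using normalizer_meet[OF K K' KK'] unfolding D_def by blast
  then show False using p_part_point_meet[OF K K' KK'] g by blast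
qed

lemma p_part_moves_point:
  assumes K: "K \<in> points" and K': "K' \<in> points" and KK': "K \<noteq> K'" and g: "g \<in> p_part K" "g \<noteq> \<one>"
  shows "conj_by G g ` K' \<in> points" "conj_by G g ` K' \<noteq> K" "conj_by G g ` K' \<noteq> K'"
proof -
  have gK: "g \<in> K" using g p_part_subset by blast
  have gc: "g \<in> carrier G" using gK point_subset[OF K] by blast
  show "conj_by G g ` K' \<in> points" using point_conj[OF K' gc] .
  show "conj_by G g ` K' \<noteq> K"
    using conj_image_self[OF point_subgroup[OF K] gK]
      inj_on_image_eq_iff[OF inj_on_conj[OF gc] point_subset[OF K'] point_subset[OF K]] KK' by auto
  show "conj_by G g ` K' \<noteq> K'"
  proof
    assume "conj_by G g ` K' = K'"
    then have "g \<in> normalizer_of G K'" using gc by (simp add: normalizer_of_def)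
    then show False using normalizer_point[OF K'] p_part_point_meet[OF K K' KK'] g by blast
  qed
qed

lemma prime_order_in_two_points:
  assumes "K \<in> points" "K' \<in> points" "K \<noteq> K'" "y \<in> K" "y \<in> K'" "ord y = t" "prime t"
  shows "t = q"
proof -
  have "t dvd q"
    using ord_dvd_subgroup_card[OF subgroups_Inter_pair[OF point_subgroup[OF assms(1)] point_subgroup[OF assms(2)]], of y]
      point_meet_order[OF assms(1-3)] assms(4-6) by simp
  then show ?thesis by (rule primes_dvd_imp_eq[OF assms(7) q_prime])
qed

lemma ord_in_meet:
  assumes "K \<in> points" "K' \<in> points" "K \<noteq> K'" "x \<in> K" "x \<in> K'" "x \<noteq> \<one>"
  shows "ord x = q"
  using prime_card_ord[OF subgroups_Inter_pair[OF point_subgroup[OF assms(1)] point_subgroup[OF assms(2)]], of x]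
    point_meet_order[OF assms(1-3)] q_prime assms(4-6) by simp

text \<open>The images \<open>L\<close> and \<open>L'\<close> of \<open>K'\<close> under \<open>g\<close> and
  \<open>g \<otimes> g\<close> for an element \<open>g\<close> of order \<open>p > 2\<close> in
  \<open>K\<close> are two points not fixed by \<open>x\<close>. If \<open>t\<close> were different
  from \<open>q\<close>, then \<open>y\<close> would fix both, and would lie in a subgroup of order
  \<open>q\<close>.\<close>

lemma centralizer_of_meet:
  assumes K: "K \<in> points" and K': "K' \<in> points" and KK': "K \<noteq> K'" and x: "x \<in> K" "x \<in> K'" "x \<noteq> \<one>"
    and y: "y \<in> carrier G" "x \<otimes> y = y \<otimes> x" "ord y = t" "prime t"
  shows "t = q"
proof (rule ccontr)
  assume tq: "t \<noteq> q"
  have xD: "x \<in> K \<inter> K'" using x by blast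
  have xc: "x \<in> carrier G" using x(1) point_subset[OF K] by blast
  have ox: "ord x = q" using ord_in_meet[OF K K' KK' x] .
  obtain g where g: "g \<in> p_part K" "ord g = p" "g \<noteq> \<one>" using p_part_nontrivial[OF K] .
  have gc: "g \<in> carrier G" using g(1) p_part_subset point_subset[OF K] by blast
  have g2: "g \<otimes> g \<in> p_part K" using subgroup.m_closed[OF p_part_subgroup[OF K] g(1,1)] .
  have "g \<otimes> g \<noteq> \<one>"
  proof
    assume "g \<otimes> g = \<one>"
    then have "g [^] (2::nat) = \<one>" using gc by (simp add: numeral_2_eq_2)
    then have "p dvd 2" using pow_eq_id[OF gc, of 2] g(2) by simp
    then show False using p_gt_2 dvd_imp_le[of p 2] by simp
  qed
  note g2 = g2 this
  define L where "L = conj_by G g ` K'"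
  define L' where "L' = conj_by G (g \<otimes> g) ` K'"
  have L: "L \<in> points" "L \<noteq> K" "x \<notin> L" unfolding L_def
    using p_part_moves_point[OF K K' KK' g(1,3)] p_part_moves_meet[OF K K' KK' xD x(3) g(1,3)] by auto
  have L': "L' \<in> points" "x \<notin> L'" unfolding L'_def
    using p_part_moves_point[OF K K' KK' g2] p_part_moves_meet[OF K K' KK' xD x(3) g2] by auto
  have "L' = conj_by G g ` L" unfolding L_def L'_def using conj_image_comp[OF gc gc point_subset[OF K']] by simp
  then have "L \<noteq> L'" using p_part_moves_point(3)[OF K L(1) _ g(1,3)] L(2) by metis
  moreover have "y \<in> L" "y \<in> L'"
    using commuting_disjoint_support[OF L(1) xc y(1,2) ox y(3) q_prime y(4)]
      commuting_disjoint_support[OF L'(1) xc y(1,2) ox y(3) q_prime y(4)] tq L(3) L'(2) by auto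
  ultimately show False using prime_order_in_two_points[OF L(1) L'(1) _ _ _ y(3,4)] tq by blast
qed

text \<open>This is an instance of Sylow's theorem in \<open>K\<close>, obtained by counting: the conjugates
  of the self-normalizing subgroup \<open>K \<inter> K'\<close> contain all
  \<open>p * (q - 1)\<close> elements of \<open>K\<close> outside the \<open>p\<close>-part.\<close>

lemma order_q_conjugate:
  assumes K: "K \<in> points" and K': "K' \<in> points" and KK': "K \<noteq> K'"
    and B: "subgroup B G" "B \<subseteq> K" "card B = q"
  obtains m where "m \<in> K" "B = conj_by G m ` (K \<inter> K')"
proof -
  define A where "A = K \<inter> K'"
  have A: "subgroup A G" unfolding A_def using subgroups_Inter_pair point_subgroup assms by blast
  have cA: "card A = q" unfolding A_def using point_meet_order[OF K K' KK'] .
  define U where "U = {conj_by G g x | g x. g \<in> K \<and> x \<in> A - {\<one>}}"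
  have "card K * (q - 1) \<le> card (normalizer_of G A \<inter> K) * card U"
    unfolding U_def using card_conjugates_prime_order[OF fin point_subgroup[OF K] A cA q_prime] .
  then have "q * (p * (q - 1)) \<le> q * card U"
    using normalizer_meet[OF K K' KK'] cA point_card[OF K] point_order unfolding A_def by (simp add: mult_ac)
  then have cU: "p * (q - 1) \<le> card U" using q_ge_2 by simp
  have not_p: "x \<notin> p_part K" if "ord x = q" for x
    using that p_part_ord[OF K, of x] q_less q_ge_2 by fastforce
  have oA: "ord x = q" if "x \<in> A - {\<one>}" for x using prime_card_ord[OF A] cA q_prime that by simp
  have "U \<subseteq> K - p_part K"
  proof
    fix u assume "u \<in> U"
    then obtain g x where gx: "g \<in> K" "x \<in> A - {\<one>}" "u = conj_by G g x" unfolding U_def by blast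
    have c: "g \<in> carrier G" "x \<in> carrier G" using gx point_subset[OF K] subgroup.subset[OF A] by auto
    have "u \<in> conj_by G g ` K" using gx unfolding A_def by blast
    then have "u \<in> K" using conj_image_self[OF point_subgroup[OF K] gx(1)] by simp
    then show "u \<in> K - p_part K" using not_p ord_conj[OF c] oA[OF gx(2)] gx(3) by simp
  qed
  moreover have "card (K - p_part K) = p * (q - 1)"
    using card_Diff_subset[OF finite_subgroup[OF fin p_part_subgroup[OF K]] p_part_subset] card_p_part[OF K]
      point_card[OF K] point_order by (simp add: algebra_simps)
  ultimately have UK: "U = K - p_part K"
    using cU by (intro card_seteq) (simp_all add: point_finite[OF K])
  have "B \<noteq> {\<one>}" using B(3) q_ge_2 by auto
  then obtain b where b: "b \<in> B" "b \<noteq> \<one>" using subgroup.one_closed[OF B(1)] by blast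
  have "ord b = q" using prime_card_ord[OF B(1) _ b] B(3) q_prime by simp
  then have "b \<in> U" unfolding UK using not_p b(1) B(2) by blast
  then obtain m x where m: "m \<in> K" "x \<in> A" "b = conj_by G m x" unfolding U_def by blast
  have mc: "m \<in> carrier G" using m point_subset[OF K] by blast
  have "B = conj_by G m ` A"
    by (rule prime_card_subgroup_eq[OF fin B(1) subgroup_conj_image[OF mc A] B(3) _ q_prime b(1) _ b(2)])
      (use m card_conj_image[OF mc subgroup.subset[OF A]] cA in auto)
  then show thesis using that m(1) unfolding A_def by blast
qed

text \<open>If \<open>g\<close> carries \<open>K\<close> to \<open>K'\<close>, then it carries some subgroup
  of order \<open>q\<close> in \<open>K\<close> to \<open>K \<inter> K'\<close>. This subgroup is
  conjugate to \<open>K \<inter> K'\<close> within \<open>K\<close>, so \<open>g\<close> can be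
  corrected by an element of \<open>K\<close> to normalize \<open>K \<inter> K'\<close>.\<close>

lemma meet_normalizer_moves_point:
  assumes K: "K \<in> points" and K': "K' \<in> points" and KK': "K \<noteq> K'"
  shows "\<not> normalizer_of G (K \<inter> K') \<subseteq> K"
proof
  assume sub: "normalizer_of G (K \<inter> K') \<subseteq> K"
  define D where "D = K \<inter> K'"
  have D: "subgroup D G" unfolding D_def using subgroups_Inter_pair point_subgroup assms by blast
  note Dc = subgroup.subset[OF D]
  obtain g where g: "g \<in> carrier G" "K' = conj_by G g ` K" using point_transitive[OF K K'] .
  have ig: "inv g \<in> carrier G" using g by simp
  define B where "B = conj_by G (inv g) ` D"
  have "B \<subseteq> conj_by G (inv g) ` K'" unfolding B_def D_def by blast
  then have BK: "B \<subseteq> K" using conj_image_inv(1)[OF g(1) point_subset[OF K]] g(2) by simp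
  obtain m where m: "m \<in> K" "B = conj_by G m ` D"
    using order_q_conjugate[OF K K' KK' subgroup_conj_image[OF ig D] _] BK
      card_conj_image[OF ig Dc] point_meet_order[OF assms] unfolding B_def D_def by metis
  have mc: "m \<in> carrier G" using m point_subset[OF K] by blast
  have "D = conj_by G g ` B" unfolding B_def using conj_image_inv(2)[OF g(1) Dc] by simp
  then have "conj_by G (g \<otimes> m) ` D = D" unfolding m(2) using conj_image_comp[OF g(1) mc Dc] by simp
  then have "g \<otimes> m \<in> K" using sub g(1) mc unfolding D_def normalizer_of_def by auto
  then have "K = conj_by G (g \<otimes> m) ` K" using conj_image_self[OF point_subgroup[OF K]] by simp
  also have "\<dots> = conj_by G g ` conj_by G m ` K" using conj_image_comp[OF g(1) mc point_subset[OF K]] by simp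
  also have "\<dots> = K'" using conj_image_self[OF point_subgroup[OF K] m(1)] g(2) by simp
  finally show False using KK' by blast
qed

lemma card_p_part_conjugates:
  assumes "card (carrier G) = n * card M"
  shows "n * (p - 1) \<le> card (conjugates_of (p_part M))"
proof -
  have "n * card M * (p - 1) \<le> card M * card (conjugates_of (p_part M))"
    using card_conjugates_of_prime[OF fin p_part_subgroup[OF M_point]] card_p_part[OF M_point] p_prime
      normalizer_p_part[OF M_point] assms by simp
  then have "card M * (n * (p - 1)) \<le> card M * card (conjugates_of (p_part M))" by (simp add: mult_ac)
  then show ?thesis using card_subgroup_pos[OF fin subgroup_M] by simp
qed

lemma p_part_conjugates:
  "conjugates_of (p_part M) \<subseteq> carrier G - {\<one>}"
  "y \<in> conjugates_of (p_part M) \<Longrightarrow> ord y = p"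
  using conjugates_of_subset[OF subgroup.subset[OF p_part_subgroup[OF M_point]]]
    conjugates_of_ord[OF p_part_subgroup[OF M_point]] card_p_part[OF M_point] p_prime by auto

text \<open>The estimate common to both cases below: \<open>w\<close> is \<open>s\<close> times the number of
  elements in the conjugates of the subgroups other than the \<open>p\<close>-part of
  \<open>M\<close>, and these together with the \<open>n * (p - 1)\<close> elements of order
  \<open>p\<close> in points do not fit into \<open>G\<close>.\<close>

lemma order_contradiction:
  fixes n s :: nat
  assumes "s * (n * p * q) \<ge> s * (n * (p - 1)) + w + s" "n * p * q * s \<le> w + n * p" "s \<ge> 2" "n > 1"
  shows False
proof -
  obtain a where a: "p = Suc a" "a \<ge> 2" using p_gt_2 by (cases p) auto
  have "s * (n * a) + s \<le> n * Suc a" using assms(1,2) a(1) by (simp add: mult_ac)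
  moreover have "n * Suc a \<le> 2 * (n * a)" using a(2) by simp
  moreover have "2 * (n * a) \<le> s * (n * a)" using assms(3) by simp
  ultimately show False using assms(3) by linarith
qed

lemma meet_normalizer_order:
  assumes K: "K \<in> points" and K': "K' \<in> points" and KK': "K \<noteq> K'"
  obtains s where "prime s" "card (normalizer_of G (K \<inter> K')) = s * q"
    "normalizer_of G (K \<inter> K') \<noteq> carrier G"
proof -
  define D where "D = K \<inter> K'"
  have D: "subgroup D G" unfolding D_def using subgroups_Inter_pair point_subgroup assms by blast
  have pD: "prime (card D)" unfolding D_def using point_meet_order[OF assms] q_prime by simp
  have H: "normalizer_of G D \<noteq> carrier G" using prime_normalizer_proper[OF D pD] .
  obtain N :: "'a set" and s e where N: "prime s" "card (normalizer_of G D \<inter> K) = e * card N"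
      "card (normalizer_of G D) = s * e * card N"
    using point_frobenius[OF K subgroup_normalizer_of[OF subgroup.subset[OF D]] H]
      meet_normalizer_moves_point[OF assms] unfolding D_def prime_frobenius_def by blast
  then have "card (normalizer_of G D) = s * q"
    using normalizer_meet[OF assms] point_meet_order[OF assms] unfolding D_def by simp
  then show thesis using that[OF N(1)] H unfolding D_def by blast
qed

text \<open>Suppose that the normalizer of \<open>D = K \<inter> K'\<close> has order \<open>s * q\<close>
  with a prime \<open>s \<noteq> q\<close>. An element \<open>z\<close> of order \<open>s\<close> in
  it permutes the nontrivial elements of \<open>D\<close> without fixed points by
  \<open>centralizer_of_meet\<close>, so that \<open>s < q\<close>. In particular \<open>s\<close>
  does not divide the order of a point, and the group \<open>S\<close> generated by \<open>z\<close>
  is semiregular. Its normalizer acts on an orbit of prime length \<open>s\<close>; the kernel of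
  this action commutes with \<open>S\<close> and is trivial by disjointness of supports, and a
  nontrivial stabilizer would have a prime order below \<open>s\<close>, but be contained in a
  point. So \<open>S\<close> is its own normalizer, and the conjugates of \<open>S\<close>,
  \<open>D\<close> and the \<open>p\<close>-part of \<open>M\<close> have too many elements.\<close>

lemma meet_normalizer_not_coprime:
  assumes K: "K \<in> points" and K': "K' \<in> points" and KK': "K \<noteq> K'"
    and s: "prime s" "card (normalizer_of G (K \<inter> K')) = s * q"
  shows "s = q"
proof (rule ccontr)
  assume sq: "s \<noteq> q"
  define D where "D = K \<inter> K'"
  define H where "H = normalizer_of G D"
  have D: "subgroup D G" unfolding D_def using subgroups_Inter_pair point_subgroup assms by blast
  have cD: "card D = q" unfolding D_def using point_meet_order[OF K K' KK'] .
  have H: "subgroup H G" unfolding H_def using subgroup_normalizer_of[OF subgroup.subset[OF D]] .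
  have cH: "card H = s * q" unfolding H_def D_def using s(2) .
  obtain z where z: "z \<in> H" "ord z = s" using cauchy_in_subgroup[OF fin H s(1)] cH by auto
  have zc: "z \<in> carrier G" using subgroup.mem_carrier[OF H z(1)] .
  define S where "S = generate G {z}"
  have S: "subgroup S G" "z \<in> S" "card S = s" "S \<subseteq> H" unfolding S_def
    using cyclic_subgroup[OF zc] z H by auto
  note Sc = subgroup.subset[OF S(1)]
  have pS: "prime (card S)" using S(3) s(1) by simp
  obtain x where x: "x \<in> D" "x \<noteq> \<one>"
  proof -
    have "D \<noteq> {\<one>}" using cD q_ge_2 by auto
    then show thesis using that subgroup.one_closed[OF D] by blast
  qed
  have xc: "x \<in> carrier G" using subgroup.mem_carrier[OF D x(1)] .
  have "card S \<le> card (D - {\<one>})"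
  proof (rule card_inj_on_le[of "\<lambda>g. conj_by G g x"])
    show "inj_on (\<lambda>g. conj_by G g x) S"
    proof (rule inj_onI, rule ccontr)
      fix g h assume g: "g \<in> S" and h: "h \<in> S" and eq: "conj_by G g x = conj_by G h x" and "g \<noteq> h"
      have c: "g \<in> carrier G" "h \<in> carrier G" using g h Sc by auto
      define w where "w = inv h \<otimes> g"
      have wS: "w \<in> S" unfolding w_def using subgroup.m_closed[OF S(1)] subgroup.m_inv_closed[OF S(1)] g h by blast
      have wc: "w \<in> carrier G" using wS Sc by blast
      have w1: "w \<noteq> \<one>" unfolding w_def using c \<open>g \<noteq> h\<close> by (metis inv_equality inv_inv inv_closed)
      have "conj_by G w x = conj_by G (inv h) (conj_by G h x)"
        unfolding w_def eq[symmetric] using conj_simps(2)[of "inv h" g x x] c xc by simp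
      then have "conj_by G w x = x" using conj_simps(5)[OF c(2) c(2) xc xc] by simp
      then have "x \<otimes> w = w \<otimes> x" using wc xc by (simp add: conj_eq_iff_commute)
      then show False
        using centralizer_of_meet[OF K K' KK' _ _ x(2) wc _ prime_card_ord[OF S(1) pS wS w1] pS] x(1) S(3) sq
        unfolding D_def by blast
    qed
    show "(\<lambda>g. conj_by G g x) ` S \<subseteq> D - {\<one>}"
    proof
      fix y assume "y \<in> (\<lambda>g. conj_by G g x) ` S"
      then obtain g where g: "g \<in> S" "y = conj_by G g x" by blast
      have gc: "g \<in> carrier G" using g Sc by blast
      have "y \<in> D" using normalizer_of_mem[of g D x] g S(4) x(1) unfolding H_def by blast
      moreover have "y \<noteq> \<one>" using inj_onD[OF inj_on_conj[OF gc], of x \<one>] x(2) xc gc g(2) by auto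
      ultimately show "y \<in> D - {\<one>}" by blast
    qed
    show "finite (D - {\<one>})" using finite_subgroup[OF fin D] by blast
  qed
  moreover have "card (D - {\<one>}) = q - 1" using subgroup.one_closed[OF D] cD by simp
  ultimately have sltq: "s < q" using S(3) q_ge_2 by simp
  have SL: "S \<inter> L = {\<one>}" if L: "L \<in> points" for L
  proof (rule coprime_meet_trivial[OF S(1) point_subgroup[OF L]])
    show "coprime (card S) (card L)"
      unfolding S(3) point_card[OF L] point_order using small_prime_not_dvd_order[OF s(1) sltq] prime_imp_coprime[OF s(1)] by blast
  qed
  define N where "N = normalizer_of G S"
  have N: "subgroup N G" unfolding N_def using subgroup_normalizer_of[OF Sc] .
  have Np: "N \<noteq> carrier G" unfolding N_def using prime_normalizer_proper[OF S(1) pS] .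
  have SN: "S \<subseteq> N" unfolding N_def using subgroup_le_normalizer[OF S(1)] .
  have z1: "z \<noteq> \<one>" using z(2) s(1) by auto
  have NM: "\<not> N \<subseteq> M" using SN S(2) SL[OF M_point] z1 by blast
  obtain N' u e where N': "subgroup N' G" "N' \<subseteq> N \<inter> M" "N \<subseteq> normalizer_of G N'" "prime u"
    "card (N \<inter> M) = e * card N'" "card N = u * e * card N'" "e = 1 \<or> prime e \<and> e < u"
    using point_frobenius[OF M_point N Np NM] unfolding prime_frobenius_def by blast
  have NMd: "card (N \<inter> M) dvd p * q"
    using card_subgroup_dvd[OF subgroups_Inter_pair[OF N subgroup_M] subgroup_M] point_order by auto
  have "s dvd u * card (N \<inter> M)" using card_subgroup_dvd[OF S(1) N SN] S(3) N'(5,6) by (simp add: mult_ac)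
  moreover have "\<not> s dvd card (N \<inter> M)" using NMd small_prime_not_dvd_order[OF s(1) sltq] dvd_trans by blast
  ultimately have "s dvd u" using s(1) by (simp add: prime_dvd_mult_iff)
  then have su: "s = u" by (rule primes_dvd_imp_eq[OF s(1) N'(4)])
  have e1: "e = 1"
  proof (rule ccontr)
    assume "e \<noteq> 1"
    then have "prime e" "e < q" using N'(7) su sltq by auto
    moreover have "e dvd p * q" using NMd N'(5) dvd_mult_left by metis
    ultimately show False using small_prime_not_dvd_order by blast
  qed
  have "N' = {\<one>}"
  proof (rule ccontr)
    assume "N' \<noteq> {\<one>}"
    then have "card N' \<noteq> 1" using subgroup_eq_one_iff_card[OF fin N'(1)] by blast
    then obtain t where t: "prime t" "t dvd card N'" using prime_factor_nat by blast
    obtain y where y: "y \<in> N'" "ord y = t" using cauchy_in_subgroup[OF fin N'(1) t] .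
    have yc: "y \<in> carrier G" using subgroup.mem_carrier[OF N'(1) y(1)] .
    have "t dvd p * q" using t(2) NMd N'(5) e1 dvd_trans by auto
    then have ts: "s \<noteq> t" using small_prime_not_dvd_order[OF s(1) sltq] by blast
    have "S \<inter> N' = {\<one>}"
      using SL[OF M_point] N'(2) subgroup.one_closed[OF N'(1)] subgroup.one_closed[OF S(1)] by blast
    then have comm: "z \<otimes> y = y \<otimes> z"
      using commute_of_normalizing[OF S(1) N'(1) _ _ _ S(2) y(1)] SN N'(2,3) unfolding N_def by blast
    have "y \<in> L" if L: "L \<in> points" for L
      using commuting_disjoint_support[OF L zc yc comm z(2) y(2) s(1) t(1) ts] SL[OF L] S(2) z1 by blast
    then have "y = \<one>" using point_faithful[OF yc] by blast
    then show False using y(2) t(1) by auto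
  qed
  then have cN: "card N = s" using N'(6) su e1 by simp
  obtain n where n: "card (carrier G) = n * card M" "n > 1" using card_carrier .
  define U where "U = conjugates_of (p_part M)"
  define V where "V = conjugates_of D"
  define W where "W = conjugates_of S"
  have sub: "U \<subseteq> carrier G - {\<one>}" "V \<subseteq> carrier G - {\<one>}" "W \<subseteq> carrier G - {\<one>}"
    unfolding U_def V_def W_def using p_part_conjugates(1) conjugates_of_subset[OF subgroup.subset[OF D]]
      conjugates_of_subset[OF Sc] by auto
  have ords: "\<forall>y\<in>U. ord y = p" "\<forall>y\<in>V. ord y = q" "\<forall>y\<in>W. ord y = s"
    unfolding U_def V_def W_def using p_part_conjugates(2) conjugates_of_ord[OF D] cD q_prime
      conjugates_of_ord[OF S(1) pS] S(3) by auto
  have "p \<noteq> q" "p \<noteq> s" "q \<noteq> s" using sltq q_less by auto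
  then have disj: "U \<inter> V = {}" "U \<inter> W = {}" "V \<inter> W = {}"
    unfolding disjoint_iff using ords by metis+
  have tot: "card U + card V + card W < n * p * q"
    using card_three_disjoint[OF fin sub disj] n(1) point_order by (simp add: mult_ac)
  have cU: "n * (p - 1) \<le> card U" unfolding U_def using card_p_part_conjugates[OF n(1)] .
  have "n * p * q * (q - 1) \<le> s * q * card V"
    using card_conjugates_of_prime[OF fin D] cD q_prime cH n(1) point_order unfolding V_def H_def by (simp add: mult_ac)
  then have "q * (n * p * (q - 1)) \<le> q * (s * card V)" by (simp add: mult_ac)
  then have cV: "n * p * (q - 1) \<le> s * card V" using q_ge_2 by simp
  have cW: "n * p * q * (s - 1) \<le> s * card W"
    using card_conjugates_of_prime[OF fin S(1) pS] S(3) cN n(1) point_order unfolding W_def N_def by (simp add: mult_ac)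
  have "s * (card U + card V + card W + 1) \<le> s * (n * p * q)"
    by (intro mult_le_mono2) (use tot in simp)
  moreover have "s * (n * (p - 1)) \<le> s * card U" using cU by simp
  ultimately have 1: "s * (n * p * q) \<ge> s * (n * (p - 1)) + (s * card V + s * card W) + s"
    by (simp add: algebra_simps)
  have f1: "n * p * q * s = n * p * q * (s - 1) + n * p * q" using prime_ge_2_nat[OF s(1)] by (cases s) auto
  have f2: "n * p * q = n * p * (q - 1) + n * p" using q_ge_2 by (cases q) auto
  have 2: "n * p * q * s \<le> (s * card V + s * card W) + n * p" using f1 f2 cV cW by linarith
  show False using order_contradiction[OF 1 2 prime_ge_2_nat[OF s(1)] n(2)] .
qed

text \<open>Suppose that the normalizer \<open>Q\<close> of \<open>K \<inter> K'\<close> has order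
  \<open>q\<^sup>2\<close>. Proper subgroups above \<open>Q\<close> meet each point in a normal
  subgroup of index \<open>q\<close>. Therefore \<open>Q\<close> is abelian, and it equals its
  normalizer and the centralizers of its nontrivial elements, since none of these contains elements
  of order \<open>p\<close> fixing \<open>M\<close>. So distinct conjugates of \<open>Q\<close> meet
  trivially, and the conjugates of \<open>Q\<close> and of the \<open>p\<close>-part of
  \<open>M\<close> have too many elements.\<close>

lemma meet_normalizer_not_square:
  assumes K: "K \<in> points" and K': "K' \<in> points" and KK': "K \<noteq> K'"
  shows "card (normalizer_of G (K \<inter> K')) \<noteq> q * q"
proof
  assume sq: "card (normalizer_of G (K \<inter> K')) = q * q"
  define Q where "Q = normalizer_of G (K \<inter> K')"
  have D: "subgroup (K \<inter> K') G" using subgroups_Inter_pair point_subgroup assms by blast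
  have Q: "subgroup Q G" unfolding Q_def using subgroup_normalizer_of[OF subgroup.subset[OF D]] .
  note Qc = subgroup.subset[OF Q]
  have cQ: "card Q = q * q" unfolding Q_def using sq .
  have pq: "coprime p q" using primes_coprime[OF p_prime q_prime] q_less by simp
  have Qp: "Q \<noteq> carrier G"
    unfolding Q_def using prime_normalizer_proper[OF D] point_meet_order[OF assms] q_prime by simp
  have QL: "card (Q \<inter> L) = q" if L: "L \<in> points" for L
  proof -
    have S: "subgroup (Q \<inter> L) G" using subgroups_Inter_pair[OF Q point_subgroup[OF L]] .
    have d: "card (Q \<inter> L) dvd q * q" "card (Q \<inter> L) dvd p * q"
      using card_subgroup_dvd[OF S Q] card_subgroup_dvd[OF S point_subgroup[OF L]] cQ point_card[OF L] point_order by auto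
    have "coprime (card (Q \<inter> L)) p"
      using d(1) pq by (metis coprime_commute coprime_divisors coprime_mult_right_iff dvd_refl)
    then have "card (Q \<inter> L) dvd q" using d(2) by (simp add: coprime_dvd_mult_right_iff)
    moreover have "card (Q \<inter> L) \<noteq> 1"
    proof
      assume "card (Q \<inter> L) = 1"
      then have "Q \<inter> L = {\<one>}" using subgroup_eq_one_iff_card[OF fin S] by blast
      moreover have "Q \<noteq> {\<one>}" using cQ q_ge_2 by auto
      ultimately have "prime (q * q)" using prime_of_trivial_point_meet[OF L Q] cQ by simp
      then show False using q_ge_2 prime_product[of q q] by auto
    qed
    ultimately show ?thesis using q_prime by (auto simp: prime_nat_iff)
  qed
  have nQL: "\<not> Q \<subseteq> L" if L: "L \<in> points" for L
  proof
    assume "Q \<subseteq> L"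
    then have "Q \<inter> L = Q" by blast
    then show False using QL[OF L] cQ q_ge_2 by simp
  qed
  have above: "card Z = q * card (Z \<inter> L) \<and> Z \<subseteq> normalizer_of G (Z \<inter> L)"
    if Z: "subgroup Z G" "Z \<noteq> carrier G" "Q \<subseteq> Z" and L: "L \<in> points" for Z L
  proof -
    have "\<not> Z \<subseteq> L" using Z(3) nQL[OF L] by blast
    then obtain N u e where N: "subgroup N G" "N \<subseteq> Z \<inter> L" "Z \<subseteq> normalizer_of G N" "prime u"
      "card (Z \<inter> L) = e * card N" "card Z = u * e * card N" "e = 1 \<or> prime e \<and> e < u"
      using point_frobenius[OF L Z(1,2)] unfolding prime_frobenius_def by blast
    have ZL: "subgroup (Z \<inter> L) G" using subgroups_Inter_pair[OF Z(1) point_subgroup[OF L]] .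
    have d: "card (Z \<inter> L) dvd p * q"
      using card_subgroup_dvd[OF ZL point_subgroup[OF L]] point_card[OF L] point_order by auto
    have "q * q dvd u * card (Z \<inter> L)"
      using card_subgroup_dvd[OF Q Z(1,3)] cQ N(5,6) by (simp add: mult_ac)
    then have qq: "q * q dvd u * (p * q)" by (rule dvd_trans[OF _ mult_dvd_mono[OF dvd_refl d]])
    then have "q dvd u * p" using q_ge_2 by (simp add: mult.assoc[symmetric])
    then have "q dvd u" using pq by (simp add: coprime_commute coprime_dvd_mult_left_iff)
    then have uq: "u = q" using primes_dvd_imp_eq[OF q_prime N(4)] by simp
    have e1: "e = 1"
    proof (rule ccontr)
      assume "e \<noteq> 1"
      then have "prime e" "e < q" using N(7) uq by auto
      moreover have "e dvd p * q" using d N(5) dvd_mult_left by metis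
      ultimately show False using small_prime_not_dvd_order by blast
    qed
    have "N = Z \<inter> L" using card_subset_eq[OF finite_subgroup[OF fin ZL] N(2)] N(5) e1 by simp
    then show ?thesis using N(3,5,6) uq e1 by simp
  qed
  have Q_comm: "a \<otimes> b = b \<otimes> a" if "a \<in> Q" "b \<in> Q" for a b
  proof -
    have c: "a \<in> carrier G" "b \<in> carrier G" using that Qc by auto
    have "conj_by G a b \<otimes> inv b \<in> L" if L: "L \<in> points" for L
    proof -
      have "conj_by G a b \<otimes> inv b \<in> Q \<inter> L"
        using commutator_in_prime_index[OF fin subgroups_Inter_pair[OF Q point_subgroup[OF L]] Q _ _ _ q_prime \<open>a \<in> Q\<close> \<open>b \<in> Q\<close>]
          above[OF Q Qp subset_refl L] by blast
      then show ?thesis by blast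
    qed
    then have "conj_by G a b \<otimes> inv b = \<one>" using point_faithful[of "conj_by G a b \<otimes> inv b"] c by simp
    then show ?thesis by (rule commute_of_trivial_commutator[OF c])
  qed
  have card_le: "Z = Q" if Z: "subgroup Z G" "Z \<noteq> carrier G" "Q \<subseteq> Z" and pZ: "\<not> p dvd card (Z \<inter> M)" for Z
  proof -
    have "card (Z \<inter> M) dvd p * q"
      using card_subgroup_dvd[OF subgroups_Inter_pair[OF Z(1) subgroup_M] subgroup_M] point_order by auto
    moreover have "coprime (card (Z \<inter> M)) p" using pZ prime_imp_coprime[OF p_prime] coprime_commute by blast
    ultimately have "card (Z \<inter> M) dvd q" by (simp add: coprime_dvd_mult_right_iff)
    then have "card (Z \<inter> M) \<le> q" using q_ge_2 by (intro dvd_imp_le) auto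
    then have "card Z \<le> card Q" using above[OF Z M_point] cQ by simp
    then show ?thesis using card_seteq[OF finite_subgroup[OF fin Z(1)] Z(3)] by simp
  qed
  have Q_norm: "normalizer_of G Q = Q"
  proof -
    define Z where "Z = normalizer_of G Q"
    have Z: "subgroup Z G" "Z \<noteq> carrier G" "Q \<subseteq> Z"
    proof -
      show "subgroup Z G" unfolding Z_def using subgroup_normalizer_of[OF Qc] .
      show "Q \<subseteq> Z" unfolding Z_def using subgroup_le_normalizer[OF Q] .
      have "Q \<noteq> {\<one>}" using cQ q_ge_2 by auto
      then show "Z \<noteq> carrier G" unfolding Z_def using abelian_normalizer_proper[OF Q _ Q_comm] by blast
    qed
    have "\<not> p dvd card (Z \<inter> M)"
    proof
      assume "p dvd card (Z \<inter> M)"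
      then obtain w where w: "w \<in> Z \<inter> M" "ord w = p"
        using cauchy_in_subgroup[OF fin subgroups_Inter_pair[OF Z(1) subgroup_M] p_prime] by blast
      have wc: "w \<in> carrier G" using w M_subset by blast
      have "\<not> p dvd q" using q_less q_ge_2 by (auto dest: dvd_imp_le)
      then have "w \<in> Z \<inter> L" if L: "L \<in> points" for L
        using mem_normal_of_coprime_index[OF fin subgroups_Inter_pair[OF Z(1) point_subgroup[OF L]] Z(1) _ _ _ p_prime _ _ w(2), of q]
          above[OF Z L] w(1) by blast
      then have "w = \<one>" using point_faithful[OF wc] by blast
      then show False using w(2) p_prime by auto
    qed
    then show ?thesis using card_le[OF Z] unfolding Z_def by blast
  qed
  have cent_prime: "centralizer_of G y = Q" if y: "y \<in> Q" "ord y = q" for y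
  proof -
    define C where "C = centralizer_of G y"
    have yc: "y \<in> carrier G" using y Qc by blast
    have y1: "y \<noteq> \<one>" using y(2) q_ge_2 by auto
    have C: "subgroup C G" "C \<noteq> carrier G" "Q \<subseteq> C"
      unfolding C_def using subgroup_centralizer_of[OF yc] centralizer_proper[OF yc y1] Q_comm y(1) Qc
      by (auto simp: centralizer_of_def)
    have "\<not> p dvd card (C \<inter> M)"
    proof
      assume "p dvd card (C \<inter> M)"
      then obtain w where w: "w \<in> C \<inter> M" "ord w = p"
        using cauchy_in_subgroup[OF fin subgroups_Inter_pair[OF C(1) subgroup_M] p_prime] by blast
      have wc: "w \<in> carrier G" "w \<noteq> \<one>" using w M_subset p_prime by auto
      have comm: "y \<otimes> w = w \<otimes> y" using w(1) unfolding C_def centralizer_of_def by auto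
      have wM: "w \<in> p_part M" using p_partI[OF _ M_point w(2)] w(1) by blast
      have yL: "y \<in> L" if L: "L \<in> points" "L \<noteq> M" for L
      proof -
        have "w \<notin> L" using p_part_point_meet[OF M_point L(1)] L(2) wM wc(2) by blast
        then show ?thesis
          using commuting_disjoint_support[OF L(1) yc wc(1) comm y(2) w(2) q_prime p_prime] q_less by simp
      qed
      \<comment> \<open>There are at least three points, so \<open>y\<close> lies in two of them.\<close>
      obtain L where L: "L \<in> points" "L \<noteq> M" using other_point[OF M_point] .
      note L' = p_part_moves_point[OF M_point L(1) _ wM wc(2)]
      have "p = q"
        using centralizer_of_meet[OF L(1) L'(1) _ yL[OF L] yL[OF L'(1,2)] y1 wc(1) comm w(2) p_prime] L(2) L'(3) by metis
      then show False using q_less by simp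
    qed
    then show ?thesis using card_le[OF C] unfolding C_def by blast
  qed
  have cent: "centralizer_of G y = Q" if y: "y \<in> Q" "y \<noteq> \<one>" for y
  proof -
    have yc: "y \<in> carrier G" using y Qc by blast
    note Y = cyclic_subgroup[OF yc]
    have YQ: "generate G {y} \<subseteq> Q" using Y(4)[OF Q y(1)] .
    have "card (generate G {y}) \<noteq> 1" using Y(3) y(2) ord_eq_1[OF yc] by simp
    then obtain t where t: "prime t" "t dvd card (generate G {y})" using prime_factor_nat by blast
    have "t dvd q * q" using card_subgroup_dvd[OF Y(1) Q YQ] cQ t(2) dvd_trans by metis
    then have "t = q" using t(1) primes_dvd_imp_eq[OF t(1) q_prime] prime_dvd_mult_iff[OF t(1)] by blast
    then obtain x where x: "x \<in> generate G {y}" "ord x = q" using cauchy_in_subgroup[OF fin Y(1) t] by blast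
    have xQ: "x \<in> Q" using x YQ by blast
    have xc: "x \<in> carrier G" using xQ Qc by blast
    have "centralizer_of G y \<subseteq> centralizer_of G x"
    proof
      fix c assume c: "c \<in> centralizer_of G y"
      then have cc: "c \<in> carrier G" "y \<in> centralizer_of G c" using yc unfolding centralizer_of_def by auto
      then have "x \<in> centralizer_of G c" using Y(4)[OF subgroup_centralizer_of[OF cc(1)] cc(2)] x(1) by blast
      then show "c \<in> centralizer_of G x" using cc(1) unfolding centralizer_of_def by auto
    qed
    moreover have "Q \<subseteq> centralizer_of G y" using Q_comm y(1) Qc by (auto simp: centralizer_of_def)
    ultimately show ?thesis using cent_prime[OF xQ x(2)] by blast
  qed
  have TI: "g \<in> Q" if g: "g \<in> carrier G" and x: "x \<in> Q - {\<one>}" "conj_by G g x \<in> Q - {\<one>}" for g x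
  proof -
    have xc: "x \<in> carrier G" using x Qc by blast
    have "conj_by G g ` Q \<subseteq> centralizer_of G (conj_by G g x)"
    proof
      fix y assume "y \<in> conj_by G g ` Q"
      then obtain a where a: "a \<in> Q" "y = conj_by G g a" by blast
      have ac: "a \<in> carrier G" using a Qc by blast
      have "conj_by G g a \<otimes> conj_by G g x = conj_by G g x \<otimes> conj_by G g a"
        using conj_simps(3)[OF g g ac xc] conj_simps(3)[OF g g xc ac] Q_comm[of a x] a(1) x(1) by simp
      then show "y \<in> centralizer_of G (conj_by G g x)" using a(2) g ac by (simp add: centralizer_of_def)
    qed
    also have "\<dots> = Q" using cent x(2) by blast
    finally have "conj_by G g ` Q = Q"
      using card_subset_eq[OF finite_subgroup[OF fin Q]] card_conj_image[OF g Qc] by simp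
    then have "g \<in> normalizer_of G Q" using g by (simp add: normalizer_of_def)
    then show ?thesis using Q_norm by simp
  qed
  obtain n where n: "card (carrier G) = n * card M" "n > 1" using card_carrier .
  define U where "U = conjugates_of (p_part M)"
  define V where "V = conjugates_of Q"
  have sub: "U \<subseteq> carrier G - {\<one>}" "V \<subseteq> carrier G - {\<one>}"
    unfolding U_def V_def using p_part_conjugates(1) conjugates_of_subset[OF Qc] by auto
  have "ord v \<noteq> p" if v: "v \<in> V" for v
  proof -
    obtain g x where gx: "g \<in> carrier G" "x \<in> Q" "v = conj_by G g x" using v unfolding V_def conjugates_of_def by blast
    have "ord v = ord x" using ord_conj[OF gx(1) subgroup.mem_carrier[OF Q gx(2)]] gx(3) by simp
    then have "ord v dvd q * q" using ord_dvd_subgroup_card[OF Q gx(2)] cQ by simp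
    moreover have "\<not> p dvd q" using q_less q_ge_2 by (auto dest: dvd_imp_le)
    then have "\<not> p dvd q * q" using prime_dvd_mult_iff[OF p_prime] by simp
    ultimately show ?thesis by metis
  qed
  then have disj: "U \<inter> V = {}" unfolding U_def using p_part_conjugates(2) by blast
  have tot: "card U + card V < n * p * q"
    using card_two_disjoint[OF fin sub disj] n(1) point_order by (simp add: mult_ac)
  have cU: "n * (p - 1) \<le> card U" unfolding U_def using card_p_part_conjugates[OF n(1)] .
  have "card (carrier G) * card (Q - {\<one>}) \<le> card Q * card V"
    using card_conjugates_ge[OF fin subgroup_self Q, of "Q - {\<one>}"] TI Qc unfolding V_def conjugates_of_def by blast
  moreover have "card (Q - {\<one>}) = q * q - 1" using subgroup.one_closed[OF Q] cQ by simp
  ultimately have "q * (n * p * (q * q - 1)) \<le> q * (q * card V)" using n(1) point_order cQ by (simp add: mult_ac)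
  then have cV: "n * p * (q * q - 1) \<le> q * card V" using q_ge_2 by simp
  have "q * (card U + card V + 1) \<le> q * (n * p * q)"
    by (intro mult_le_mono2) (use tot in simp)
  moreover have "q * (n * (p - 1)) \<le> q * card U" using cU by simp
  ultimately have 1: "q * (n * p * q) \<ge> q * (n * (p - 1)) + q * card V + q"
    by (simp add: algebra_simps)
  obtain k where k: "q * q = Suc k" using q_ge_2 by (cases "q * q") auto
  have "n * p * q * q = n * p * (q * q - 1) + n * p" by (simp add: k mult.assoc distrib_left)
  then have 2: "n * p * q * q \<le> q * card V + n * p" using cV by linarith
  show False using order_contradiction[OF 1 2 q_ge_2 n(2)] .
qed

theorem counterexample_impossible: False
proof -
  obtain K where K: "K \<in> points" "K \<noteq> M" using other_point[OF M_point] .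
  obtain s where s: "prime s" "card (normalizer_of G (K \<inter> M)) = s * q"
    using meet_normalizer_order[OF K(1) M_point K(2)] by blast
  then have "s = q" by (rule meet_normalizer_not_coprime[OF K(1) M_point K(2)])
  then show False using meet_normalizer_not_square[OF K(1) M_point K(2)] s(2) by simp
qed

end

section \<open>The structure of hereditarily primitive actions\<close>

context faithful_hereditarily_primitive
begin

theorem frobenius_of_faithful: "prime_frobenius G (carrier G) M"
proof (rule ccontr)
  assume not: "\<not> prime_frobenius G (carrier G) M"
  have nn: "normalizer_of G M \<noteq> carrier G" using frobenius_of_normal_point not by blast
  have "M \<noteq> {\<one>}" using nn by (auto simp: normalizer_of_def)
  then have "card M \<noteq> 1" using subgroup_eq_one_iff_card[OF fin subgroup_M] by blast
  then have ne: "prime_factors (card M) \<noteq> {}"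
    using card_subgroup_pos[OF fin subgroup_M] prime_factor_nat[of "card M"] by (auto simp: prime_factors_dvd)
  define p where "p = Max (prime_factors (card M))"
  have p: "p \<in> prime_factors (card M)" unfolding p_def using ne by (intro Max_in) auto
  interpret frobenius_counterexample G M p
  proof
    show "A = {\<one>}" if "subgroup A G" "normalizer_of G A = carrier G" "\<And>a b. a \<in> A \<Longrightarrow> b \<in> A \<Longrightarrow> a \<otimes> b = b \<otimes> a" for A
      using frobenius_of_abelian_normal[OF that(1,2) _ that(3)] not by blast
    show "prime p" "p dvd card M" using p by auto
    show "u \<le> p" if "prime u" "u dvd card M" for u
      unfolding p_def using that card_subgroup_pos[OF fin subgroup_M] by (intro Max_ge) (auto simp: prime_factors_dvd)
  qed (fact nn)
  show False by (rule counterexample_impossible)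
qed

end

context group
begin

text \<open>The kernel of the action may be enlarged to contain a given normal subgroup below
  \<open>L\<close>: if \<open>N\<^sub>0\<close> is not contained in \<open>N\<close>, then
  \<open>L\<close> is the product of the two because \<open>N\<close> has prime index in
  \<open>L\<close>. Then \<open>L\<close> is normal in \<open>Z\<close>, of index \<open>r\<close>.\<close>

lemma prime_frobenius_core:
  assumes "finite (carrier G)" "prime_frobenius G Z L" "subgroup Z G" "subgroup L G" "L \<subseteq> Z"
    and N\<^sub>0: "subgroup N\<^sub>0 G" "N\<^sub>0 \<subseteq> L" "Z \<subseteq> normalizer_of G N\<^sub>0"
  obtains N E r e where "subgroup N G" "subgroup E G" "N \<subseteq> L" "N \<subseteq> E" "E \<subseteq> Z" "N\<^sub>0 \<subseteq> N"
     "Z \<subseteq> normalizer_of G N" "Z \<subseteq> normalizer_of G E" "prime (r::nat)"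
     "card E = r * card N" "card L = e * card N" "card Z = r * e * card N" "e = 1 \<or> prime e \<and> e < r"
proof -
  obtain N E r e where N: "subgroup N G" "subgroup E G" "N \<subseteq> L" "N \<subseteq> E" "E \<subseteq> Z"
     "Z \<subseteq> normalizer_of G N" "Z \<subseteq> normalizer_of G E" "prime (r::nat)"
     "card E = r * card N" "card L = e * card N" "card Z = r * e * card N" "e = 1 \<or> prime e \<and> e < r"
    using assms(2) unfolding prime_frobenius_def by blast
  show thesis
  proof (cases "N\<^sub>0 \<subseteq> N")
    case True
    then show thesis using that[OF N(1-5) _ N(6-12)] by blast
  next
    case False
    have finL: "finite L" using finite_subgroup[OF assms(1,4)] .
    have "e \<noteq> 1" using False N(10) card_subset_eq[OF finL N(3)] N\<^sub>0(2) by auto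
    then have e: "prime e" using N(12) by blast
    have sub: "N\<^sub>0 \<subseteq> normalizer_of G N" using N(6) N\<^sub>0(2) assms(5) by blast
    note S = subgroup_set_mult_normalizer[OF N(1) N\<^sub>0(1) sub]
    have mem: "x \<in> N <#> N\<^sub>0 \<longleftrightarrow> (\<exists>a\<in>N. \<exists>b\<in>N\<^sub>0. x = a \<otimes> b)" for x unfolding set_mult_def by auto
    have "N <#> N\<^sub>0 \<subseteq> L" using subgroup.m_closed[OF assms(4)] N(3) N\<^sub>0(2) by (auto simp: mem subset_iff)
    then have "N <#> N\<^sub>0 = N \<or> N <#> N\<^sub>0 = L"
      using subgroup_prime_index_maximal[OF assms(1) N(1) S(1) assms(4) S(2) _ N(10) e] by blast
    then have L: "L = N <#> N\<^sub>0" using False S(3) by blast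
    have "Z \<subseteq> normalizer_of G L"
    proof (rule subset_normalizer_ofI[OF assms(3) subgroup.subset[OF assms(4)]])
      fix z x assume z: "z \<in> Z" and "x \<in> L"
      then obtain a b where ab: "a \<in> N" "b \<in> N\<^sub>0" "x = a \<otimes> b" unfolding L mem by blast
      have c: "z \<in> carrier G" "a \<in> carrier G" "b \<in> carrier G"
        using subgroup.mem_carrier[OF assms(3) z] subgroup.mem_carrier[OF N(1) ab(1)]
          subgroup.mem_carrier[OF N\<^sub>0(1) ab(2)] by auto
      have "conj_by G z a \<in> N" using normalizer_of_mem[of z N a] N(6) z ab(1) by blast
      moreover have "conj_by G z b \<in> N\<^sub>0" using normalizer_of_mem[of z "N\<^sub>0" b] N\<^sub>0(3) z ab(2) by blast
      ultimately show "conj_by G z x \<in> L"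
        unfolding L mem ab(3) using conj_simps(3)[OF c(1,1,2,3)] by blast
    qed
    moreover have "card Z = r * card L" using N(10,11) by simp
    ultimately show thesis
      using that[OF assms(4,3) subset_refl assms(5) subset_refl N\<^sub>0(2) _ subgroup_le_normalizer[OF assms(3)] N(8), of 1] by simp
  qed
qed

end

locale finite_epimorphism = group_hom +
  assumes finG: "finite (carrier G)" and surj: "h ` carrier G = carrier H"
begin

definition preimage where
  "preimage X = {g \<in> carrier G. h g \<in> X}"

lemma finH: "finite (carrier H)"
  unfolding surj[symmetric] using finG by simp

lemma subgroup_preimage:
  assumes "subgroup X H"
  shows "subgroup (preimage X) G"
  by (rule G.subgroupI)
    (use subgroup.one_closed[OF assms] subgroup.m_closed[OF assms] subgroup.m_inv_closed[OF assms] in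
      \<open>auto simp: preimage_def intro: exI[of _ "\<one>\<^bsub>G\<^esub>"]\<close>)

lemma subgroup_image: "subgroup X G \<Longrightarrow> subgroup (h ` X) H"
  by (rule subgroup_img_is_subgroup)

lemma image_preimage: "X \<subseteq> carrier H \<Longrightarrow> h ` preimage X = X"
  unfolding preimage_def surj[symmetric] by auto

lemma preimage_mono: "X \<subseteq> Y \<Longrightarrow> preimage X \<subseteq> preimage Y"
  by (auto simp: preimage_def)

lemma preimage_image:
  assumes "subgroup K G" "kernel G H h \<subseteq> K"
  shows "preimage (h ` K) = K"
proof
  note Kc = subgroup.subset[OF assms(1)]
  show "K \<subseteq> preimage (h ` K)" using Kc by (auto simp: preimage_def)
  show "preimage (h ` K) \<subseteq> K"
  proof
    fix g assume "g \<in> preimage (h ` K)"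
    then obtain k where gk: "g \<in> carrier G" "k \<in> K" "h g = h k" by (auto simp: preimage_def)
    have kc: "k \<in> carrier G" using gk Kc by blast
    have "h (g \<otimes>\<^bsub>G\<^esub> inv\<^bsub>G\<^esub> k) = \<one>\<^bsub>H\<^esub>" using gk kc by simp
    then have "g \<otimes>\<^bsub>G\<^esub> inv\<^bsub>G\<^esub> k \<in> K" using assms(2) gk(1) kc by (auto simp: kernel_def)
    then have "g \<otimes>\<^bsub>G\<^esub> inv\<^bsub>G\<^esub> k \<otimes>\<^bsub>G\<^esub> k \<in> K" using subgroup.m_closed[OF assms(1)] gk(2) by blast
    then show "g \<in> K" using gk(1) kc by (simp add: G.m_assoc)
  qed
qed

lemma card_preimage:
  assumes "X \<subseteq> carrier H"
  shows "card (preimage X) = card X * card (kernel G H h)"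
proof -
  have fin: "finite (preimage X)" using finG by (simp add: preimage_def)
  have fibre: "card {g \<in> preimage X. h g = x} = card (kernel G H h)" if x: "x \<in> X" for x
  proof -
    have "x \<in> h ` carrier G" unfolding surj using x assms by blast
    then obtain a where a: "a \<in> carrier G" "h a = x" by blast
    have "bij_betw (\<lambda>k. k \<otimes>\<^bsub>G\<^esub> a) (kernel G H h) {g \<in> preimage X. h g = x}"
    proof (rule bij_betw_imageI)
      show "inj_on (\<lambda>k. k \<otimes>\<^bsub>G\<^esub> a) (kernel G H h)"
        using a by (intro inj_onI) (simp add: kernel_def)
      show "(\<lambda>k. k \<otimes>\<^bsub>G\<^esub> a) ` kernel G H h = {g \<in> preimage X. h g = x}"
      proof
        show "(\<lambda>k. k \<otimes>\<^bsub>G\<^esub> a) ` kernel G H h \<subseteq> {g \<in> preimage X. h g = x}"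
          using a x assms by (auto simp: kernel_def preimage_def subset_iff)
        show "{g \<in> preimage X. h g = x} \<subseteq> (\<lambda>k. k \<otimes>\<^bsub>G\<^esub> a) ` kernel G H h"
        proof
          fix g assume "g \<in> {g \<in> preimage X. h g = x}"
          then have g: "g \<in> carrier G" "h g = x" by (auto simp: preimage_def)
          then have "g \<otimes>\<^bsub>G\<^esub> inv\<^bsub>G\<^esub> a \<in> kernel G H h" using a x assms by (auto simp: kernel_def)
          moreover have "g = g \<otimes>\<^bsub>G\<^esub> inv\<^bsub>G\<^esub> a \<otimes>\<^bsub>G\<^esub> a" using g a by (simp add: G.m_assoc)
          ultimately show "g \<in> (\<lambda>k. k \<otimes>\<^bsub>G\<^esub> a) ` kernel G H h" by blast
        qed
      qed
    qed
    then show ?thesis by (simp add: bij_betw_same_card)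
  qed
  have "card (preimage X) = (\<Sum>x \<in> h ` preimage X. card {g \<in> preimage X. h g = x})"
    using fin sum.image_gen[of "preimage X" "\<lambda>_. 1::nat" h] by simp
  then show ?thesis unfolding image_preimage[OF assms] using fibre by simp
qed

lemma card_image_subgroup:
  assumes "subgroup K G" "kernel G H h \<subseteq> K"
  shows "card K = card (h ` K) * card (kernel G H h)"
  using card_preimage[OF subgroup.subset[OF subgroup_image[OF assms(1)]]] preimage_image[OF assms] by simp

lemma card_kernel_pos: "card (kernel G H h) > 0"
  using G.card_subgroup_pos[OF finG subgroup_kernel] .

lemma image_conj: "g \<in> carrier G \<Longrightarrow> x \<in> carrier G \<Longrightarrow> h (conj_by G g x) = conj_by H (h g) (h x)"
  by (simp add: conj_by_def)

lemma image_conj_image: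
  assumes "g \<in> carrier G" "X \<subseteq> carrier G"
  shows "h ` conj_by G g ` X = conj_by H (h g) ` h ` X"
  unfolding image_image using assms by (intro image_cong) (auto simp: image_conj)

lemma preimage_normalizer:
  assumes "subgroup Z H" "X \<subseteq> carrier H" "Z \<subseteq> normalizer_of H X"
  shows "preimage Z \<subseteq> normalizer_of G (preimage X)"
proof (rule G.subset_normalizer_ofI[OF subgroup_preimage[OF assms(1)]])
  show "preimage X \<subseteq> carrier G" by (auto simp: preimage_def)
  fix z x assume "z \<in> preimage Z" "x \<in> preimage X"
  then have zx: "z \<in> carrier G" "h z \<in> Z" "x \<in> carrier G" "h x \<in> X" by (auto simp: preimage_def)
  have "conj_by H (h z) (h x) \<in> X" using H.normalizer_of_mem[OF _ zx(4)] assms(3) zx(2) by blast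
  then show "conj_by G z x \<in> preimage X" using zx image_conj by (simp add: preimage_def)
qed

lemma image_normalizer:
  assumes "X \<subseteq> carrier G" "Z \<subseteq> normalizer_of G X"
  shows "h ` Z \<subseteq> normalizer_of H (h ` X)"
proof
  fix y assume "y \<in> h ` Z"
  then obtain z where z: "z \<in> Z" "y = h z" by blast
  then have "z \<in> carrier G" "conj_by G z ` X = X" using assms(2) by (auto simp: normalizer_of_def)
  then show "y \<in> normalizer_of H (h ` X)"
    using image_conj_image[of z X] assms(1) z(2) by (simp add: normalizer_of_def)
qed

lemma prime_frobenius_preimage:
  assumes "prime_frobenius H Z L" "subgroup Z H" "subgroup L H"
  shows "prime_frobenius G (preimage Z) (preimage L)"
proof -
  obtain N E r e where N: "subgroup N H" "subgroup E H" "N \<subseteq> L" "N \<subseteq> E" "E \<subseteq> Z"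
     "Z \<subseteq> normalizer_of H N" "Z \<subseteq> normalizer_of H E" "prime (r::nat)"
     "card E = r * card N" "card L = e * card N" "card Z = r * e * card N" "e = 1 \<or> prime e \<and> e < r"
    using assms(1) unfolding prime_frobenius_def by blast
  have c: "card (preimage X) = card X * card (kernel G H h)" if "subgroup X H" for X
    using card_preimage[OF subgroup.subset[OF that]] .
  show ?thesis
    unfolding prime_frobenius_def
  proof (intro exI conjI)
    show "subgroup (preimage N) G" "subgroup (preimage E) G" using subgroup_preimage N by auto
    show "preimage N \<subseteq> preimage L" "preimage N \<subseteq> preimage E" "preimage E \<subseteq> preimage Z"
      using preimage_mono N by auto
    show "preimage Z \<subseteq> normalizer_of G (preimage N)" "preimage Z \<subseteq> normalizer_of G (preimage E)"
      using preimage_normalizer[OF assms(2)] subgroup.subset N(1,2,6,7) by metis+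
    show "card (preimage E) = r * card (preimage N)" "card (preimage L) = e * card (preimage N)"
      "card (preimage Z) = r * e * card (preimage N)"
      using c[OF N(1)] c[OF N(2)] c[OF assms(2)] c[OF assms(3)] N(9-11) by auto
  qed (use N in auto)
qed

lemma prime_frobenius_image:
  assumes "prime_frobenius G Z L" "subgroup Z G" "subgroup L G" "L \<subseteq> Z" "kernel G H h \<subseteq> L"
  shows "prime_frobenius H (h ` Z) (h ` L)"
proof -
  have k: "Z \<subseteq> normalizer_of G (kernel G H h)"
    using G.normal_iff_normalizer[OF subgroup_kernel] normal_kernel subgroup.subset[OF assms(2)] by blast
  obtain N E r e where N: "subgroup N G" "subgroup E G" "N \<subseteq> L" "N \<subseteq> E" "E \<subseteq> Z" "kernel G H h \<subseteq> N"
     "Z \<subseteq> normalizer_of G N" "Z \<subseteq> normalizer_of G E" "prime (r::nat)"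
     "card E = r * card N" "card L = e * card N" "card Z = r * e * card N" "e = 1 \<or> prime e \<and> e < r"
    using G.prime_frobenius_core[OF finG assms(1-4) subgroup_kernel assms(5) k] .
  have kk: "kernel G H h \<subseteq> E" "kernel G H h \<subseteq> Z" using N(4,6) assms(4,5) by auto
  note cards = card_image_subgroup[OF N(1,6)] card_image_subgroup[OF N(2) kk(1)]
    card_image_subgroup[OF assms(3,5)] card_image_subgroup[OF assms(2) kk(2)]
  show ?thesis
    unfolding prime_frobenius_def
  proof (intro exI conjI)
    show "subgroup (h ` N) H" "subgroup (h ` E) H" using subgroup_image N by auto
    show "h ` N \<subseteq> h ` L" "h ` N \<subseteq> h ` E" "h ` E \<subseteq> h ` Z" using N by auto
    show "h ` Z \<subseteq> normalizer_of H (h ` N)" "h ` Z \<subseteq> normalizer_of H (h ` E)"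
      using image_normalizer[OF subgroup.subset[OF N(1)] N(7)] image_normalizer[OF subgroup.subset[OF N(2)] N(8)] .
    show "card (h ` E) = r * card (h ` N)" "card (h ` L) = e * card (h ` N)"
      "card (h ` Z) = r * e * card (h ` N)"
      using N(10-12) card_kernel_pos unfolding cards by (auto simp: mult.assoc[symmetric])
  qed (use N in auto)
qed

lemma hereditarily_primitive_image:
  assumes "hereditarily_primitive G (carrier G) M" "kernel G H h \<subseteq> M"
  shows "hereditarily_primitive H (carrier H) (h ` M)"
proof -
  have M: "subgroup M G" "M \<subset> carrier G" using assms(1) unfolding hereditarily_primitive_def by auto
  have pre: "preimage (h ` M) = M" using preimage_image[OF M(1) assms(2)] .
  show ?thesis
    unfolding hereditarily_primitive_def
  proof (intro conjI allI impI)
    show "subgroup (carrier H) H" by (rule H.subgroup_self)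
    show "subgroup (h ` M) H" using subgroup_image[OF M(1)] .
    have "h ` M \<noteq> carrier H"
    proof
      assume "h ` M = carrier H"
      then have "M = preimage (carrier H)" using pre by simp
      then show False using M(2) by (auto simp: preimage_def)
    qed
    then show "h ` M \<subset> carrier H" using subgroup.subset[OF subgroup_image[OF M(1)]] by blast
  next
    fix X Y assume X: "subgroup X H" and Y: "subgroup Y H" and *: "Y \<inter> h ` M \<subseteq> X" "X \<subseteq> Y" "\<not> X \<subseteq> h ` M"
    note Xc = subgroup.subset[OF X] and Yc = subgroup.subset[OF Y]
    have "preimage X = preimage Y"
    proof (rule G.hereditarily_primitiveD[OF assms(1) subgroup_preimage[OF X] subgroup_preimage[OF Y]])
      show "preimage Y \<inter> M \<subseteq> preimage X" using *(1) by (auto simp: preimage_def)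
      show "preimage X \<subseteq> preimage Y" using preimage_mono[OF *(2)] .
      show "preimage Y \<subseteq> carrier G" by (auto simp: preimage_def)
      show "\<not> preimage X \<subseteq> M"
      proof
        assume "preimage X \<subseteq> M"
        then have "h ` preimage X \<subseteq> h ` M" by (rule image_mono)
        then show False using *(3) unfolding image_preimage[OF Xc] by blast
      qed
    qed
    then have "h ` preimage X = h ` preimage Y" by (rule arg_cong)
    then show "X = Y" unfolding image_preimage[OF Xc] image_preimage[OF Yc] .
  qed
qed

end

context group
begin

text \<open>Divide by the intersection \<open>N\<close> of all conjugates of \<open>M\<close>. Subgroups of
  the quotient correspond to subgroups of \<open>G\<close> above \<open>N\<close>, and the property
  of being hereditarily primitive, the structure of proper subgroups, and the resulting structure of
  the quotient are transported along this correspondence.\<close>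

lemma frobenius_of_proper_subgroups:
  assumes fin: "finite (carrier G)" and hp: "hereditarily_primitive G (carrier G) M"
    and IH: "\<And>Z L. Z \<noteq> carrier G \<Longrightarrow> hereditarily_primitive G Z L \<Longrightarrow> prime_frobenius G Z L"
  shows "prime_frobenius G (carrier G) M"
proof -
  have M: "subgroup M G" "M \<subset> carrier G" using hp unfolding hereditarily_primitive_def by auto
  note Mc = subgroup.subset[OF M(1)]
  define N where "N = (\<Inter>g\<in>carrier G. conj_by G g ` M)"
  have "subgroup (\<Inter> ((\<lambda>g. conj_by G g ` M) ` carrier G)) G"
    by (rule subgroups_Inter) (use subgroup_conj_image[OF _ M(1)] one_closed in auto)
  then have NG: "subgroup N G" unfolding N_def .
  have NK: "N \<subseteq> conj_by G g ` M" if "g \<in> carrier G" for g unfolding N_def using that by blast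
  have NM: "N \<subseteq> M" using NK[of \<one>] conj_image_one[OF Mc] by simp
  have normal: "conj_by G z x \<in> N" if z: "z \<in> carrier G" and x: "x \<in> N" for z x
  proof -
    have xc: "x \<in> carrier G" using subgroup.mem_carrier[OF NG x] .
    have "conj_by G z x \<in> conj_by G g ` M" if g: "g \<in> carrier G" for g
    proof -
      have "x \<in> conj_by G (inv z \<otimes> g) ` M" using NK[of "inv z \<otimes> g"] x z g by blast
      then have "conj_by G z x \<in> conj_by G z ` conj_by G (inv z \<otimes> g) ` M" by blast
      also have "\<dots> = conj_by G g ` M" using conj_image_comp[OF z _ Mc, of "inv z \<otimes> g"] z g by simp
      finally show ?thesis .
    qed
    then show ?thesis unfolding N_def by blast
  qed
  have "carrier G \<subseteq> normalizer_of G N"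
    by (rule subset_normalizer_ofI[OF subgroup_self subgroup.subset[OF NG] normal])
  then have "N \<lhd> G" using normal_iff_normalizer[OF NG] normalizer_of_subset by blast
  then interpret N: normal N G .
  define h where "h = (\<lambda>g. N #> g)"
  interpret h: finite_epimorphism G "G Mod N" h
  proof (intro finite_epimorphism.intro finite_epimorphism_axioms.intro)
    show "group_hom G (G Mod N) h"
      unfolding h_def using N.r_coset_hom_Mod N.factorgroup_is_group
      by (simp add: group_hom_def group_hom_axioms_def)
    show "finite (carrier G)" by fact
    show "h ` carrier G = carrier (G Mod N)" unfolding h_def by (simp add: carrier_FactGroup)
  qed
  have ker: "kernel G (G Mod N) h = N"
  proof
    show "kernel G (G Mod N) h \<subseteq> N"
      using coset_join1[OF _ _ NG] by (auto simp: kernel_def h_def)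
    show "N \<subseteq> kernel G (G Mod N) h"
      using coset_join2[OF _ NG] N.mem_carrier by (auto simp: kernel_def h_def)
  qed
  have hM: "subgroup (h ` M) (G Mod N)" using h.subgroup_image[OF M(1)] .
  interpret Q: faithful_hereditarily_primitive "G Mod N" "h ` M"
  proof
    show "finite (carrier (G Mod N))" by (rule h.finH)
    show "hereditarily_primitive (G Mod N) (carrier (G Mod N)) (h ` M)"
      using h.hereditarily_primitive_image[OF hp] ker NM by simp
    show "x = \<one>\<^bsub>G Mod N\<^esub>" if x: "x \<in> carrier (G Mod N)"
      and all: "\<And>g. g \<in> carrier (G Mod N) \<Longrightarrow> x \<in> conj_by (G Mod N) g ` h ` M" for x
    proof -
      obtain a where a: "a \<in> carrier G" "x = h a" using x unfolding h.surj[symmetric] by blast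
      have "a \<in> conj_by G g ` M" if g: "g \<in> carrier G" for g
      proof -
        have "x \<in> h ` conj_by G g ` M" using all[of "h g"] h.image_conj_image[OF g Mc] g by simp
        then have "a \<in> h.preimage (h ` conj_by G g ` M)" using a by (simp add: h.preimage_def)
        then show ?thesis using h.preimage_image[OF subgroup_conj_image[OF g M(1)]] ker NK[OF g] by simp
      qed
      then have "a \<in> N" unfolding N_def by blast
      then have "a \<in> kernel G (G Mod N) h" using ker by simp
      then show ?thesis using a(2) unfolding kernel_def by blast
    qed
    show "prime_frobenius (G Mod N) Z (Z \<inter> conj_by (G Mod N) y ` h ` M)"
      if Z: "subgroup Z (G Mod N)" "Z \<noteq> carrier (G Mod N)" and y: "y \<in> carrier (G Mod N)"
        and nsub: "\<not> Z \<subseteq> conj_by (G Mod N) y ` h ` M" for Z y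
    proof -
      note Zc = subgroup.subset[OF Z(1)]
      obtain g where g: "g \<in> carrier G" "y = h g" using y unfolding h.surj[symmetric] by blast
      define K where "K = conj_by G g ` M"
      have K: "subgroup K G" "N \<subseteq> K" unfolding K_def using subgroup_conj_image[OF g(1) M(1)] NK[OF g(1)] by auto
      have hK: "conj_by (G Mod N) y ` h ` M = h ` K" unfolding K_def g(2) using h.image_conj_image[OF g(1) Mc] by simp
      define Y where "Y = h.preimage Z"
      have Y: "subgroup Y G" "h ` Y = Z" unfolding Y_def
        using h.subgroup_preimage[OF Z(1)] h.image_preimage[OF Zc] by auto
      have "Y \<noteq> carrier G" using Y(2) Z(2) h.surj by auto
      moreover have "\<not> Y \<subseteq> K" using nsub Y(2) unfolding hK by blast
      moreover have "hereditarily_primitive G (carrier G) K"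
        using hereditarily_primitive_conj[OF hp g(1)] conj_image_self[OF subgroup_self g(1)] unfolding K_def by simp
      ultimately have pf: "prime_frobenius G Y (Y \<inter> K)"
        using IH hereditarily_primitive_restrict[OF _ Y(1) subgroup.subset[OF Y(1)]] by blast
      have "N \<subseteq> Y" unfolding Y_def h.preimage_def
        using ker subgroup.one_closed[OF Z(1)] by (auto simp: kernel_def)
      then have "prime_frobenius (G Mod N) (h ` Y) (h ` (Y \<inter> K))"
        using h.prime_frobenius_image[OF pf Y(1) subgroups_Inter_pair[OF Y(1) K(1)]] ker K(2) by blast
      moreover have "h ` (Y \<inter> K) = Z \<inter> h ` K"
      proof
        show "h ` (Y \<inter> K) \<subseteq> Z \<inter> h ` K" using Y(2) by blast
        show "Z \<inter> h ` K \<subseteq> h ` (Y \<inter> K)"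
          using subgroup.subset[OF K(1)] unfolding Y_def h.preimage_def by auto
      qed
      ultimately show ?thesis using Y(2) hK by simp
    qed
  qed
  have "prime_frobenius G (h.preimage (carrier (G Mod N))) (h.preimage (h ` M))"
    using h.prime_frobenius_preimage[OF Q.frobenius_of_faithful h.H.subgroup_self hM] .
  moreover have "h.preimage (carrier (G Mod N)) = carrier G" by (auto simp: h.preimage_def)
  moreover have "h.preimage (h ` M) = M" using h.preimage_image[OF M(1)] ker NM by simp
  ultimately show ?thesis by simp
qed

lemma conj_by_restrict:
  assumes "subgroup Z G" "g \<in> Z"
  shows "conj_by (G\<lparr>carrier := Z\<rparr>) g = conj_by G g"
  using assms by (intro ext) (simp add: conj_by_def)

lemma normalizer_of_restrict:
  assumes "subgroup Z G"
  shows "normalizer_of (G\<lparr>carrier := Z\<rparr>) N = normalizer_of G N \<inter> Z"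
  using assms conj_by_restrict[OF assms] subgroup.mem_carrier[OF assms]
  by (auto simp: normalizer_of_def)

lemma subgroup_restrict_iff:
  assumes "subgroup Z G"
  shows "subgroup X (G\<lparr>carrier := Z\<rparr>) \<longleftrightarrow> subgroup X G \<and> X \<subseteq> Z"
  using incl_subgroup[OF assms, of X] subgroup_incl[OF _ assms, of X] subgroup.subset[of X "G\<lparr>carrier := Z\<rparr>"] by auto

lemma hereditarily_primitive_restrict_iff:
  assumes "subgroup Z G" "Y \<subseteq> Z"
  shows "hereditarily_primitive (G\<lparr>carrier := Z\<rparr>) Y L \<longleftrightarrow> hereditarily_primitive G Y L"
proof -
  have "(\<forall>X W. subgroup X G \<and> X \<subseteq> Z \<longrightarrow> subgroup W G \<and> W \<subseteq> Z \<longrightarrow> W \<inter> L \<subseteq> X \<longrightarrow> X \<subseteq> W \<longrightarrow> W \<subseteq> Y \<longrightarrow> \<not> X \<subseteq> L \<longrightarrow> X = W) \<longleftrightarrow>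
      (\<forall>X W. subgroup X G \<longrightarrow> subgroup W G \<longrightarrow> W \<inter> L \<subseteq> X \<longrightarrow> X \<subseteq> W \<longrightarrow> W \<subseteq> Y \<longrightarrow> \<not> X \<subseteq> L \<longrightarrow> X = W)"
    by (intro iff_allI) (use assms(2) in blast)
  moreover have "(subgroup Y G \<and> Y \<subseteq> Z) \<and> (subgroup L G \<and> L \<subseteq> Z) \<and> L \<subset> Y \<and> R \<longleftrightarrow> subgroup Y G \<and> subgroup L G \<and> L \<subset> Y \<and> R" for R
    using assms(2) by auto
  ultimately show ?thesis
    unfolding hereditarily_primitive_def subgroup_restrict_iff[OF assms(1)] by simp
qed

lemma prime_frobenius_restrict_iff:
  assumes "subgroup Z G" "Y \<subseteq> Z"
  shows "prime_frobenius (G\<lparr>carrier := Z\<rparr>) Y L \<longleftrightarrow> prime_frobenius G Y L"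
proof -
  have "(subgroup N G \<and> N \<subseteq> Z) \<and> (subgroup E G \<and> E \<subseteq> Z) \<and> N \<subseteq> L \<and> N \<subseteq> E \<and> E \<subseteq> Y \<and>
      Y \<subseteq> normalizer_of G N \<inter> Z \<and> Y \<subseteq> normalizer_of G E \<inter> Z \<and> R \<longleftrightarrow>
      subgroup N G \<and> subgroup E G \<and> N \<subseteq> L \<and> N \<subseteq> E \<and> E \<subseteq> Y \<and>
      Y \<subseteq> normalizer_of G N \<and> Y \<subseteq> normalizer_of G E \<and> R" for N E R
    using assms(2) by blast
  then show ?thesis
    unfolding prime_frobenius_def subgroup_restrict_iff[OF assms(1)] normalizer_of_restrict[OF assms(1)] by simp
qed

theorem hereditarily_primitive_frobenius:
  assumes fin: "finite (carrier G)" and "hereditarily_primitive G Z L"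
  shows "prime_frobenius G Z L"
  using assms(2)
proof (induction "card Z" arbitrary: Z L rule: less_induct)
  case less
  have Z: "subgroup Z G" using less.prems unfolding hereditarily_primitive_def by blast
  interpret Z: group "G\<lparr>carrier := Z\<rparr>" using subgroup_imp_group[OF Z] .
  have finZ: "finite Z" using finite_subgroup[OF fin Z] .
  have "prime_frobenius (G\<lparr>carrier := Z\<rparr>) (carrier (G\<lparr>carrier := Z\<rparr>)) L"
  proof (rule Z.frobenius_of_proper_subgroups)
    show "finite (carrier (G\<lparr>carrier := Z\<rparr>))" using finZ by simp
    show "hereditarily_primitive (G\<lparr>carrier := Z\<rparr>) (carrier (G\<lparr>carrier := Z\<rparr>)) L"
      using less.prems hereditarily_primitive_restrict_iff[OF Z subset_refl] by simp
  next
    fix Y K assume Y: "Y \<noteq> carrier (G\<lparr>carrier := Z\<rparr>)" "hereditarily_primitive (G\<lparr>carrier := Z\<rparr>) Y K"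
    then have sub: "Y \<subset> Z" using subgroup.subset[of Y "G\<lparr>carrier := Z\<rparr>"] unfolding hereditarily_primitive_def by auto
    have YZ: "Y \<subseteq> Z" using sub by blast
    have "prime_frobenius G Y K"
      using less.hyps[OF psubset_card_mono[OF finZ sub]] Y(2) hereditarily_primitive_restrict_iff[OF Z YZ] by blast
    then show "prime_frobenius (G\<lparr>carrier := Z\<rparr>) Y K" using prime_frobenius_restrict_iff[OF Z YZ] by blast
  qed
  then show ?case using prime_frobenius_restrict_iff[OF Z subset_refl] by simp
qed

end

section \<open>Solvable radicals of modular and submodular subgroups\<close>

context group
begin

lemma solvable_seq_subgroup:
  assumes "subgroup H G" "subgroup K G" "H \<subseteq> K" "solvable_seq G K"
  shows "solvable_seq G H"
proof -
  obtain n where n: "(derived G ^^ n) K = {\<one>}" using solvable_imp_trivial_derived_seq[OF assms(4)] by blast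
  have "(derived G ^^ n) H \<subseteq> {\<one>}" using mono_exp_of_derived[OF assms(3), of n] n by simp
  moreover have "\<one> \<in> (derived G ^^ n) H"
    using subgroup.one_closed[OF exp_of_derived_is_subgroup[OF assms(1)]] .
  ultimately show ?thesis using trivial_derived_seq_imp_solvable[OF assms(1), of n] by blast
qed

lemma radical_restrict:
  assumes "finite (carrier G)" "subgroup Z G"
  defines "R \<equiv> solvable_radical (G\<lparr>carrier := Z\<rparr>)"
  shows "subgroup R G" "R \<subseteq> Z" "Z \<subseteq> normalizer_of G R" "solvable_seq G R"
    "\<And>T. subgroup T G \<Longrightarrow> T \<subseteq> Z \<Longrightarrow> Z \<subseteq> normalizer_of G T \<Longrightarrow> solvable_seq G T \<Longrightarrow> T \<subseteq> R"
proof -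
  interpret Z: group "G\<lparr>carrier := Z\<rparr>" using subgroup_imp_group[OF assms(2)] .
  have fin: "finite (carrier (G\<lparr>carrier := Z\<rparr>))" using finite_subgroup[OF assms(1,2)] by simp
  note rad = Z.solvable_radical_greatest[OF fin, folded R_def]
  have normal_iff: "T \<lhd> (G\<lparr>carrier := Z\<rparr>) \<longleftrightarrow> subgroup T G \<and> T \<subseteq> Z \<and> Z \<subseteq> normalizer_of G T" for T
  proof -
    have "T \<lhd> (G\<lparr>carrier := Z\<rparr>) \<longleftrightarrow> subgroup T (G\<lparr>carrier := Z\<rparr>) \<and> normalizer_of (G\<lparr>carrier := Z\<rparr>) T = Z"
    proof (cases "subgroup T (G\<lparr>carrier := Z\<rparr>)")
      case True
      then show ?thesis using Z.normal_iff_normalizer[OF True] by simp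
    next
      case False
      then show ?thesis using normal_imp_subgroup[of T "G\<lparr>carrier := Z\<rparr>"] by auto
    qed
    also have "normalizer_of (G\<lparr>carrier := Z\<rparr>) T = Z \<longleftrightarrow> Z \<subseteq> normalizer_of G T"
      unfolding normalizer_of_restrict[OF assms(2)] by blast
    finally show ?thesis unfolding subgroup_restrict_iff[OF assms(2)] by simp
  qed
  show R: "subgroup R G" "R \<subseteq> Z" "Z \<subseteq> normalizer_of G R" using rad(1) normal_iff by auto
  show "solvable_seq G R" using rad(2) solvable_restrict_iff[OF R(1)] by simp
  show "T \<subseteq> R" if "subgroup T G" "T \<subseteq> Z" "Z \<subseteq> normalizer_of G T" "solvable_seq G T" for T
    using rad(3)[of T] that normal_iff solvable_restrict_iff[OF that(1)] by simp
qed

text \<open>Conjugation by \<open>g\<close> maps the radical to a solvable normal subgroup of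
  \<open>N\<close>.\<close>

lemma radical_characteristic:
  assumes "finite (carrier G)" "subgroup N G" "normalizer_of G N = carrier G"
  shows "normalizer_of G (solvable_radical (G\<lparr>carrier := N\<rparr>)) = carrier G"
proof -
  define R where "R = solvable_radical (G\<lparr>carrier := N\<rparr>)"
  note R = radical_restrict[OF assms(1,2), folded R_def]
  note Rc = subgroup.subset[OF R(1)] and Nc = subgroup.subset[OF assms(2)]
  have conjN: "conj_by G g x \<in> N" if "g \<in> carrier G" "x \<in> N" for g x
    using normalizer_of_mem[of g N x] assms(3) that by simp
  have "conj_by G g ` R \<subseteq> R" if g: "g \<in> carrier G" for g
  proof (rule R(5))
    show S: "subgroup (conj_by G g ` R) G" using subgroup_conj_image[OF g R(1)] .
    show "conj_by G g ` R \<subseteq> N" using conjN[OF g] R(2) by blast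
    show "solvable_seq G (conj_by G g ` R)"
      by (rule group_hom.solvable_imp_solvable_img[OF group_hom_conj[OF g] R(4)])
    show "N \<subseteq> normalizer_of G (conj_by G g ` R)"
    proof (rule subset_normalizer_ofI[OF assms(2) subgroup.subset[OF S]])
      fix z y assume z: "z \<in> N" and "y \<in> conj_by G g ` R"
      then obtain x where x: "x \<in> R" "y = conj_by G g x" by blast
      have c: "z \<in> carrier G" "x \<in> carrier G" "inv g \<in> carrier G" using z x Nc Rc g by auto
      have "conj_by G (conj_by G (inv g) z) x \<in> R"
        using normalizer_of_mem[of _ R x] R(3) conjN[OF c(3) z] x(1) by blast
      moreover have "conj_by G z y = conj_by G g (conj_by G (conj_by G (inv g) z) x)"
        unfolding x(2) using g c by (simp add: conj_by_def m_assoc inv_mult_group)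
      ultimately show "conj_by G z y \<in> conj_by G g ` R" by blast
    qed
  qed
  then have "carrier G \<subseteq> normalizer_of G R"
    using Rc by (intro subset_normalizer_ofI[OF subgroup_self]) blast+
  then show ?thesis using normalizer_of_subset unfolding R_def by blast
qed

lemma le_solvable_radical:
  assumes "finite (carrier G)" "subgroup T G" "normalizer_of G T = carrier G" "solvable_seq G T"
  shows "T \<subseteq> solvable_radical G"
  using radical_restrict(5)[OF assms(1) subgroup_self assms(2) subgroup.subset[OF assms(2)]] assms(3,4) by simp

text \<open>Let \<open>R\<close> be the solvable radical of \<open>N\<close>, and \<open>C\<close> the
  centralizer of \<open>N\<close> modulo \<open>R\<close>, a normal subgroup of \<open>G\<close>.
  Commutators of \<open>S\<close> with \<open>N\<close> lie in \<open>S \<inter> N\<close>, a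
  solvable normal subgroup of \<open>N\<close>, hence in \<open>R\<close>; so \<open>S\<close> lies
  in \<open>C\<close>. The second derived subgroup of \<open>C\<close> lies in
  \<open>C \<inter> N\<close>, whose commutators lie in \<open>R\<close>, so that \<open>C\<close>
  is solvable.\<close>

lemma radical_of_metabelian_quotient:
  assumes fin: "finite (carrier G)" and N: "subgroup N G" "normalizer_of G N = carrier G"
    and M: "subgroup M G" "N \<subseteq> M" and der: "derived G (derived G (carrier G)) \<subseteq> N"
    and S: "subgroup S G" "S \<subseteq> M" "M \<subseteq> normalizer_of G S" "solvable_seq G S"
  shows "S \<subseteq> solvable_radical G"
proof -
  define R where "R = solvable_radical (G\<lparr>carrier := N\<rparr>)"
  note R = radical_restrict[OF fin N(1), folded R_def]
  have R_normal: "normalizer_of G R = carrier G" unfolding R_def using radical_characteristic[OF fin N] .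
  note Rc = subgroup.subset[OF R(1)] and Nc = subgroup.subset[OF N(1)]
  have conjN: "conj_by G g x \<in> N" if "g \<in> carrier G" "x \<in> N" for g x
    using normalizer_of_mem[of g N x] N(2) that by simp
  have conjR: "conj_by G g x \<in> R" if "g \<in> carrier G" "x \<in> R" for g x
    using normalizer_of_mem[of g R x] R_normal that by simp
  define C where "C = {g \<in> carrier G. \<forall>x\<in>N. conj_by G g x \<otimes> inv x \<in> R}"
  have C: "subgroup C G"
  proof (rule subgroupI)
    show "C \<subseteq> carrier G" by (auto simp: C_def)
    have "conj_by G \<one> x \<otimes> inv x \<in> R" if "x \<in> N" for x
      using that Nc subgroup.one_closed[OF R(1)] by (simp add: conj_by_def subset_iff)
    then have "\<one> \<in> C" by (simp add: C_def)
    then show "C \<noteq> {}" by blast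
  next
    fix g assume "g \<in> C"
    then have g: "g \<in> carrier G" "\<And>x. x \<in> N \<Longrightarrow> conj_by G g x \<otimes> inv x \<in> R" by (auto simp: C_def)
    have "conj_by G (inv g) x \<otimes> inv x \<in> R" if x: "x \<in> N" for x
    proof -
      have c: "x \<in> carrier G" using x Nc by blast
      have "inv (conj_by G g (conj_by G (inv g) x) \<otimes> inv (conj_by G (inv g) x)) \<in> R"
        using subgroup.m_inv_closed[OF R(1) g(2)[OF conjN[of "inv g" x]]] x g(1) by simp
      moreover have "inv (conj_by G g (conj_by G (inv g) x) \<otimes> inv (conj_by G (inv g) x)) = conj_by G (inv g) x \<otimes> inv x"
        using c g(1) by (simp add: conj_by_def m_assoc inv_mult_group)
      ultimately show ?thesis by simp
    qed
    then show "inv g \<in> C" using g(1) by (simp add: C_def)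
  next
    fix g k assume "g \<in> C" "k \<in> C"
    then have g: "g \<in> carrier G" "\<And>x. x \<in> N \<Longrightarrow> conj_by G g x \<otimes> inv x \<in> R"
      and k: "k \<in> carrier G" "\<And>x. x \<in> N \<Longrightarrow> conj_by G k x \<otimes> inv x \<in> R" by (auto simp: C_def)
    have "conj_by G (g \<otimes> k) x \<otimes> inv x \<in> R" if x: "x \<in> N" for x
    proof -
      have c: "x \<in> carrier G" using x Nc by blast
      have "(conj_by G g (conj_by G k x) \<otimes> inv (conj_by G k x)) \<otimes> (conj_by G k x \<otimes> inv x) \<in> R"
        using subgroup.m_closed[OF R(1) g(2)[OF conjN[OF k(1) x]] k(2)[OF x]] .
      moreover have "(conj_by G g (conj_by G k x) \<otimes> inv (conj_by G k x)) \<otimes> (conj_by G k x \<otimes> inv x) = conj_by G (g \<otimes> k) x \<otimes> inv x"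
        using c g(1) k(1) by (simp add: conj_by_def m_assoc inv_mult_group)
      ultimately show ?thesis by simp
    qed
    then show "g \<otimes> k \<in> C" using g(1) k(1) by (simp add: C_def)
  qed
  have C_normal: "normalizer_of G C = carrier G"
  proof -
    have "carrier G \<subseteq> normalizer_of G C"
    proof (rule subset_normalizer_ofI[OF subgroup_self subgroup.subset[OF C]])
      fix k g assume k: "k \<in> carrier G" and "g \<in> C"
      then have g: "g \<in> carrier G" "\<And>x. x \<in> N \<Longrightarrow> conj_by G g x \<otimes> inv x \<in> R" by (auto simp: C_def)
      have "conj_by G (conj_by G k g) x \<otimes> inv x \<in> R" if x: "x \<in> N" for x
      proof -
        have c: "x \<in> carrier G" using x Nc by blast
        have "conj_by G k (conj_by G g (conj_by G (inv k) x) \<otimes> inv (conj_by G (inv k) x)) \<in> R"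
          using conjR[OF k g(2)[OF conjN[of "inv k" x]]] x k by simp
        moreover have "conj_by G k (conj_by G g (conj_by G (inv k) x) \<otimes> inv (conj_by G (inv k) x)) = conj_by G (conj_by G k g) x \<otimes> inv x"
          using c g(1) k by (simp add: conj_by_def m_assoc inv_mult_group)
        ultimately show ?thesis by simp
      qed
      then show "conj_by G k g \<in> C" using k g(1) by (simp add: C_def)
    qed
    then show ?thesis using normalizer_of_subset by blast
  qed
  have SN: "S \<inter> N \<subseteq> R"
  proof (rule R(5))
    show I: "subgroup (S \<inter> N) G" using subgroups_Inter_pair[OF S(1) N(1)] .
    show "solvable_seq G (S \<inter> N)" using solvable_seq_subgroup[OF I S(1) _ S(4)] by blast
    show "N \<subseteq> normalizer_of G (S \<inter> N)"
    proof (rule subset_normalizer_ofI[OF N(1) subgroup.subset[OF I]])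
      fix z x assume "z \<in> N" "x \<in> S \<inter> N"
      then show "conj_by G z x \<in> S \<inter> N"
        using normalizer_of_mem[of z S x] S(3) M(2) conjN[of z x] Nc by blast
    qed
  qed blast
  have "S \<subseteq> C"
  proof
    fix s assume s: "s \<in> S"
    have sc: "s \<in> carrier G" using subgroup.mem_carrier[OF S(1) s] .
    have "conj_by G s x \<otimes> inv x \<in> R" if x: "x \<in> N" for x
    proof -
      have xc: "x \<in> carrier G" using x Nc by blast
      have "conj_by G s x \<otimes> inv x \<in> N"
        using subgroup.m_closed[OF N(1) conjN[OF sc x] subgroup.m_inv_closed[OF N(1) x]] .
      moreover have "conj_by G x (inv s) \<in> S"
        using normalizer_of_mem[of x S "inv s"] S(3) M(2) x subgroup.m_inv_closed[OF S(1) s] by blast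
      then have "s \<otimes> conj_by G x (inv s) \<in> S" using subgroup.m_closed[OF S(1) s] by blast
      moreover have "s \<otimes> conj_by G x (inv s) = conj_by G s x \<otimes> inv x"
        using sc xc by (simp add: conj_by_def m_assoc)
      ultimately show ?thesis using SN by auto
    qed
    then show "s \<in> C" using sc by (simp add: C_def)
  qed
  moreover have "solvable_seq G C"
  proof -
    define D where "D = derived G (derived G C)"
    have DN: "D \<subseteq> N"
      unfolding D_def using mono_derived[OF mono_derived[OF subgroup.subset[OF C]]] der by blast
    have DC: "D \<subseteq> C" unfolding D_def using derived_incl[OF derived_incl[OF subset_refl C] C] .
    have "derived_set G D \<subseteq> R"
    proof
      fix y assume "y \<in> derived_set G D"
      then obtain a b where ab: "a \<in> D" "b \<in> D" "y = a \<otimes> b \<otimes> inv a \<otimes> inv b" by auto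
      have "conj_by G a b \<otimes> inv b \<in> R" using ab DN DC by (auto simp: C_def)
      then show "y \<in> R" using ab(3) by (simp add: conj_by_def)
    qed
    then have "derived G D \<subseteq> R" unfolding derived_def by (rule generate_subgroup_incl[OF _ R(1)])
    then have DR: "(derived G ^^ 3) C \<subseteq> R" by (simp add: D_def numeral_3_eq_3)
    obtain n where n: "(derived G ^^ n) R = {\<one>}" using solvable_imp_trivial_derived_seq[OF R(4)] by blast
    have "(derived G ^^ (n + 3)) C \<subseteq> {\<one>}"
      using mono_exp_of_derived[OF DR, of n] n by (simp add: funpow_add)
    moreover have "\<one> \<in> (derived G ^^ (n + 3)) C"
      using subgroup.one_closed[OF exp_of_derived_is_subgroup[OF C]] .
    ultimately have "(derived G ^^ (n + 3)) C = {\<one>}" by blast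
    then show ?thesis by (rule trivial_derived_seq_imp_solvable[OF C])
  qed
  then have "C \<subseteq> solvable_radical G" by (rule le_solvable_radical[OF fin C C_normal])
  ultimately show ?thesis by blast
qed

lemma derived_prime_index:
  assumes "finite (carrier G)" "subgroup L G" "subgroup Z G" "L \<subseteq> Z" "Z \<subseteq> normalizer_of G L"
    and "card Z = r * card L" "prime (r::nat)"
  shows "derived G Z \<subseteq> L"
  unfolding derived_def
proof (rule generate_subgroup_incl[OF _ assms(2)])
  show "derived_set G Z \<subseteq> L"
    using commutator_in_prime_index[OF assms] by (auto simp: conj_by_def)
qed

text \<open>Both \<open>N \<subseteq> E\<close> and \<open>E \<subseteq> carrier G\<close> have index
  \<open>1\<close> or a prime, so the second derived subgroup of \<open>G\<close> lies in
  \<open>N\<close>.\<close>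

lemma radical_of_frobenius:
  assumes fin: "finite (carrier G)" and L: "subgroup L G" and pf: "prime_frobenius G (carrier G) L"
  shows "solvable_radical (G\<lparr>carrier := L\<rparr>) \<subseteq> solvable_radical G"
proof -
  obtain N E r e where N: "subgroup N G" "subgroup E G" "N \<subseteq> L" "N \<subseteq> E" "E \<subseteq> carrier G"
     "carrier G \<subseteq> normalizer_of G N" "carrier G \<subseteq> normalizer_of G E" "prime (r::nat)"
     "card E = r * card N" "card L = e * card N" "card (carrier G) = r * e * card N" "e = 1 \<or> prime e \<and> e < r"
    using pf unfolding prime_frobenius_def by blast
  have cG: "card (carrier G) = e * card E" using N(9,11) by simp
  have "derived G (carrier G) \<subseteq> E"
  proof (cases "e = 1")
    case True
    then have "E = carrier G" using card_subset_eq[OF fin N(5)] cG by simp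
    then show ?thesis using derived_in_carrier[of "carrier G"] by simp
  next
    case False
    then show ?thesis using derived_prime_index[OF fin N(2) subgroup_self N(5,7) cG] N(12) by blast
  qed
  then have "derived G (derived G (carrier G)) \<subseteq> derived G E" by (rule mono_derived)
  also have "\<dots> \<subseteq> N" using derived_prime_index[OF fin N(1,2,4) _ N(9,8)] N(5,6) by blast
  finally have der: "derived G (derived G (carrier G)) \<subseteq> N" .
  have NN: "normalizer_of G N = carrier G" using N(6) normalizer_of_subset by blast
  show ?thesis using radical_of_metabelian_quotient[OF fin N(1) NN L N(3) der radical_restrict(1-4)[OF fin L]] .
qed

end

text \<open>In both cases of \<open>modular_dichotomy\<close> the radical of \<open>L\<close> lies in that of
  \<open>G\<close>, and the induction hypothesis applies to \<open>M\<close> as a modular subgroup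
  of \<open>L\<close>.\<close>

theorem radical_of_modular:
  assumes "group G" "finite (carrier G)" "modular_subgroup M G"
  shows "solvable_radical (G\<lparr>carrier := M\<rparr>) \<subseteq> solvable_radical G"
  using assms
proof (induction "card (carrier G)" arbitrary: G rule: less_induct)
  case less
  interpret group G by fact
  note fin = less.prems(2)
  show ?case
  proof (cases "M = carrier G")
    case False
    then obtain L where L: "subgroup L G" "M \<subseteq> L" "L \<noteq> carrier G"
      "L \<lhd> G \<or> hereditarily_primitive G (carrier G) L"
      using modular_dichotomy[OF fin less.prems(3)] by blast
    have "card L < card (carrier G)"
      using L(3) subgroup.subset[OF L(1)] fin by (intro psubset_card_mono) auto
    then have "solvable_radical (G\<lparr>carrier := L, carrier := M\<rparr>) \<subseteq> solvable_radical (G\<lparr>carrier := L\<rparr>)"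
      using less.hyps[of "G\<lparr>carrier := L\<rparr>"] subgroup_imp_group[OF L(1)] finite_subgroup[OF fin L(1)]
        modular_restrict[OF less.prems(3) L(1,2)] by simp
    then have 1: "solvable_radical (G\<lparr>carrier := M\<rparr>) \<subseteq> solvable_radical (G\<lparr>carrier := L\<rparr>)" by simp
    from L(4) have "solvable_radical (G\<lparr>carrier := L\<rparr>) \<subseteq> solvable_radical G"
    proof
      assume "L \<lhd> G"
      then have "normalizer_of G L = carrier G" using normal_iff_normalizer[OF L(1)] by blast
      note rc = radical_characteristic[OF fin L(1) this]
      show ?thesis
        using le_solvable_radical[OF fin radical_restrict(1)[OF fin L(1)] rc radical_restrict(4)[OF fin L(1)]] .
    next
      assume "hereditarily_primitive G (carrier G) L"
      then show ?thesis using radical_of_frobenius[OF fin L(1) hereditarily_primitive_frobenius[OF fin]] by blast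
    qed
    then show ?thesis using 1 by blast
  qed simp
qed

theorem corollary2p2:
  fixes G :: "('a, 'b) monoid_scheme" and A :: "'a set"
  assumes "group G" and "finite (carrier G)"
    and "subgroup A G" and "solvable (G\<lparr>carrier := A\<rparr>)"
    and "submodular_subgroup A G"
  shows "A \<subseteq> solvable_radical G \<and>
    (\<forall>B. subgroup B G \<longrightarrow> solvable (G\<lparr>carrier := B\<rparr>) \<longrightarrow>
       solvable (G\<lparr>carrier := generate G (A \<union> B)\<rparr>))"
proof -
  interpret group G by fact
  note fin = assms(2)
  obtain n H where H: "H (0::nat) = A" "H n = carrier G" "\<And>i. i \<le> n \<Longrightarrow> subgroup (H i) G"
    "\<And>i. i < n \<Longrightarrow> modular_subgroup (H i) (G\<lparr>carrier := H (Suc i)\<rparr>)"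
    using assms(5) unfolding submodular_subgroup_def by blast
  have sA: "solvable_seq G A" using assms(4) solvable_restrict_iff[OF assms(3)] by simp
  have "A \<subseteq> solvable_radical (G\<lparr>carrier := H i\<rparr>)" if "i \<le> n" for i
    using that
  proof (induction i)
    case 0
    show ?case
      using radical_restrict(5)[OF fin assms(3) assms(3) subset_refl subgroup_le_normalizer[OF assms(3)] sA] H(1) by simp
  next
    case (Suc i)
    have S: "subgroup (H (Suc i)) G" using H(3) Suc.prems by blast
    have "solvable_radical (G\<lparr>carrier := H (Suc i), carrier := H i\<rparr>) \<subseteq> solvable_radical (G\<lparr>carrier := H (Suc i)\<rparr>)"
      using radical_of_modular[OF subgroup_imp_group[OF S]] finite_subgroup[OF fin S] H(4)[of i] Suc.prems by simp
    then show ?case using Suc by simp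
  qed
  from this[of n] have A: "A \<subseteq> solvable_radical G" using H(2) by simp
  define R where "R = solvable_radical G"
  have R: "R \<lhd> G" "solvable_seq G R"
    unfolding R_def using solvable_radical_greatest(1)[OF fin] radical_restrict(4)[OF fin subgroup_self] by auto
  have "solvable (G\<lparr>carrier := generate G (A \<union> B)\<rparr>)" if B: "subgroup B G" "solvable (G\<lparr>carrier := B\<rparr>)" for B
  proof -
    note RG = normal_imp_subgroup[OF R(1)]
    have "B \<subseteq> normalizer_of G R" using normal_iff_normalizer[OF RG] R(1) subgroup.subset[OF B(1)] by blast
    note RB = subgroup_set_mult_normalizer[OF RG B(1) this]
    have sRB: "solvable_seq G (R <#>\<^bsub>G\<^esub> B)"
      using solvable_seq_normal_mult[OF R B(1)] B(2) solvable_restrict_iff[OF B(1)] by simp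
    have AB: "A \<union> B \<subseteq> carrier G" using subgroup.subset[OF assms(3)] subgroup.subset[OF B(1)] by blast
    have "A \<union> B \<subseteq> R <#>\<^bsub>G\<^esub> B" using A RB(2,3) unfolding R_def by blast
    then have "generate G (A \<union> B) \<subseteq> R <#>\<^bsub>G\<^esub> B" by (rule generate_subgroup_incl[OF _ RB(1)])
    then have "solvable_seq G (generate G (A \<union> B))"
      using solvable_seq_subgroup[OF generate_is_subgroup[OF AB] RB(1) _ sRB] by blast
    then show ?thesis using solvable_restrict_iff[OF generate_is_subgroup[OF AB]] by simp
  qed
  then show ?thesis using A by blast
qed

end
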